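(* On a mean curvature zero spacelike Lagrangian immersion of a surface in a four-dimensional para-Kähler manifold of constant para-holomorphic sectional curvature $4c$ there is induced an exact Riemannian Einstein AH structure with scalar curvature $2c$.
   Context: A para-Kähler manifold $(N,g,J)$: $J_i{}^pJ_p{}^j=\delta_i{}^j$, $g$ is a split signature metric, and $\Omega_{ij}=J_i{}^pg_{pj}$ is a symplectic form, with $J$ parallel for the Levi-Civita connection of $g$. With the convention $2\nabla_{[i}\nabla_{j]}X^k=R_{ijp}{}^kX^p$, it has constant para-holomorphic sectional curvature $4c$ if $R_{ijk}{}^l=2c(\delta_{[i}{}^lg_{j]k}-J_{[i}{}^l\Omega_{j]k}+\Omega_{ij}J_k{}^l)$. An immersed submanifold is spacelike if the induced metric is positive definite. For a Lagrangian immersion $i:M\to N$ with induced metric $h=i^*(g)$, the normal-bundle-valued second fundamental form $\Pi(X,Y)$ is identified with the completely symmetric tensor $\Pi(X,Y,Z)=\Omega(\Pi(X,Y),Z)$ on $M$; mean curvature zero means $h^{pq}\Pi_{ipq}=0$. An AH structure on a surface is a pair $([\nabla],[h])$ of a projective structure (class of torsion-free affine connections with the same unparametrized geodesics) and a conformal structure; it is Riemannian if $[h]$ is. Let $H_{ij}=|\det h|^{-1/2}h_{ij}$ (independent of $h\in[h]$), with inverse $H^{ij}$. The aligned representative is the unique torsion-free $\nabla\in[\nabla]$ with $\nabla_{[i}H_{j]k}=0$; henceforth $\nabla$ denotes it. With $R_{ij}=R_{pij}{}^p$ its Ricci tensor, $R=H^{ij}R_{ij}$ (a $1$-density), $\mathsf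 R_h=h^{ij}R_{ij}$, $F_{ij}=-R_{[ij]}$. The AH structure is Einstein if $R_{(ij)}=\tfrac12RH_{ij}$ and $\nabla_iR+2H^{pq}\nabla_qF_{ip}=0$; it is exact if some $h\in[h]$ satisfies $\nabla|\det h|=0$. The structure referred to as induced is the pair $([\nabla],[h])$ where $h=i^*(g)$, $D$ is the Levi-Civita connection of $h$, $B_{ijk}$ is the completely $h$-trace-free part of $\Pi_{ijk}$, and $[\nabla]$ is the projective structure generated by $\nabla=D-B_{ijp}h^{pk}$; its scalar curvature is measured with respect to $h$, i.e. as $\mathsf R_h$. *)

theory Defs
  imports "HOL-Analysis.Analysis"
begin

section \<open>Smooth manifolds\<close>

text \<open>Only meaningful on open sets \<open>S\<close>.\<close>

primrec Ck_on :: "nat \<Rightarrow> 'a::real_normed_vector set \<Rightarrow> ('a \<Rightarrow> 'b::real_normed_vector) \<Rightarrow> bool" where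
  "Ck_on 0 S f \<longleftrightarrow> continuous_on S f"
| "Ck_on (Suc k) S f \<longleftrightarrow> (\<forall>x\<in>S. f differentiable (at x)) \<and>
     (\<forall>v. Ck_on k S (\<lambda>x. frechet_derivative f (at x) v))"

definition smooth_on :: "'a::real_normed_vector set \<Rightarrow> ('a \<Rightarrow> 'b::real_normed_vector) \<Rightarrow> bool" where
  "smooth_on S f \<longleftrightarrow> (\<forall>k. Ck_on k S f)"

text \<open>A chart is a domain together with its coordinate map; the values of the coordinate map
  outside the domain are irrelevant. A manifold is a Hausdorff, second countable type with an
  atlas; the atlas need not be maximal.\<close>

type_synonym ('m, 'n) chart = "'m set \<times> ('m \<Rightarrow> real ^ 'n)"

definition chart_inv :: "('m, 'n) chart \<Rightarrow> real ^ 'n \<Rightarrow> 'm" where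
  "chart_inv x = inv_into (fst x) (snd x)"

definition smooth_manifold ::
  "('m::{t2_space, second_countable_topology}, 'n::finite) chart set \<Rightarrow> bool" where
  "smooth_manifold A \<longleftrightarrow>
     (\<Union>x\<in>A. fst x) = UNIV \<and>
     (\<forall>x\<in>A. open (fst x) \<and> open (snd x ` fst x) \<and>
        homeomorphism (fst x) (snd x ` fst x) (snd x) (chart_inv x)) \<and>
     (\<forall>x\<in>A. \<forall>y\<in>A. smooth_on (snd x ` (fst x \<inter> fst y)) (snd y \<circ> chart_inv x))"

definition smooth_in :: "('m, 'n::finite) chart \<Rightarrow> ('m \<Rightarrow> 'b::real_normed_vector) \<Rightarrow> bool" where
  "smooth_in x u \<longleftrightarrow> smooth_on (snd x ` fst x) (u \<circ> chart_inv x)"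

text \<open>\<open>pd x i u\<close> is the partial derivative of \<open>u\<close> in the \<open>i\<close>-th coordinate direction
  of the chart \<open>x\<close>, as a function on the manifold.\<close>

definition pd :: "('m, 'n::finite) chart \<Rightarrow> 'n \<Rightarrow> ('m \<Rightarrow> real) \<Rightarrow> 'm \<Rightarrow> real" where
  "pd x i u p = frechet_derivative (u \<circ> chart_inv x) (at (snd x p)) (axis i 1)"

text \<open>\<open>dmap x y f p i a\<close> is the component \<open>\<partial>f\<^sup>a / \<partial>x\<^sup>i\<close> of the differential
  of \<open>f\<close> with respect to a chart \<open>x\<close> around \<open>p\<close> and a chart \<open>y\<close> around \<open>f p\<close>;
  for \<open>f = id\<close> this is the Jacobian of a change of coordinates.\<close>

definition dmap :: "('m, 'n::finite) chart \<Rightarrow> ('p, 'k::finite) chart \<Rightarrow> ('m \<Rightarrow> 'p) \<Rightarrow> 'm \<Rightarrow> 'n \<Rightarrow> 'k \<Rightarrow> real" where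
  "dmap x y f p i a = pd x i (\<lambda>q. snd y (f q) $ a) p"

definition smooth_map ::
  "('m::topological_space, 'n::finite) chart set \<Rightarrow> ('p::topological_space, 'k::finite) chart set \<Rightarrow> ('m \<Rightarrow> 'p) \<Rightarrow> bool" where
  "smooth_map A B f \<longleftrightarrow> continuous_on UNIV f \<and>
     (\<forall>x\<in>A. \<forall>y\<in>B. smooth_on (snd x ` (fst x \<inter> f -` fst y)) (snd y \<circ> f \<circ> chart_inv x))"

definition immersion ::
  "('m::topological_space, 'n::finite) chart set \<Rightarrow> ('p::topological_space, 'k::finite) chart set \<Rightarrow> ('m \<Rightarrow> 'p) \<Rightarrow> bool" where
  "immersion A B f \<longleftrightarrow> smooth_map A B f \<and>
     (\<forall>x\<in>A. \<forall>y\<in>B. \<forall>p\<in>fst x \<inter> f -` fst y.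
        inj (frechet_derivative (snd y \<circ> f \<circ> chart_inv x) (at (snd x p))))"


section \<open>Tensors and connections\<close>

text \<open>Tensor fields and connections are families of components, one for each chart of the atlas,
  that are smooth and obey the transformation law on overlaps. Components are meaningful only for
  charts \<open>x \<in> A\<close> and points \<open>p \<in> fst x\<close>.\<close>

type_synonym ('m, 'n) field2 = "('m, 'n) chart \<Rightarrow> 'm \<Rightarrow> real ^ 'n ^ 'n"
type_synonym ('m, 'n) field3 = "('m, 'n) chart \<Rightarrow> 'm \<Rightarrow> 'n \<Rightarrow> 'n \<Rightarrow> 'n \<Rightarrow> real"

text \<open>Components \<open>T x p $ i $ j = T\<^sub>i\<^sub>j\<close>.\<close>

definition covariant2 :: "('m, 'n::finite) chart set \<Rightarrow> ('m, 'n) field2 \<Rightarrow> bool" where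
  "covariant2 A T \<longleftrightarrow>
     (\<forall>x\<in>A. smooth_in x (T x)) \<and>
     (\<forall>x\<in>A. \<forall>y\<in>A. \<forall>p\<in>fst x \<inter> fst y. \<forall>i j.
        T x p $ i $ j = (\<Sum>a\<in>UNIV. \<Sum>b\<in>UNIV. dmap x y id p i a * dmap x y id p j b * T y p $ a $ b))"

text \<open>Components \<open>T x p $ i $ j = T\<^sub>i\<^sup>j\<close>.\<close>

definition endomorphism :: "('m, 'n::finite) chart set \<Rightarrow> ('m, 'n) field2 \<Rightarrow> bool" where
  "endomorphism A T \<longleftrightarrow>
     (\<forall>x\<in>A. smooth_in x (T x)) \<and>
     (\<forall>x\<in>A. \<forall>y\<in>A. \<forall>p\<in>fst x \<inter> fst y. \<forall>i j.
        T x p $ i $ j = (\<Sum>a\<in>UNIV. \<Sum>b\<in>UNIV. dmap x y id p i a * T y p $ a $ b * dmap y x id p b j))"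

text \<open>Components \<open>G x p i j k = \<Gamma>\<^sub>i\<^sub>j\<^sup>k\<close>, with the convention
  \<open>\<nabla>\<^sub>i X\<^sup>k = \<partial>\<^sub>i X\<^sup>k + \<Gamma>\<^sub>i\<^sub>j\<^sup>k X\<^sup>j\<close>.\<close>

definition connection :: "('m, 'n::finite) chart set \<Rightarrow> ('m, 'n) field3 \<Rightarrow> bool" where
  "connection A G \<longleftrightarrow>
     (\<forall>x\<in>A. \<forall>i j k. smooth_in x (\<lambda>p. G x p i j k)) \<and>
     (\<forall>x\<in>A. \<forall>y\<in>A. \<forall>p\<in>fst x \<inter> fst y. \<forall>i j a.
        pd x i (\<lambda>q. dmap x y id q j a) p
          + (\<Sum>b\<in>UNIV. \<Sum>c\<in>UNIV. G y p b c a * dmap x y id p i b * dmap x y id p j c)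
        = (\<Sum>k\<in>UNIV. G x p i j k * dmap x y id p k a))"

definition torsion_free_connection :: "('m, 'n::finite) chart set \<Rightarrow> ('m, 'n) field3 \<Rightarrow> bool" where
  "torsion_free_connection A G \<longleftrightarrow> connection A G \<and>
     (\<forall>x\<in>A. \<forall>p\<in>fst x. \<forall>i j k. G x p i j k = G x p j i k)"

text \<open>Covariant derivatives \<open>\<nabla>\<^sub>i s\<close> and \<open>\<nabla>\<^sub>i T\<^sub>j\<^sub>k\<close> of a density, respectively of a
  covariant 2-tensor with values in densities, of weight \<open>w\<close>. The weight is normalized so that
  a volume density has weight 1 and \<open>\<bar>det h\<bar>\<close> has weight 2.\<close>

definition cov_density :: "('m, 'n::finite) field3 \<Rightarrow> real \<Rightarrow> (('m, 'n) chart \<Rightarrow> 'm \<Rightarrow> real)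
    \<Rightarrow> ('m, 'n) chart \<Rightarrow> 'm \<Rightarrow> 'n \<Rightarrow> real" where
  "cov_density G w s x p i = pd x i (s x) p - w * (\<Sum>r\<in>UNIV. G x p i r r) * s x p"

definition cov2 :: "('m, 'n::finite) field3 \<Rightarrow> real \<Rightarrow> ('m, 'n) field2 \<Rightarrow> ('m, 'n) field3" where
  "cov2 G w T x p i j k = pd x i (\<lambda>q. T x q $ j $ k) p
     - (\<Sum>r\<in>UNIV. G x p i j r * T x p $ r $ k)
     - (\<Sum>r\<in>UNIV. G x p i k r * T x p $ j $ r)
     - w * (\<Sum>r\<in>UNIV. G x p i r r) * T x p $ j $ k"

text \<open>\<open>\<nabla>\<^sub>i T\<^sub>j\<^sup>k\<close>\<close>

definition cov_endo :: "('m, 'n::finite) field3 \<Rightarrow> ('m, 'n) field2 \<Rightarrow> ('m, 'n) field3" where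
  "cov_endo G T x p i j k = pd x i (\<lambda>q. T x q $ j $ k) p
     - (\<Sum>r\<in>UNIV. G x p i j r * T x p $ r $ k)
     + (\<Sum>r\<in>UNIV. G x p i r k * T x p $ j $ r)"

text \<open>\<open>curvature G x p i j k l = R\<^sub>i\<^sub>j\<^sub>k\<^sup>l\<close>: the coordinate expression of
  \<open>(\<nabla>\<^sub>i \<nabla>\<^sub>j - \<nabla>\<^sub>j \<nabla>\<^sub>i) X\<^sup>l = R\<^sub>i\<^sub>j\<^sub>k\<^sup>l X\<^sup>k\<close> for torsion-free \<open>G\<close>.\<close>

definition curvature :: "('m, 'n::finite) field3 \<Rightarrow> ('m, 'n) chart \<Rightarrow> 'm \<Rightarrow> 'n \<Rightarrow> 'n \<Rightarrow> 'n \<Rightarrow> 'n \<Rightarrow> real" where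
  "curvature G x p i j k l =
     pd x i (\<lambda>q. G x q j k l) p - pd x j (\<lambda>q. G x q i k l) p
     + (\<Sum>r\<in>UNIV. G x p i r l * G x p j k r - G x p j r l * G x p i k r)"

text \<open>\<open>R\<^sub>i\<^sub>j = R\<^sub>p\<^sub>i\<^sub>j\<^sup>p\<close>\<close>

definition ricci :: "('m, 'n::finite) field3 \<Rightarrow> ('m, 'n) field2" where
  "ricci G x p = (\<chi> i j. \<Sum>r\<in>UNIV. curvature G x p r i j r)"


section \<open>Metrics\<close>

definition pseudo_metric :: "('m, 'n::finite) chart set \<Rightarrow> ('m, 'n) field2 \<Rightarrow> bool" where
  "pseudo_metric A g \<longleftrightarrow> covariant2 A g \<and>
     (\<forall>x\<in>A. \<forall>p\<in>fst x. transpose (g x p) = g x p \<and> invertible (g x p))"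

definition positive_definite :: "('m, 'n::finite) chart set \<Rightarrow> ('m, 'n) field2 \<Rightarrow> bool" where
  "positive_definite A h \<longleftrightarrow> (\<forall>x\<in>A. \<forall>p\<in>fst x. \<forall>v. v \<noteq> 0 \<longrightarrow> v \<bullet> (h x p *v v) > 0)"

definition split_signature :: "('m, 'n::finite) chart set \<Rightarrow> ('m, 'n) field2 \<Rightarrow> bool" where
  "split_signature A g \<longleftrightarrow> (\<forall>x\<in>A. \<forall>p\<in>fst x. \<exists>V W.
     subspace V \<and> subspace W \<and> 2 * dim V = CARD('n) \<and> 2 * dim W = CARD('n) \<and>
     (\<forall>v\<in>V. v \<noteq> 0 \<longrightarrow> v \<bullet> (g x p *v v) > 0) \<and> (\<forall>w\<in>W. w \<noteq> 0 \<longrightarrow> w \<bullet> (g x p *v w) < 0))"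

definition is_levi_civita :: "('m, 'n::finite) chart set \<Rightarrow> ('m, 'n) field2 \<Rightarrow> ('m, 'n) field3 \<Rightarrow> bool" where
  "is_levi_civita A g G \<longleftrightarrow> torsion_free_connection A G \<and>
     (\<forall>x\<in>A. \<forall>p\<in>fst x. \<forall>i j k. cov2 G 0 g x p i j k = 0)"

text \<open>The Levi-Civita connection is unique on all \<open>x \<in> A\<close>, \<open>p \<in> fst x\<close>; the choice operator
  only affects the irrelevant values elsewhere.\<close>

definition levi_civita :: "('m, 'n::finite) chart set \<Rightarrow> ('m, 'n) field2 \<Rightarrow> ('m, 'n) field3" where
  "levi_civita A g = (SOME G. is_levi_civita A g G)"


section \<open>Para-Kaehler manifolds\<close>

text \<open>\<open>\<Omega>\<^sub>i\<^sub>j = J\<^sub>i\<^sup>p g\<^sub>p\<^sub>j\<close>\<close>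

definition kaehler_form :: "('m, 'n::finite) field2 \<Rightarrow> ('m, 'n) field2 \<Rightarrow> ('m, 'n) field2" where
  "kaehler_form g J x p = J x p ** g x p"

definition symplectic :: "('m, 'n::finite) chart set \<Rightarrow> ('m, 'n) field2 \<Rightarrow> bool" where
  "symplectic A w \<longleftrightarrow> covariant2 A w \<and>
     (\<forall>x\<in>A. \<forall>p\<in>fst x. transpose (w x p) = - w x p \<and> invertible (w x p) \<and>
        (\<forall>i j k. pd x i (\<lambda>q. w x q $ j $ k) p + pd x j (\<lambda>q. w x q $ k $ i) p
               + pd x k (\<lambda>q. w x q $ i $ j) p = 0))"

definition para_kaehler :: "('m::{t2_space, second_countable_topology}, 'n::finite) chart set
    \<Rightarrow> ('m, 'n) field2 \<Rightarrow> ('m, 'n) field2 \<Rightarrow> bool" where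
  "para_kaehler A g J \<longleftrightarrow> smooth_manifold A \<and>
     endomorphism A J \<and> (\<forall>x\<in>A. \<forall>p\<in>fst x. J x p ** J x p = mat 1) \<and>
     pseudo_metric A g \<and> split_signature A g \<and>
     symplectic A (kaehler_form g J) \<and>
     (\<forall>x\<in>A. \<forall>p\<in>fst x. \<forall>i j k. cov_endo (levi_civita A g) J x p i j k = 0)"

text \<open>With \<open>s = 4 c\<close> and the square brackets expanded,
  \<open>R\<^sub>i\<^sub>j\<^sub>k\<^sup>l = 2 c (\<delta>\<^sub>[\<^sub>i\<^sup>l g\<^sub>j\<^sub>]\<^sub>k - J\<^sub>[\<^sub>i\<^sup>l \<Omega>\<^sub>j\<^sub>]\<^sub>k + \<Omega>\<^sub>i\<^sub>j J\<^sub>k\<^sup>l)\<close>.\<close>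

definition constant_para_holomorphic_curvature :: "('m, 'n::finite) chart set
    \<Rightarrow> ('m, 'n) field2 \<Rightarrow> ('m, 'n) field2 \<Rightarrow> real \<Rightarrow> bool" where
  "constant_para_holomorphic_curvature A g J s \<longleftrightarrow>
     (\<forall>x\<in>A. \<forall>p\<in>fst x. \<forall>i j k l.
        let gp = g x p; Jp = J x p; W = kaehler_form g J x p; \<delta> = mat 1 :: real ^ 'n ^ 'n in
        curvature (levi_civita A g) x p i j k l =
          (s / 2) * ((\<delta> $ i $ l * gp $ j $ k - \<delta> $ j $ l * gp $ i $ k) / 2
                   - (Jp $ i $ l * W $ j $ k - Jp $ j $ l * W $ i $ k) / 2
                   + W $ i $ j * Jp $ k $ l))"


section \<open>Geometry of an immersed submanifold\<close>

definition chart_at :: "('m, 'n) chart set \<Rightarrow> 'm \<Rightarrow> ('m, 'n) chart" where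
  "chart_at A p = (SOME x. x \<in> A \<and> p \<in> fst x)"

text \<open>The pullback \<open>f\<^sup>*(T)\<close>. For a tensor \<open>T\<close> it does not depend on the chart
  used around \<open>f p\<close>.\<close>

definition pullback :: "('p, 'k::finite) chart set \<Rightarrow> ('m \<Rightarrow> 'p) \<Rightarrow> ('p, 'k) field2 \<Rightarrow> ('m, 'n::finite) field2" where
  "pullback B f T x p = (let y = chart_at B (f p) in
     \<chi> i j. \<Sum>a\<in>UNIV. \<Sum>b\<in>UNIV. dmap x y f p i a * dmap x y f p j b * T y (f p) $ a $ b)"

definition spacelike :: "('m, 'n::finite) chart set \<Rightarrow> ('p, 'k::finite) chart set \<Rightarrow> ('p, 'k) field2 \<Rightarrow> ('m \<Rightarrow> 'p) \<Rightarrow> bool" where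
  "spacelike A B g f \<longleftrightarrow> positive_definite A (pullback B f g)"

definition lagrangian :: "('m, 'n::finite) chart set \<Rightarrow> ('p, 'k::finite) chart set \<Rightarrow> ('p, 'k) field2 \<Rightarrow> ('m \<Rightarrow> 'p) \<Rightarrow> bool" where
  "lagrangian A B w f \<longleftrightarrow> 2 * CARD('n) = CARD('k) \<and> (\<forall>x\<in>A. \<forall>p\<in>fst x. pullback B f w x p = 0)"

text \<open>Component \<open>a\<close> of \<open>\<nabla>\<^sub>X f\<^sub>* Y\<close> for the coordinate fields \<open>X = \<partial>\<^sub>i\<close>, \<open>Y = \<partial>\<^sub>j\<close>,
  where \<open>\<nabla>\<close> is the Levi-Civita connection of \<open>g\<close>.\<close>

definition ambient_derivative :: "('p, 'k::finite) chart set \<Rightarrow> ('p, 'k) field2 \<Rightarrow> ('m \<Rightarrow> 'p)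
    \<Rightarrow> ('m, 'n::finite) chart \<Rightarrow> 'm \<Rightarrow> 'n \<Rightarrow> 'n \<Rightarrow> 'k \<Rightarrow> real" where
  "ambient_derivative B g f x p i j a = (let y = chart_at B (f p) in
     pd x i (\<lambda>q. dmap x y f q j a) p
     + (\<Sum>b\<in>UNIV. \<Sum>c\<in>UNIV. levi_civita B g y (f p) b c a * dmap x y f p i b * dmap x y f p j c))"

text \<open>The component \<open>v - h\<^sup>k\<^sup>l g(v, f\<^sub>* \<partial>\<^sub>l) f\<^sub>* \<partial>\<^sub>k\<close> of \<open>v\<close> normal to the immersion,
  where \<open>h = f\<^sup>*(g)\<close>.\<close>

definition normal_part :: "('p, 'k::finite) chart set \<Rightarrow> ('p, 'k) field2 \<Rightarrow> ('m \<Rightarrow> 'p)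
    \<Rightarrow> ('m, 'n::finite) chart \<Rightarrow> 'm \<Rightarrow> ('k \<Rightarrow> real) \<Rightarrow> 'k \<Rightarrow> real" where
  "normal_part B g f x p v a = (let y = chart_at B (f p) in
     v a - (\<Sum>k\<in>UNIV. \<Sum>l\<in>UNIV. matrix_inv (pullback B f g x p) $ k $ l
              * (\<Sum>b\<in>UNIV. \<Sum>c\<in>UNIV. g y (f p) $ b $ c * v b * dmap x y f p l c)
              * dmap x y f p k a))"

text \<open>\<open>\<Pi>(\<partial>\<^sub>i, \<partial>\<^sub>j)\<close>, the normal part of \<open>\<nabla>\<^sub>X f\<^sub>* Y\<close>, and
  \<open>\<Pi>\<^sub>i\<^sub>j\<^sub>k = \<Omega>(\<Pi>(\<partial>\<^sub>i, \<partial>\<^sub>j), f\<^sub>* \<partial>\<^sub>k)\<close>.\<close>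

definition second_ff :: "('p, 'k::finite) chart set \<Rightarrow> ('p, 'k) field2 \<Rightarrow> ('m \<Rightarrow> 'p)
    \<Rightarrow> ('m, 'n::finite) chart \<Rightarrow> 'm \<Rightarrow> 'n \<Rightarrow> 'n \<Rightarrow> 'k \<Rightarrow> real" where
  "second_ff B g f x p i j = normal_part B g f x p (ambient_derivative B g f x p i j)"

definition second_ff3 :: "('p, 'k::finite) chart set \<Rightarrow> ('p, 'k) field2 \<Rightarrow> ('p, 'k) field2 \<Rightarrow> ('m \<Rightarrow> 'p)
    \<Rightarrow> ('m, 'n::finite) field3" where
  "second_ff3 B g J f x p i j k = (let y = chart_at B (f p) in
     \<Sum>a\<in>UNIV. \<Sum>b\<in>UNIV. kaehler_form g J y (f p) $ a $ b
        * second_ff B g f x p i j a * dmap x y f p k b)"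

text \<open>\<open>h\<^sup>p\<^sup>q T\<^sub>i\<^sub>p\<^sub>q\<close>\<close>

definition trace3 :: "('m, 'n::finite) field2 \<Rightarrow> ('m, 'n) field3 \<Rightarrow> ('m, 'n) chart \<Rightarrow> 'm \<Rightarrow> 'n \<Rightarrow> real" where
  "trace3 h T x p i = (\<Sum>k\<in>UNIV. \<Sum>l\<in>UNIV. matrix_inv (h x p) $ k $ l * T x p i k l)"

definition mean_curvature_zero :: "('m, 'n::finite) chart set \<Rightarrow> ('p, 'k::finite) chart set
    \<Rightarrow> ('p, 'k) field2 \<Rightarrow> ('p, 'k) field2 \<Rightarrow> ('m \<Rightarrow> 'p) \<Rightarrow> bool" where
  "mean_curvature_zero A B g J f \<longleftrightarrow>
     (\<forall>x\<in>A. \<forall>p\<in>fst x. \<forall>i. trace3 (pullback B f g) (second_ff3 B g J f) x p i = 0)"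

text \<open>The completely trace-free part of a completely symmetric tensor \<open>T\<close> in dimension \<open>n\<close>:
  \<open>T\<^sub>i\<^sub>j\<^sub>k - (h\<^sub>i\<^sub>j t\<^sub>k + h\<^sub>j\<^sub>k t\<^sub>i + h\<^sub>k\<^sub>i t\<^sub>j) / (n + 2)\<close>, where \<open>t\<close> is the trace
  of \<open>T\<close>.\<close>

definition trace_free_part :: "('m, 'n::finite) field2 \<Rightarrow> ('m, 'n) field3 \<Rightarrow> ('m, 'n) field3" where
  "trace_free_part h T x p i j k = T x p i j k -
     (h x p $ i $ j * trace3 h T x p k + h x p $ j $ k * trace3 h T x p i
      + h x p $ k $ i * trace3 h T x p j) / (real CARD('n) + 2)"


section \<open>Projective and conformal structures\<close>

definition geodesic :: "('m::topological_space, 'n::finite) chart set \<Rightarrow> ('m, 'n) field3 \<Rightarrow> real set \<Rightarrow> (real \<Rightarrow> 'm) \<Rightarrow> bool" where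
  "geodesic A G I \<gamma> \<longleftrightarrow> open I \<and> is_interval I \<and> I \<noteq> {} \<and> continuous_on I \<gamma> \<and>
     (\<forall>x\<in>A. smooth_on (I \<inter> \<gamma> -` fst x) (snd x \<circ> \<gamma>) \<and>
        (\<forall>t\<in>I \<inter> \<gamma> -` fst x. \<forall>k.
           deriv (deriv (\<lambda>s. snd x (\<gamma> s) $ k)) t
           + (\<Sum>i\<in>UNIV. \<Sum>j\<in>UNIV. G x (\<gamma> t) i j k
                * deriv (\<lambda>s. snd x (\<gamma> s) $ i) t * deriv (\<lambda>s. snd x (\<gamma> s) $ j) t) = 0))"

definition unparametrized_geodesic :: "('m::topological_space, 'n::finite) chart set \<Rightarrow> ('m, 'n) field3
    \<Rightarrow> real set \<Rightarrow> (real \<Rightarrow> 'm) \<Rightarrow> bool" where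
  "unparametrized_geodesic A G I \<gamma> \<longleftrightarrow> (\<exists>K \<tau>.
     bij_betw \<tau> K I \<and> smooth_on K \<tau> \<and> (\<forall>t\<in>K. deriv \<tau> t \<noteq> 0) \<and> geodesic A G K (\<gamma> \<circ> \<tau>))"

definition projective_class :: "('m::topological_space, 'n::finite) chart set \<Rightarrow> ('m, 'n) field3 \<Rightarrow> ('m, 'n) field3 set" where
  "projective_class A G = {G'. torsion_free_connection A G' \<and>
     (\<forall>I \<gamma>. unparametrized_geodesic A G' I \<gamma> \<longleftrightarrow> unparametrized_geodesic A G I \<gamma>)}"

definition projective_structure :: "('m::topological_space, 'n::finite) chart set \<Rightarrow> ('m, 'n) field3 set \<Rightarrow> bool" where
  "projective_structure A P \<longleftrightarrow> (\<exists>G. torsion_free_connection A G \<and> P = projective_class A G)"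

definition conformal_class :: "('m, 'n::finite) chart set \<Rightarrow> ('m, 'n) field2 \<Rightarrow> ('m, 'n) field2 set" where
  "conformal_class A h = {h'. pseudo_metric A h' \<and>
     (\<exists>u. (\<forall>p. u p > 0) \<and> (\<forall>x\<in>A. smooth_in x u \<and> (\<forall>p\<in>fst x. h' x p = u p *\<^sub>R h x p)))}"

definition conformal_structure :: "('m, 'n::finite) chart set \<Rightarrow> ('m, 'n) field2 set \<Rightarrow> bool" where
  "conformal_structure A C \<longleftrightarrow> (\<exists>h. pseudo_metric A h \<and> C = conformal_class A h)"


section \<open>AH structures on surfaces\<close>

type_synonym 'm AH = "('m, 2) field3 set \<times> ('m, 2) field2 set"

definition AH_structure :: "('m::topological_space, 2) chart set \<Rightarrow> 'm AH \<Rightarrow> bool" where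
  "AH_structure A S \<longleftrightarrow> projective_structure A (fst S) \<and> conformal_structure A (snd S)"

definition riemannian_AH :: "('m, 2) chart set \<Rightarrow> 'm AH \<Rightarrow> bool" where
  "riemannian_AH A S \<longleftrightarrow> (\<forall>h\<in>snd S. positive_definite A h)"

text \<open>\<open>H\<^sub>i\<^sub>j = \<bar>det h\<bar>\<^sup>-\<^sup>1\<^sup>/\<^sup>2 h\<^sub>i\<^sub>j\<close>, of weight -1.\<close>

definition normalized_metric :: "('m, 2) field2 \<Rightarrow> ('m, 2) field2" where
  "normalized_metric h x p = (\<bar>det (h x p)\<bar> powr (- 1 / 2)) *\<^sub>R h x p"

text \<open>\<open>\<nabla> \<in> [\<nabla>]\<close> and \<open>\<nabla>\<^sub>[\<^sub>i H\<^sub>j\<^sub>]\<^sub>k = 0\<close>. The aligned representative of an AH structure is unique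
  (up to irrelevant values), so that existential quantification over it below amounts to a
  definite description.\<close>

definition aligned :: "('m, 2) chart set \<Rightarrow> 'm AH \<Rightarrow> ('m, 2) field3 \<Rightarrow> bool" where
  "aligned A S G \<longleftrightarrow> G \<in> fst S \<and>
     (\<forall>h\<in>snd S. \<forall>x\<in>A. \<forall>p\<in>fst x. \<forall>i j k.
        cov2 G (- 1) (normalized_metric h) x p i j k = cov2 G (- 1) (normalized_metric h) x p j i k)"

text \<open>\<open>R = H\<^sup>i\<^sup>j R\<^sub>i\<^sub>j\<close>, of weight 1, and \<open>R\<^sub>h = h\<^sup>i\<^sup>j R\<^sub>i\<^sub>j\<close>.\<close>

definition weighted_scalar :: "('m, 2) field3 \<Rightarrow> ('m, 2) field2 \<Rightarrow> ('m, 2) chart \<Rightarrow> 'm \<Rightarrow> real" where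
  "weighted_scalar G h x p =
     (\<Sum>i\<in>UNIV. \<Sum>j\<in>UNIV. matrix_inv (normalized_metric h x p) $ i $ j * ricci G x p $ i $ j)"

definition scalar_curvature :: "('m, 2) field3 \<Rightarrow> ('m, 2) field2 \<Rightarrow> ('m, 2) chart \<Rightarrow> 'm \<Rightarrow> real" where
  "scalar_curvature G h x p = (\<Sum>i\<in>UNIV. \<Sum>j\<in>UNIV. matrix_inv (h x p) $ i $ j * ricci G x p $ i $ j)"

text \<open>\<open>F\<^sub>i\<^sub>j = - R\<^sub>[\<^sub>i\<^sub>j\<^sub>]\<close>\<close>

definition faraday :: "('m, 2) field3 \<Rightarrow> ('m, 2) field2" where
  "faraday G x p = (\<chi> i j. - (ricci G x p $ i $ j - ricci G x p $ j $ i) / 2)"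

definition einstein_AH :: "('m, 2) chart set \<Rightarrow> 'm AH \<Rightarrow> bool" where
  "einstein_AH A S \<longleftrightarrow> (\<exists>G. aligned A S G \<and>
     (\<forall>h\<in>snd S. \<forall>x\<in>A. \<forall>p\<in>fst x.
        (\<forall>i j. (ricci G x p $ i $ j + ricci G x p $ j $ i) / 2
               = 1 / 2 * weighted_scalar G h x p * normalized_metric h x p $ i $ j) \<and>
        (\<forall>i. cov_density G 1 (weighted_scalar G h) x p i
               + 2 * (\<Sum>r\<in>UNIV. \<Sum>s\<in>UNIV. matrix_inv (normalized_metric h x p) $ r $ s
                        * cov2 G 0 (faraday G) x p s i r) = 0)))"

definition exact_AH :: "('m, 2) chart set \<Rightarrow> 'm AH \<Rightarrow> bool" where
  "exact_AH A S \<longleftrightarrow> (\<exists>G. aligned A S G \<and> (\<exists>h\<in>snd S. \<forall>x\<in>A. \<forall>p\<in>fst x. \<forall>i.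
     cov_density G 2 (\<lambda>x p. \<bar>det (h x p)\<bar>) x p i = 0))"


section \<open>The induced structure\<close>

text \<open>\<open>\<nabla> = D - B\<^sub>i\<^sub>j\<^sub>p h\<^sup>p\<^sup>k\<close>\<close>

definition induced_connection :: "('m, 2) chart set \<Rightarrow> ('p, 4) chart set \<Rightarrow> ('p, 4) field2
    \<Rightarrow> ('p, 4) field2 \<Rightarrow> ('m \<Rightarrow> 'p) \<Rightarrow> ('m, 2) field3" where
  "induced_connection A B g J f x p i j k = (let h = pullback B f g in
     levi_civita A h x p i j k
     - (\<Sum>r\<in>UNIV. trace_free_part h (second_ff3 B g J f) x p i j r * matrix_inv (h x p) $ r $ k))"

definition induced_AH :: "('m::topological_space, 2) chart set \<Rightarrow> ('p, 4) chart set \<Rightarrow> ('p, 4) field2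
    \<Rightarrow> ('p, 4) field2 \<Rightarrow> ('m \<Rightarrow> 'p) \<Rightarrow> 'm AH" where
  "induced_AH A B g J f =
     (projective_class A (induced_connection A B g J f), conformal_class A (pullback B f g))"

end

theory Submission
  imports Defs
begin

text \<open>Write \<open>E\<^sub>i = f\<^sub>* \<partial>\<^sub>i\<close> and \<open>P\<^sub>i = E\<^sub>i - J E\<^sub>i\<close>, a frame of the \<open>-1\<close> eigenbundle of \<open>J\<close> along the
  immersion. Since \<open>J\<close> is parallel and interchanges the tangent and the normal bundle, the ambient
  Levi-Civita connection satisfies \<open>\<nabla>\<^sub>i P\<^sub>j = \<Gamma>\<^sub>i\<^sub>j\<^sup>k P\<^sub>k\<close>, where \<open>\<Gamma> = D - B\<close> is precisely the induced
  connection. So the induced connection is the ambient one restricted to the eigenbundle, which yields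
  its smoothness, its transformation law and its curvature at once, without the Gauss and Codazzi
  equations: evaluating the ambient curvature on \<open>P\<^sub>k\<close> gives
  \<open>R\<^sub>i\<^sub>j\<^sub>k\<^sup>l = c (\<delta>\<^sub>i\<^sup>l h\<^sub>j\<^sub>k - \<delta>\<^sub>j\<^sup>l h\<^sub>i\<^sub>k)\<close>, hence \<open>R\<^sub>i\<^sub>j = c h\<^sub>i\<^sub>j\<close>. As \<open>B\<close> is trace-free and completely symmetric,
  \<open>\<Gamma>\<close> preserves \<open>det h\<close> and is aligned, and the Einstein equations follow.\<close>

section \<open>Smooth functions on open sets\<close>

text \<open>The choice of the \<open>-1\<close> eigenbundle fixes the sign: on the \<open>+1\<close>
  eigenbundle the same computation gives D + B. The eigenbundle is totally null, so coefficients in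
  the frame P cannot be read off by pairing P with itself; they are read off against E, since g(P_i,
  E_j) = h_ij. The obstacle lies in the choice operators. \<open>levi_civita\<close> is a chosen
  connection, so a witness has to be built before any of its properties is available.
  \<open>chart_at\<close> may jump from point to point, so an identity expressed through it cannot
  be differentiated. Identities along the immersion are therefore moved to an arbitrary fixed target
  chart, and smoothness is proved where the image stays in that chart and then glued. The constants:
  a para-holomorphic curvature 4c enters the curvature tensor as 2c, the antisymmetrization halves
  it, and a contraction multiplies by n - 1. On a surface this leaves c h as the Ricci tensor, whose
  h-trace is 2c.\<close>

lemma frechet_derivative_cong_open:
  assumes "open S" "x \<in> S" "\<And>z. z \<in> S \<Longrightarrow> f z = g z"
  shows "frechet_derivative f (at x) = frechet_derivative g (at x)"
proof -
  \<comment> \<open>\<open>frechet_derivative\<close> is a choice among all derivatives at x, so it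
    suffices that f and g have the same ones.\<close>
  have "(f has_derivative D) (at x) \<longleftrightarrow> (g has_derivative D) (at x)" for D
    using has_derivative_transform_within_open[of f D x UNIV S g] has_derivative_transform_within_open[of g D x UNIV S f]
      assms by auto
  then show ?thesis
    by (simp add: frechet_derivative_def)
qed

lemma differentiable_cong_open:
  assumes "open S" "x \<in> S" "\<And>z. z \<in> S \<Longrightarrow> f z = g z"
  shows "f differentiable (at x) \<longleftrightarrow> g differentiable (at x)"
proof -
  have "(f has_derivative D) (at x) \<longleftrightarrow> (g has_derivative D) (at x)" for D
    using has_derivative_transform_within_open[of f D x UNIV S g] has_derivative_transform_within_open[of g D x UNIV S f]
      assms by auto
  then show ?thesis
    by (simp add: differentiable_def)
qed

lemma Ck_on_cong:
  assumes "open S" "\<And>z. z \<in> S \<Longrightarrow> f z = g z"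
  shows "Ck_on k S f \<longleftrightarrow> Ck_on k S g"
  using assms(2)
proof (induction k arbitrary: f g)
  case 0
  then show ?case by (simp cong: continuous_on_cong)
next
  case (Suc k)
  have "(\<forall>x\<in>S. f differentiable at x) \<longleftrightarrow> (\<forall>x\<in>S. g differentiable at x)"
    using differentiable_cong_open[OF assms(1)] Suc.prems by blast
  moreover have "Ck_on k S (\<lambda>x. frechet_derivative f (at x) v) \<longleftrightarrow> Ck_on k S (\<lambda>x. frechet_derivative g (at x) v)" for v
    by (rule Suc.IH) (simp add: frechet_derivative_cong_open[OF assms(1) _ Suc.prems])
  ultimately show ?case by simp
qed

lemma Ck_on_Suc_imp: "Ck_on (Suc k) S f \<Longrightarrow> Ck_on k S f"
proof (induction k arbitrary: f)
  case 0
  then show ?case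
    by (auto intro!: continuous_at_imp_continuous_on differentiable_imp_continuous_within)
next
  case (Suc k)
  then show ?case by (metis Ck_on.simps(2))
qed

lemma Ck_on_subset: "Ck_on k S f \<Longrightarrow> T \<subseteq> S \<Longrightarrow> Ck_on k T f"
  by (induction k arbitrary: f) (auto intro: continuous_on_subset)

lemma Ck_on_const: "Ck_on k S (\<lambda>x. c)"
  by (induction k arbitrary: c) auto

text \<open>Lets an explicit formula stand in for the chosen \<open>frechet_derivative\<close>, so
  that the inductions below work with the usual differentiation rules.\<close>

lemma Ck_on_Suc_I:
  assumes "open S" "\<And>x. x \<in> S \<Longrightarrow> (f has_derivative f' x) (at x)" "\<And>v. Ck_on k S (\<lambda>x. f' x v)"
  shows "Ck_on (Suc k) S f"
proof -
  have "f' x = frechet_derivative f (at x)" if "x \<in> S" for x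
    using frechet_derivative_at[OF assms(2)[OF that]] .
  then have "Ck_on k S (\<lambda>x. frechet_derivative f (at x) v)" for v
    using Ck_on_cong[OF assms(1), of "\<lambda>x. f' x v" "\<lambda>x. frechet_derivative f (at x) v" k] assms(3) by simp
  then show ?thesis
    using assms(2) by (auto simp: differentiable_def)
qed

lemma Ck_on_Suc_deriv:
  "Ck_on (Suc k) S f \<Longrightarrow> x \<in> S \<Longrightarrow> (f has_derivative frechet_derivative f (at x)) (at x)"
  by (simp add: frechet_derivative_works[symmetric])

lemma Ck_on_add:
  "open S \<Longrightarrow> Ck_on k S f \<Longrightarrow> Ck_on k S g \<Longrightarrow> Ck_on k S (\<lambda>x. f x + g x)"
proof (induction k arbitrary: f g)
  case 0
  then show ?case by (simp add: continuous_on_add)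
next
  case (Suc k)
  show ?case
  proof (rule Ck_on_Suc_I[OF Suc.prems(1)])
    fix x assume "x \<in> S"
    then show "((\<lambda>x. f x + g x) has_derivative
        (\<lambda>v. frechet_derivative f (at x) v + frechet_derivative g (at x) v)) (at x)"
      by (intro has_derivative_add Ck_on_Suc_deriv[OF Suc.prems(2)] Ck_on_Suc_deriv[OF Suc.prems(3)])
  next
    show "Ck_on k S (\<lambda>x. frechet_derivative f (at x) v + frechet_derivative g (at x) v)" for v
      using Suc.prems by (intro Suc.IH) simp_all
  qed
qed

lemma Ck_on_linear:
  assumes "bounded_linear L"
  shows "open S \<Longrightarrow> Ck_on k S f \<Longrightarrow> Ck_on k S (\<lambda>x. L (f x))"
proof (induction k arbitrary: f)
  case 0
  then show ?case by (auto intro: bounded_linear.continuous_on[OF assms])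
next
  case (Suc k)
  show ?case
  proof (rule Ck_on_Suc_I[OF Suc.prems(1)])
    fix x assume "x \<in> S"
    then show "((\<lambda>x. L (f x)) has_derivative (\<lambda>v. L (frechet_derivative f (at x) v))) (at x)"
      by (intro bounded_linear.has_derivative[OF assms] Ck_on_Suc_deriv[OF Suc.prems(2)])
  qed (use Suc in auto)
qed

lemma Ck_on_bilinear:
  assumes "bounded_bilinear B"
  shows "open S \<Longrightarrow> Ck_on k S f \<Longrightarrow> Ck_on k S g \<Longrightarrow> Ck_on k S (\<lambda>x. B (f x) (g x))"
proof (induction k arbitrary: f g)
  case 0
  then show ?case by (auto intro: bounded_bilinear.continuous_on[OF assms])
next
  case (Suc k)
  show ?case
  proof (rule Ck_on_Suc_I[OF Suc.prems(1)])
    fix x assume "x \<in> S"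
    then show "((\<lambda>x. B (f x) (g x)) has_derivative
        (\<lambda>v. B (f x) (frechet_derivative g (at x) v) + B (frechet_derivative f (at x) v) (g x))) (at x)"
      by (intro bounded_bilinear.FDERIV[OF assms] Ck_on_Suc_deriv[OF Suc.prems(2)] Ck_on_Suc_deriv[OF Suc.prems(3)])
  next
    show "Ck_on k S (\<lambda>x. B (f x) (frechet_derivative g (at x) v) + B (frechet_derivative f (at x) v) (g x))" for v
      \<comment> \<open>Each summand keeps one factor undifferentiated; that factor has to be
        demoted from C^(k+1) to C^k before the induction hypothesis applies.\<close>
      using Suc.prems(1) Suc.prems(2,3)[THEN Ck_on_Suc_imp] Suc.prems(2,3)
      by (intro Ck_on_add Suc.IH) auto
  qed
qed

lemma Ck_on_sum:
  "finite I \<Longrightarrow> open S \<Longrightarrow> (\<And>i. i \<in> I \<Longrightarrow> Ck_on k S (f i)) \<Longrightarrow> Ck_on k S (\<lambda>x. \<Sum>i\<in>I. f i x)"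
  by (induction I rule: finite_induct) (simp_all only: sum.empty sum.insert Ck_on_const Ck_on_add insert_iff simp_thms)

lemma linear_sum_Basis:
  fixes v :: "'a::euclidean_space"
  assumes "linear L"
  shows "L v = (\<Sum>b\<in>Basis. (v \<bullet> b) *\<^sub>R L b)"
proof -
  interpret linear L by fact
  show ?thesis
    by (subst euclidean_representation[of v, symmetric]) (simp add: sum scale)
qed

lemma Ck_on_compose:
  fixes f :: "'a::real_normed_vector \<Rightarrow> 'b::euclidean_space" and g :: "'b \<Rightarrow> 'c::real_normed_vector"
  shows "open S \<Longrightarrow> open T \<Longrightarrow> f ` S \<subseteq> T \<Longrightarrow> Ck_on k S f \<Longrightarrow> Ck_on k T g \<Longrightarrow> Ck_on k S (\<lambda>x. g (f x))"
proof (induction k arbitrary: g)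
  case 0
  then show ?case by (auto intro: continuous_on_compose2)
next
  case (Suc k)
  note derivf = Ck_on_Suc_deriv[OF Suc.prems(4)] and derivg = Ck_on_Suc_deriv[OF Suc.prems(5)]
  let ?f' = "\<lambda>x. frechet_derivative f (at x)" and ?g' = "\<lambda>x. frechet_derivative g (at x)"
  show ?case
  proof (rule Ck_on_Suc_I[OF Suc.prems(1)])
    fix x assume x: "x \<in> S"
    then have fx: "f x \<in> T" using Suc.prems by auto
    have "((\<lambda>x. g (f x)) has_derivative (\<lambda>v. ?g' (f x) (?f' x v))) (at x)"
      using has_derivative_compose[OF derivf[OF x] derivg[OF fx]] .
    \<comment> \<open>\<open>Ck_on\<close> controls derivatives in fixed directions only, whereas
      the chain rule differentiates g in a direction that moves with x. Expanding that direction in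
      \<open>Basis\<close> separates moving coefficients from fixed directions; hence the Euclidean
      middle space.\<close>
    moreover have "(\<lambda>v. ?g' (f x) (?f' x v)) = (\<lambda>v. \<Sum>b\<in>Basis. (?f' x v \<bullet> b) *\<^sub>R ?g' (f x) b)"
      using has_derivative_linear[OF derivg[OF fx]] by (intro ext linear_sum_Basis)
    ultimately show "((\<lambda>x. g (f x)) has_derivative (\<lambda>v. \<Sum>b\<in>Basis. (?f' x v \<bullet> b) *\<^sub>R ?g' (f x) b)) (at x)"
      by (simp only:)
  next
    fix v
    have "Ck_on k S (\<lambda>x. ?f' x v \<bullet> b)" for b
      using Suc.prems by (intro Ck_on_linear[where L = "\<lambda>w. w \<bullet> b"] bounded_linear_inner_left) auto
    moreover have "Ck_on k S (\<lambda>x. ?g' (f x) b)" for b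
      using Suc.prems Suc.prems(4)[THEN Ck_on_Suc_imp] by (intro Suc.IH[where g = "\<lambda>z. ?g' z b"]) auto
    ultimately show "Ck_on k S (\<lambda>x. \<Sum>b\<in>Basis. (?f' x v \<bullet> b) *\<^sub>R ?g' (f x) b)"
      using Suc.prems by (intro Ck_on_sum Ck_on_bilinear[OF bounded_bilinear_scaleR]) auto
  qed
qed

text \<open>The derivative contains two factors \<open>inverse\<close>, so the product rule closes
  the induction.\<close>

lemma Ck_on_inverse: "Ck_on k (- {0::real}) inverse"
proof (induction k)
  case 0
  then show ?case by (auto intro!: continuous_intros)
next
  case (Suc k)
  show ?case
  proof (rule Ck_on_Suc_I)
    fix x :: real assume "x \<in> - {0}"
    then show "(inverse has_derivative (\<lambda>v. (- v) * (inverse x * inverse x))) (at x)"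
      by (auto intro!: derivative_eq_intros)
  next
    show "Ck_on k (- {0}) (\<lambda>x::real. (- v) * (inverse x * inverse x))" for v
      by (intro Ck_on_bilinear[OF bounded_bilinear_mult] Ck_on_const Suc) auto
  qed auto
qed

text \<open>The exponent is generalized because differentiation lowers it. The application is to
  powers of det h.\<close>

lemma Ck_on_powr: "Ck_on k {0<..} (\<lambda>t::real. t powr a)"
proof (induction k arbitrary: a)
  case 0
  then show ?case by (auto intro!: continuous_intros)
next
  case (Suc k)
  show ?case
  proof (rule Ck_on_Suc_I)
    fix t :: real assume "t \<in> {0<..}"
    then show "((\<lambda>t. t powr a) has_derivative (\<lambda>v. a * t powr (a - 1) * v)) (at t)"
      using has_real_derivative_powr[of t a] by (simp add: has_field_derivative_def)
  next
    show "Ck_on k {0<..} (\<lambda>t::real. a * t powr (a - 1) * v)" for v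
      by (intro Ck_on_bilinear[OF bounded_bilinear_mult] Ck_on_const Suc) auto
  qed auto
qed

lemma smooth_on_cong:
  assumes "open S" "\<And>z. z \<in> S \<Longrightarrow> f z = g z"
  shows "smooth_on S f \<longleftrightarrow> smooth_on S g"
proof -
  have "Ck_on k S f \<longleftrightarrow> Ck_on k S g" for k
    by (rule Ck_on_cong[OF assms])
  then show ?thesis by (simp only: smooth_on_def)
qed

lemma smooth_on_subset: "smooth_on S f \<Longrightarrow> T \<subseteq> S \<Longrightarrow> smooth_on T f"
  unfolding smooth_on_def using Ck_on_subset by blast

lemma smooth_on_const: "smooth_on S (\<lambda>x. c)"
  by (simp add: smooth_on_def Ck_on_const)

lemma smooth_on_add: "open S \<Longrightarrow> smooth_on S f \<Longrightarrow> smooth_on S g \<Longrightarrow> smooth_on S (\<lambda>x. f x + g x)"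
  unfolding smooth_on_def by (intro allI Ck_on_add) simp_all

lemma smooth_on_linear:
  assumes "bounded_linear L" "open S" "smooth_on S f"
  shows "smooth_on S (\<lambda>x. L (f x))"
  using assms(3) Ck_on_linear[OF assms(1,2), of _ f] by (simp only: smooth_on_def simp_thms)

lemma smooth_on_mult:
  fixes f g :: "'a::real_normed_vector \<Rightarrow> real"
  shows "open S \<Longrightarrow> smooth_on S f \<Longrightarrow> smooth_on S g \<Longrightarrow> smooth_on S (\<lambda>x. f x * g x)"
  unfolding smooth_on_def by (intro allI Ck_on_bilinear[OF bounded_bilinear_mult]) simp_all

lemma smooth_on_sum:
  "finite I \<Longrightarrow> open S \<Longrightarrow> (\<And>i. i \<in> I \<Longrightarrow> smooth_on S (f i)) \<Longrightarrow> smooth_on S (\<lambda>x. \<Sum>i\<in>I. f i x)"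
  unfolding smooth_on_def by (intro allI Ck_on_sum) simp_all

lemma smooth_on_compose:
  fixes f :: "'a::real_normed_vector \<Rightarrow> 'b::euclidean_space"
  assumes "open S" "open T" "f ` S \<subseteq> T" "smooth_on S f" "smooth_on T g"
  shows "smooth_on S (\<lambda>x. g (f x))"
  unfolding smooth_on_def
proof
  show "Ck_on k S (\<lambda>x. g (f x))" for k
    by (rule Ck_on_compose[OF assms(1-3)]) (use assms(4,5) in \<open>simp_all only: smooth_on_def\<close>)
qed

lemma smooth_on_inverse:
  fixes f :: "'a::real_normed_vector \<Rightarrow> real"
  assumes "open S" "smooth_on S f" "\<And>x. x \<in> S \<Longrightarrow> f x \<noteq> 0"
  shows "smooth_on S (\<lambda>x. inverse (f x))"
  by (rule smooth_on_compose[where T = "- {0}"]) (use assms in \<open>auto simp: smooth_on_def Ck_on_inverse\<close>)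

lemma smooth_on_frechet_derivative:
  assumes "smooth_on S f"
  shows "smooth_on S (\<lambda>x. frechet_derivative f (at x) v)"
  unfolding smooth_on_def
proof
  fix k
  have "Ck_on (Suc k) S f" using assms by (simp only: smooth_on_def)
  then show "Ck_on k S (\<lambda>x. frechet_derivative f (at x) v)" by simp
qed

lemma smooth_on_has_derivative:
  assumes "smooth_on S f" "x \<in> S"
  shows "(f has_derivative frechet_derivative f (at x)) (at x)"
proof -
  have "Ck_on (Suc 0) S f" using assms(1) by (simp only: smooth_on_def)
  from Ck_on_Suc_deriv[OF this assms(2)] show ?thesis .
qed

lemma smooth_on_continuous_on:
  assumes "smooth_on S f"
  shows "continuous_on S f"
proof -
  have "Ck_on 0 S f" using assms by (simp only: smooth_on_def)
  then show ?thesis by simp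
qed

lemma linear_axis: "linear (axis i :: 'b::real_vector \<Rightarrow> 'b ^ 'n::finite)"
  by (intro linearI) (auto simp: vec_eq_iff axis_def)

lemma smooth_on_vec_iff:
  fixes f :: "'a::real_normed_vector \<Rightarrow> 'b::euclidean_space ^ 'n::finite"
  assumes "open S"
  shows "smooth_on S f \<longleftrightarrow> (\<forall>i. smooth_on S (\<lambda>x. f x $ i))"
proof
  assume "\<forall>i. smooth_on S (\<lambda>x. f x $ i)"
  then have "smooth_on S (\<lambda>x. \<Sum>i\<in>UNIV. axis i (f x $ i))"
    using assms by (intro smooth_on_sum smooth_on_linear[where L = "axis _"] linear_conv_bounded_linear[THEN iffD1] linear_axis) auto
  moreover have "(\<Sum>i\<in>UNIV. axis i (f x $ i)) = f x" for x
    by (simp add: vec_eq_iff axis_def)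
  ultimately show "smooth_on S f" by simp
qed (use assms in \<open>auto intro: smooth_on_linear[OF bounded_linear_vec_nth]\<close>)

text \<open>The mean value theorem, applied to the second difference over a parallelogram once in
  direction v and once in direction w. The left side is symmetric in v and w; the right side is a
  mixed derivative at some point of the parallelogram.\<close>

lemma second_difference_mean_value:
  fixes u :: "'a::real_normed_vector \<Rightarrow> real"
  defines "D \<equiv> \<lambda>u z v. frechet_derivative u (at z) v"
  assumes smooth: "smooth_on S u" and s: "s > 0"
    and inS: "\<And>a b. 0 \<le> a \<Longrightarrow> a \<le> s \<Longrightarrow> 0 \<le> b \<Longrightarrow> b \<le> s \<Longrightarrow> z + a *\<^sub>R v + b *\<^sub>R w \<in> S"
  obtains a b where "0 \<le> a" "a \<le> s" "0 \<le> b" "b \<le> s"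
    "u (z + s *\<^sub>R v + s *\<^sub>R w) - u (z + s *\<^sub>R v) - u (z + s *\<^sub>R w) + u z
      = s * s * D (\<lambda>y. D u y v) (z + a *\<^sub>R v + b *\<^sub>R w) w"
proof -
  have lin: "r * D F y d = D F y (r *\<^sub>R d)" if "smooth_on S F" "y \<in> S" for F :: "'a \<Rightarrow> real" and y r d
    unfolding D_def using linear_cmul[OF has_derivative_linear[OF smooth_on_has_derivative[OF that]]] by simp
  have der: "((\<lambda>t. F (y + t *\<^sub>R d)) has_real_derivative D F (y + t *\<^sub>R d) d) (at t)"
    if "smooth_on S F" "y + t *\<^sub>R d \<in> S" for F :: "'a \<Rightarrow> real" and y t d
  proof -
    have "((\<lambda>t. F (y + t *\<^sub>R d)) has_derivative (\<lambda>r. D F (y + t *\<^sub>R d) (r *\<^sub>R d))) (at t)"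
      unfolding D_def
      by (rule has_derivative_compose[of "\<lambda>t. y + t *\<^sub>R d", OF _ smooth_on_has_derivative[OF that]])
        (auto intro!: derivative_eq_intros)
    then show ?thesis
      unfolding has_field_derivative_def lin[OF that, symmetric] by (simp add: mult.commute[of _ "D F (y + t *\<^sub>R d) d"])
  qed
  \<comment> \<open>The difference of u along \<open>s *\<^sub>R w\<close> is treated as a function
    of the parameter along v.\<close>
  have "\<exists>a. a > 0 \<and> a < s \<and>
    (u (z + s *\<^sub>R w + s *\<^sub>R v) - u (z + s *\<^sub>R v)) - (u (z + s *\<^sub>R w + 0 *\<^sub>R v) - u (z + 0 *\<^sub>R v))
      = (s - 0) * (D u (z + s *\<^sub>R w + a *\<^sub>R v) v - D u (z + a *\<^sub>R v) v)"
  proof (rule MVT2[of 0 s "\<lambda>t. u (z + s *\<^sub>R w + t *\<^sub>R v) - u (z + t *\<^sub>R v)"])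
    fix t assume "0 \<le> t" "t \<le> s"
    then have "z + s *\<^sub>R w + t *\<^sub>R v \<in> S" "z + t *\<^sub>R v \<in> S"
      using inS[of t s] inS[of t 0] s by (auto simp: add_ac)
    then show "((\<lambda>t. u (z + s *\<^sub>R w + t *\<^sub>R v) - u (z + t *\<^sub>R v)) has_real_derivative
       (D u (z + s *\<^sub>R w + t *\<^sub>R v) v - D u (z + t *\<^sub>R v) v)) (at t)"
      by (intro DERIV_diff der[OF smooth])
  qed (use s in auto)
  then obtain a where a: "0 < a" "a < s"
    and eq1: "u (z + s *\<^sub>R v + s *\<^sub>R w) - u (z + s *\<^sub>R v) - u (z + s *\<^sub>R w) + u z
      = s * (D u (z + a *\<^sub>R v + s *\<^sub>R w) v - D u (z + a *\<^sub>R v) v)"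
    by (auto simp: algebra_simps)
  have sm: "smooth_on S (\<lambda>y. D u y v)"
    unfolding D_def by (rule smooth_on_frechet_derivative[OF smooth])
  have "\<exists>b. b > 0 \<and> b < s \<and> D u (z + a *\<^sub>R v + s *\<^sub>R w) v - D u (z + a *\<^sub>R v + 0 *\<^sub>R w) v
      = (s - 0) * D (\<lambda>y. D u y v) (z + a *\<^sub>R v + b *\<^sub>R w) w"
    using s a by (intro MVT2[of 0 s "\<lambda>t. D u (z + a *\<^sub>R v + t *\<^sub>R w) v"] der[OF sm] inS) auto
  then obtain b where b: "0 < b" "b < s" and
    eq2: "D u (z + a *\<^sub>R v + s *\<^sub>R w) v - D u (z + a *\<^sub>R v) v = s * D (\<lambda>y. D u y v) (z + a *\<^sub>R v + b *\<^sub>R w) w"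
    by auto
  show thesis
    using a b by (intro that[of a b] less_imp_le) (simp_all only: eq1 eq2 mult.assoc)
qed

text \<open>Both mixed derivatives equal the same second difference divided by s^2, at two possibly
  different points close to z; continuity then identifies their values at z.\<close>

lemma frechet_derivative_commute:
  fixes u :: "'a::real_normed_vector \<Rightarrow> real"
  assumes smooth: "smooth_on S u" and S: "open S" "z \<in> S"
  shows "frechet_derivative (\<lambda>y. frechet_derivative u (at y) v) (at z) w
       = frechet_derivative (\<lambda>y. frechet_derivative u (at y) w) (at z) v"
proof -
  define D where "D = (\<lambda>(u::'a \<Rightarrow> real) z v. frechet_derivative u (at z) v)"
  define P where "P = (\<lambda>y. D (\<lambda>y. D u y v) y w)"
  define Q where "Q = (\<lambda>y. D (\<lambda>y. D u y w) y v)"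
  have cont: "continuous_on S P" "continuous_on S Q"
    unfolding P_def Q_def D_def
    by (intro smooth_on_continuous_on smooth_on_frechet_derivative smooth)+
  have "\<bar>P z - Q z\<bar> \<le> e" if e: "e > 0" for e
  proof -
    have "isCont P z" "isCont Q z"
      using cont S by (auto simp: continuous_on_eq_continuous_at)
    then have near: "\<exists>d>0. \<forall>y. dist y z < d \<longrightarrow> dist (P y) (P z) < e / 2"
      "\<exists>d>0. \<forall>y. dist y z < d \<longrightarrow> dist (Q y) (Q z) < e / 2"
      using half_gt_zero[OF e] unfolding continuous_at_eps_delta by blast+
    obtain d1 where d1: "d1 > 0" "\<And>y. dist y z < d1 \<Longrightarrow> dist (P y) (P z) < e / 2" using near(1) by auto
    obtain d2 where d2: "d2 > 0" "\<And>y. dist y z < d2 \<Longrightarrow> dist (Q y) (Q z) < e / 2" using near(2) by auto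
    note d = d1 d2
    obtain r where r: "r > 0" "ball z r \<subseteq> S" using S open_contains_ball by blast
    define m where "m = min r (min d1 d2)"
    have m: "m > 0" using r d by (simp add: m_def)
    \<comment> \<open>The parallelogram with sides \<open>s *\<^sub>R v\<close> and
      \<open>s *\<^sub>R w\<close> has to fit into the ball of radius m; adding 1 keeps the
      denominator positive even for v = w = 0.\<close>
    define s where "s = m / (norm v + norm w + 1)"
    have pos: "norm v + norm w + 1 > 0" using norm_ge_zero[of v] norm_ge_zero[of w] by linarith
    have s: "s > 0" using m pos by (simp add: s_def)
    have near: "dist (z + a *\<^sub>R v + b *\<^sub>R w) z < m" if "0 \<le> a" "a \<le> s" "0 \<le> b" "b \<le> s" for a b
    proof -
      have "dist (z + a *\<^sub>R v + b *\<^sub>R w) z \<le> norm (a *\<^sub>R v) + norm (b *\<^sub>R w)"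
        using norm_triangle_ineq[of "a *\<^sub>R v" "b *\<^sub>R w"] by (simp add: dist_norm add_ac)
      also have "\<dots> \<le> s * norm v + s * norm w"
        using that by (intro add_mono) (auto intro: mult_right_mono)
      also have "\<dots> < s * (norm v + norm w + 1)"
        using s by (simp add: algebra_simps)
      also have "\<dots> = m" using pos by (simp add: s_def)
      finally show ?thesis .
    qed
    have inS: "z + a *\<^sub>R v + b *\<^sub>R w \<in> S" "z + a *\<^sub>R w + b *\<^sub>R v \<in> S"
      if "0 \<le> a" "a \<le> s" "0 \<le> b" "b \<le> s" for a b
    proof -
      have "dist (z + a *\<^sub>R v + b *\<^sub>R w) z < r" "dist (z + b *\<^sub>R v + a *\<^sub>R w) z < r"
        using near[of a b] near[of b a] that by (auto simp: m_def)
      then show "z + a *\<^sub>R v + b *\<^sub>R w \<in> S" "z + a *\<^sub>R w + b *\<^sub>R v \<in> S"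
        using r by (auto simp: dist_commute add_ac)
    qed
    obtain a b where ab: "0 \<le> a" "a \<le> s" "0 \<le> b" "b \<le> s"
      "u (z + s *\<^sub>R v + s *\<^sub>R w) - u (z + s *\<^sub>R v) - u (z + s *\<^sub>R w) + u z = s * s * P (z + a *\<^sub>R v + b *\<^sub>R w)"
      using second_difference_mean_value[OF smooth s inS(1)] unfolding P_def D_def by blast
    obtain a' b' where ab': "0 \<le> a'" "a' \<le> s" "0 \<le> b'" "b' \<le> s"
      "u (z + s *\<^sub>R w + s *\<^sub>R v) - u (z + s *\<^sub>R w) - u (z + s *\<^sub>R v) + u z = s * s * Q (z + a' *\<^sub>R w + b' *\<^sub>R v)"
      using second_difference_mean_value[OF smooth s inS(2)] unfolding Q_def D_def by blast
    have "s * s * P (z + a *\<^sub>R v + b *\<^sub>R w) = s * s * Q (z + b' *\<^sub>R v + a' *\<^sub>R w)"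
    proof -
      have "z + s *\<^sub>R w + s *\<^sub>R v = z + s *\<^sub>R v + s *\<^sub>R w"
        "z + a' *\<^sub>R w + b' *\<^sub>R v = z + b' *\<^sub>R v + a' *\<^sub>R w" by (simp_all add: add_ac)
      then show ?thesis using ab(5) ab'(5) by (simp only:)
    qed
    then have "P (z + a *\<^sub>R v + b *\<^sub>R w) = Q (z + b' *\<^sub>R v + a' *\<^sub>R w)" using s by simp
    moreover have "dist (P (z + a *\<^sub>R v + b *\<^sub>R w)) (P z) < e / 2"
      using near[of a b] ab d by (auto simp: m_def)
    moreover have "dist (Q (z + b' *\<^sub>R v + a' *\<^sub>R w)) (Q z) < e / 2"
      using near[of b' a'] ab' d by (auto simp: m_def)
    ultimately show ?thesis unfolding dist_real_def by linarith
  qed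
  then have "\<bar>P z - Q z\<bar> \<le> 0" by (rule field_le_epsilon) simp
  then show ?thesis by (simp add: P_def Q_def D_def)
qed

section \<open>Partial derivatives in charts\<close>

text \<open>Calculus is done on open pieces S of a chart, because a map between manifolds is seen in
  a pair of charts only on part of the source chart.\<close>

definition chart_domain :: "('m::topological_space, 'n::finite) chart \<Rightarrow> 'm set \<Rightarrow> bool" where
  "chart_domain x S \<longleftrightarrow> open S \<and> S \<subseteq> fst x \<and> open (fst x) \<and> open (snd x ` fst x) \<and>
     homeomorphism (fst x) (snd x ` fst x) (snd x) (chart_inv x)"

definition smooth_fun :: "('m::topological_space, 'n::finite) chart \<Rightarrow> 'm set \<Rightarrow> ('m \<Rightarrow> real) \<Rightarrow> bool" where
  "smooth_fun x S u \<longleftrightarrow> smooth_on (snd x ` S) (u \<circ> chart_inv x)"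

lemma chart_domain_subset: "chart_domain x S \<Longrightarrow> open T \<Longrightarrow> T \<subseteq> S \<Longrightarrow> chart_domain x T"
  by (auto simp: chart_domain_def)

lemma chart_inv_apply: "chart_domain x S \<Longrightarrow> p \<in> S \<Longrightarrow> chart_inv x (snd x p) = p"
  by (auto simp: chart_domain_def homeomorphism_def)

lemma open_chart_image:
  assumes "chart_domain x S"
  shows "open (snd x ` S)"
proof -
  have "snd x ` S = snd x ` fst x \<inter> chart_inv x -` S"
    using assms by (auto simp: chart_domain_def homeomorphism_def)
  moreover have "open (snd x ` fst x \<inter> chart_inv x -` S)"
    using assms by (intro continuous_open_preimage) (auto simp: chart_domain_def homeomorphism_def)
  ultimately show ?thesis by simp
qed

lemma smooth_fun_subset: "smooth_fun x S u \<Longrightarrow> T \<subseteq> S \<Longrightarrow> smooth_fun x T u"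
  unfolding smooth_fun_def by (rule smooth_on_subset) auto

lemma smooth_fun_cong:
  assumes "chart_domain x S" "\<And>q. q \<in> S \<Longrightarrow> u q = v q"
  shows "smooth_fun x S u \<longleftrightarrow> smooth_fun x S v"
  unfolding smooth_fun_def
  by (rule smooth_on_cong[OF open_chart_image[OF assms(1)]]) (auto simp: assms chart_inv_apply[OF assms(1)])

lemma smooth_fun_has_derivative:
  assumes "smooth_fun x S u" "p \<in> S"
  shows "((u \<circ> chart_inv x) has_derivative frechet_derivative (u \<circ> chart_inv x) (at (snd x p))) (at (snd x p))"
  using assms unfolding smooth_fun_def by (intro smooth_on_has_derivative) auto

lemma pd_eqI:
  "((u \<circ> chart_inv x) has_derivative D) (at (snd x p)) \<Longrightarrow> pd x i u p = D (axis i 1)"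
  unfolding pd_def by (metis frechet_derivative_at)

lemma pd_cong:
  assumes "chart_domain x S" "p \<in> S" "\<And>q. q \<in> S \<Longrightarrow> u q = v q"
  shows "pd x i u p = pd x i v p"
proof -
  have "frechet_derivative (u \<circ> chart_inv x) (at (snd x p)) = frechet_derivative (v \<circ> chart_inv x) (at (snd x p))"
    by (rule frechet_derivative_cong_open[OF open_chart_image[OF assms(1)]])
      (use assms in \<open>auto simp: chart_inv_apply[OF assms(1)]\<close>)
  then show ?thesis by (simp add: pd_def)
qed

lemma smooth_fun_const: "smooth_fun x S (\<lambda>q. c)"
  by (simp add: smooth_fun_def comp_def smooth_on_const)

lemma smooth_fun_add:
  "chart_domain x S \<Longrightarrow> smooth_fun x S u \<Longrightarrow> smooth_fun x S v \<Longrightarrow> smooth_fun x S (\<lambda>q. u q + v q)"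
  unfolding smooth_fun_def comp_def by (rule smooth_on_add[OF open_chart_image])

lemma smooth_fun_mult:
  "chart_domain x S \<Longrightarrow> smooth_fun x S u \<Longrightarrow> smooth_fun x S v \<Longrightarrow> smooth_fun x S (\<lambda>q. u q * v q)"
  unfolding smooth_fun_def comp_def by (rule smooth_on_mult[OF open_chart_image])

lemma smooth_fun_cmult:
  "chart_domain x S \<Longrightarrow> smooth_fun x S u \<Longrightarrow> smooth_fun x S (\<lambda>q. c * u q)"
  by (rule smooth_fun_mult[OF _ smooth_fun_const])

lemma smooth_fun_minus: "chart_domain x S \<Longrightarrow> smooth_fun x S u \<Longrightarrow> smooth_fun x S (\<lambda>q. - u q)"
  using smooth_fun_cmult[of x S u "-1"] by simp

lemma smooth_fun_diff:
  "chart_domain x S \<Longrightarrow> smooth_fun x S u \<Longrightarrow> smooth_fun x S v \<Longrightarrow> smooth_fun x S (\<lambda>q. u q - v q)"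
  using smooth_fun_add[OF _ _ smooth_fun_minus, of x S u v] by simp

lemma smooth_fun_sum:
  assumes "chart_domain x S" "\<And>i. i \<in> I \<Longrightarrow> smooth_fun x S (u i)"
  shows "smooth_fun x S (\<lambda>q. \<Sum>i\<in>I. u i q)"
  using assms(2)
  by (induction I rule: infinite_finite_induct) (simp_all add: smooth_fun_const smooth_fun_add[OF assms(1)])

lemma smooth_fun_prod:
  assumes "chart_domain x S" "\<And>i. i \<in> I \<Longrightarrow> smooth_fun x S (u i)"
  shows "smooth_fun x S (\<lambda>q. \<Prod>i\<in>I. u i q)"
  using assms(2)
  by (induction I rule: infinite_finite_induct) (simp_all add: smooth_fun_const smooth_fun_mult[OF assms(1)])

lemma smooth_fun_divide:
  assumes "chart_domain x S" "smooth_fun x S u" "smooth_fun x S v" "\<And>q. q \<in> S \<Longrightarrow> v q \<noteq> 0"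
  shows "smooth_fun x S (\<lambda>q. u q / v q)"
proof -
  have "smooth_fun x S (\<lambda>q. inverse (v q))"
    unfolding smooth_fun_def comp_def
    by (rule smooth_on_inverse[OF open_chart_image[OF assms(1)]])
      (use assms in \<open>auto simp: smooth_fun_def comp_def chart_inv_apply[OF assms(1)]\<close>)
  from smooth_fun_mult[OF assms(1,2) this] show ?thesis by (simp add: divide_inverse)
qed

lemma smooth_fun_powr:
  assumes x: "chart_domain x S" and u: "smooth_fun x S u" and pos: "\<And>q. q \<in> S \<Longrightarrow> u q > 0"
  shows "smooth_fun x S (\<lambda>q. u q powr a)"
  unfolding smooth_fun_def comp_def
  by (rule smooth_on_compose[OF open_chart_image[OF x], where T = "{0<..}"])
    (use u pos in \<open>auto simp: smooth_fun_def comp_def smooth_on_def Ck_on_powr chart_inv_apply[OF x]\<close>)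

lemma smooth_fun_pd:
  assumes "chart_domain x S" "smooth_fun x S u"
  shows "smooth_fun x S (pd x i u)"
  using smooth_on_frechet_derivative[OF assms(2)[unfolded smooth_fun_def], of "axis i 1"]
  unfolding smooth_fun_def
  by (subst smooth_on_cong[OF open_chart_image[OF assms(1)]])
    (auto simp: pd_def chart_inv_apply[OF assms(1)])

lemma pd_const: "pd x i (\<lambda>q. c) p = 0"
  by (simp add: pd_def comp_def)

lemma pd_add:
  assumes "smooth_fun x S u" "smooth_fun x S v" "p \<in> S"
  shows "pd x i (\<lambda>q. u q + v q) p = pd x i u p + pd x i v p"
proof -
  have "((\<lambda>q. u q + v q) \<circ> chart_inv x has_derivative
     (\<lambda>w. frechet_derivative (u \<circ> chart_inv x) (at (snd x p)) w
        + frechet_derivative (v \<circ> chart_inv x) (at (snd x p)) w)) (at (snd x p))"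
    using has_derivative_add[OF smooth_fun_has_derivative[OF assms(1,3)] smooth_fun_has_derivative[OF assms(2,3)]]
    by (simp add: comp_def)
  from pd_eqI[OF this] show ?thesis by (simp add: pd_def)
qed

lemma pd_mult:
  assumes x: "chart_domain x S" and p: "p \<in> S" and uv: "smooth_fun x S u" "smooth_fun x S v"
  shows "pd x i (\<lambda>q. u q * v q) p = pd x i u p * v p + u p * pd x i v p"
proof -
  have "((\<lambda>q. u q * v q) \<circ> chart_inv x has_derivative
     (\<lambda>w. u p * frechet_derivative (v \<circ> chart_inv x) (at (snd x p)) w
        + frechet_derivative (u \<circ> chart_inv x) (at (snd x p)) w * v p)) (at (snd x p))"
    using has_derivative_mult[OF smooth_fun_has_derivative[OF uv(1) p] smooth_fun_has_derivative[OF uv(2) p]]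
    by (simp add: comp_def chart_inv_apply[OF x p])
  from pd_eqI[OF this] show ?thesis by (simp add: pd_def)
qed

lemma pd_sum:
  assumes "chart_domain x S" "p \<in> S" "\<And>k. k \<in> I \<Longrightarrow> smooth_fun x S (u k)"
  shows "pd x i (\<lambda>q. \<Sum>k\<in>I. u k q) p = (\<Sum>k\<in>I. pd x i (u k) p)"
  using assms(3)
  by (induction I rule: infinite_finite_induct)
    (simp_all add: pd_const pd_add[OF _ smooth_fun_sum[OF assms(1)] assms(2)])

lemma pd_cmult:
  assumes "chart_domain x S" "smooth_fun x S u" "p \<in> S"
  shows "pd x i (\<lambda>q. c * u q) p = c * pd x i u p"
  using pd_mult[OF assms(1,3) smooth_fun_const assms(2)] by (simp add: pd_const)

lemma pd_diff:
  assumes "chart_domain x S" "smooth_fun x S u" "smooth_fun x S v" "p \<in> S"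
  shows "pd x i (\<lambda>q. u q - v q) p = pd x i u p - pd x i v p"
  using pd_add[OF assms(2) smooth_fun_cmult[OF assms(1,3), of "-1"] assms(4)] pd_cmult[OF assms(1,3,4), of i "-1"] by simp

lemma pd_real_compose:
  assumes "chart_domain x S" "smooth_fun x S u" "p \<in> S" "(\<phi> has_real_derivative d) (at (u p))"
  shows "pd x i (\<lambda>q. \<phi> (u q)) p = d * pd x i u p"
proof -
  have "(\<phi> has_derivative (*) d) (at ((u \<circ> chart_inv x) (snd x p)))"
    using assms by (simp add: has_field_derivative_def chart_inv_apply[OF assms(1)])
  from has_derivative_compose[OF smooth_fun_has_derivative[OF assms(2,3)] this]
  show ?thesis by (subst pd_eqI) (auto simp: comp_def pd_def)
qed

lemma pd_commute:
  assumes "chart_domain x S" "smooth_fun x S u" "p \<in> S"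
  shows "pd x i (pd x j u) p = pd x j (pd x i u) p"
proof -
  let ?U = "u \<circ> chart_inv x"
  have "pd x i (pd x j u) p = frechet_derivative (\<lambda>z. frechet_derivative ?U (at z) (axis j 1)) (at (snd x p)) (axis i 1)"
    for i j
    unfolding pd_def[of x i "pd x j u"]
    by (subst frechet_derivative_cong_open[OF open_chart_image[OF assms(1)]])
      (use assms(3) in \<open>auto simp: pd_def chart_inv_apply[OF assms(1)]\<close>)
  then show ?thesis
    using frechet_derivative_commute[OF assms(2)[unfolded smooth_fun_def] open_chart_image[OF assms(1)]] assms(3)
    by simp
qed

lemma
  assumes x: "chart_domain x S" and y: "chart_domain y T" and fS: "f ` S \<subseteq> T"
    and f: "\<And>a. smooth_fun x S (\<lambda>q. snd y (f q) $ a)" and u: "smooth_fun y T u"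
  shows smooth_fun_compose: "smooth_fun x S (\<lambda>q. u (f q))"
    and pd_chain: "p \<in> S \<Longrightarrow> pd x i (\<lambda>q. u (f q)) p = (\<Sum>a\<in>UNIV. dmap x y f p i a * pd y a u (f p))"
proof -
  define F where "F = snd y \<circ> f \<circ> chart_inv x"
  define U where "U = u \<circ> chart_inv y"
  have F: "smooth_on (snd x ` S) F"
    using f unfolding smooth_fun_def
    by (subst smooth_on_vec_iff[OF open_chart_image[OF x]]) (simp add: F_def comp_def)
  have U: "smooth_on (snd y ` T) U" using u by (simp add: smooth_fun_def U_def)
  have FS: "F ` snd x ` S \<subseteq> snd y ` T"
    using fS by (auto simp: F_def chart_inv_apply[OF x])
  have eq: "((\<lambda>q. u (f q)) \<circ> chart_inv x) z = U (F z)" if "z \<in> snd x ` S" for z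
    using that fS by (auto simp: F_def U_def chart_inv_apply[OF x] chart_inv_apply[OF y] image_subset_iff)
  show "smooth_fun x S (\<lambda>q. u (f q))"
  proof -
    have "smooth_fun x S (\<lambda>q. u (f q)) \<longleftrightarrow> smooth_on (snd x ` S) (\<lambda>z. U (F z))"
      unfolding smooth_fun_def by (rule smooth_on_cong[OF open_chart_image[OF x]]) (rule eq)
    then show ?thesis
      using smooth_on_compose[OF open_chart_image[OF x] open_chart_image[OF y] FS F U] by (rule iffD2)
  qed
  assume p: "p \<in> S"
  let ?z = "snd x p"
  have z: "?z \<in> snd x ` S" "F ?z \<in> snd y ` T" using p FS by auto
  have Fz: "F ?z = snd y (f p)" by (simp add: F_def chart_inv_apply[OF x p])
  have DF: "(F has_derivative frechet_derivative F (at ?z)) (at ?z)"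
    by (rule smooth_on_has_derivative[OF F z(1)])
  have DU: "(U has_derivative frechet_derivative U (at (F ?z))) (at (F ?z))"
    by (rule smooth_on_has_derivative[OF U z(2)])
  have comp: "frechet_derivative F (at ?z) (axis i 1) $ a = dmap x y f p i a" for a
    using bounded_linear.has_derivative[OF bounded_linear_vec_nth[of a] DF]
    unfolding dmap_def by (subst pd_eqI) (auto simp: F_def comp_def)
  have "pd x i (\<lambda>q. u (f q)) p = frechet_derivative (\<lambda>z. U (F z)) (at ?z) (axis i 1)"
    unfolding pd_def by (rule fun_cong[OF frechet_derivative_cong_open[OF open_chart_image[OF x] z(1)]]) (rule eq)
  also have "\<dots> = frechet_derivative U (at (F ?z)) (frechet_derivative F (at ?z) (axis i 1))"
    using frechet_derivative_at[OF has_derivative_compose[OF DF DU]] by (simp add: fun_eq_iff)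
  also have "\<dots> = (\<Sum>b\<in>Basis. (frechet_derivative F (at ?z) (axis i 1) \<bullet> b) *\<^sub>R frechet_derivative U (at (F ?z)) b)"
    by (rule linear_sum_Basis[OF has_derivative_linear[OF DU]])
  also have "\<dots> = (\<Sum>a\<in>UNIV. dmap x y f p i a * pd y a u (f p))"
    \<comment> \<open>\<open>Basis\<close> of the target space is the disjoint union over a of the
      singletons of \<open>axis a 1\<close>, which turns the sum over \<open>Basis\<close> into a
      sum over coordinates.\<close>
    unfolding Basis_vec_def
    by (subst sum.UNION_disjoint) (auto simp: comp inner_axis axis_eq_axis pd_def U_def Fz)
  finally show "pd x i (\<lambda>q. u (f q)) p = (\<Sum>a\<in>UNIV. dmap x y f p i a * pd y a u (f p))" .
qed

lemma dmap_same:
  assumes "chart_domain x S" "p \<in> S"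
  shows "dmap x x id p i a = (if i = a then 1 else 0)"
proof -
  have "frechet_derivative ((\<lambda>q. snd x (id q) $ a) \<circ> chart_inv x) (at (snd x p)) = frechet_derivative (\<lambda>z. z $ a) (at (snd x p))"
    by (rule frechet_derivative_cong_open[OF open_chart_image[OF assms(1)]])
      (use assms in \<open>auto simp: chart_inv_apply[OF assms(1)]\<close>)
  also have "\<dots> = (\<lambda>z. z $ a)"
    using frechet_derivative_at[OF bounded_linear_imp_has_derivative[OF bounded_linear_vec_nth]] by metis
  finally show ?thesis by (simp add: dmap_def pd_def axis_def)
qed

section \<open>Vector fields and connections along a map\<close>

definition smooth_vec :: "('m::topological_space, 'n::finite) chart \<Rightarrow> 'm set \<Rightarrow> ('m \<Rightarrow> real ^ 'k::finite) \<Rightarrow> bool" where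
  "smooth_vec x S V \<longleftrightarrow> (\<forall>a. smooth_fun x S (\<lambda>q. V q $ a))"

definition smooth_mat :: "('m::topological_space, 'n::finite) chart \<Rightarrow> 'm set \<Rightarrow> ('m \<Rightarrow> real ^ 'k::finite ^ 'l::finite) \<Rightarrow> bool" where
  "smooth_mat x S A \<longleftrightarrow> (\<forall>a b. smooth_fun x S (\<lambda>q. A q $ a $ b))"

definition pd_vec :: "('m, 'n::finite) chart \<Rightarrow> 'n \<Rightarrow> ('m \<Rightarrow> real ^ 'k::finite) \<Rightarrow> 'm \<Rightarrow> real ^ 'k" where
  "pd_vec x i V p = (\<chi> a. pd x i (\<lambda>q. V q $ a) p)"

definition pd_mat :: "('m, 'n::finite) chart \<Rightarrow> 'n \<Rightarrow> ('m \<Rightarrow> real ^ 'k::finite ^ 'l::finite) \<Rightarrow> 'm \<Rightarrow> real ^ 'k ^ 'l" where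
  "pd_mat x i A p = (\<chi> a b. pd x i (\<lambda>q. A q $ a $ b) p)"

lemma smooth_vec_subset: "smooth_vec x S V \<Longrightarrow> T \<subseteq> S \<Longrightarrow> smooth_vec x T V"
  unfolding smooth_vec_def using smooth_fun_subset by blast

context
  fixes x :: "('m::topological_space, 'n::finite) chart" and S
  assumes x: "chart_domain x S"
begin

lemma smooth_vec_mult:
  "smooth_mat x S A \<Longrightarrow> smooth_vec x S V \<Longrightarrow> smooth_vec x S (\<lambda>q. A q *v V q)"
  unfolding smooth_mat_def smooth_vec_def
  by (simp add: matrix_vector_mult_def smooth_fun_sum[OF x] smooth_fun_mult[OF x])

lemma smooth_vec_add: "smooth_vec x S V \<Longrightarrow> smooth_vec x S W \<Longrightarrow> smooth_vec x S (\<lambda>q. V q + W q)"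
  by (simp add: smooth_vec_def smooth_fun_add[OF x])

lemma smooth_vec_diff: "smooth_vec x S V \<Longrightarrow> smooth_vec x S W \<Longrightarrow> smooth_vec x S (\<lambda>q. V q - W q)"
  by (simp add: smooth_vec_def smooth_fun_diff[OF x])

lemma smooth_fun_inner: "smooth_vec x S V \<Longrightarrow> smooth_vec x S W \<Longrightarrow> smooth_fun x S (\<lambda>q. V q \<bullet> W q)"
  by (simp add: smooth_vec_def inner_vec_def smooth_fun_sum[OF x] smooth_fun_mult[OF x])

lemma smooth_vec_pd: "smooth_vec x S V \<Longrightarrow> smooth_vec x S (pd_vec x i V)"
  by (simp add: smooth_vec_def pd_vec_def smooth_fun_pd[OF x])

context
  fixes p
  assumes p: "p \<in> S"
begin

lemma pd_vec_cong: "(\<And>q. q \<in> S \<Longrightarrow> V q = W q) \<Longrightarrow> pd_vec x i V p = pd_vec x i W p"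
  unfolding pd_vec_def vec_eq_iff vec_lambda_beta by (intro allI pd_cong[OF x p]) simp

lemma pd_vec_add: "smooth_vec x S V \<Longrightarrow> smooth_vec x S W \<Longrightarrow> pd_vec x i (\<lambda>q. V q + W q) p = pd_vec x i V p + pd_vec x i W p"
  by (simp add: smooth_vec_def pd_vec_def vec_eq_iff pd_add[OF _ _ p])

lemma pd_vec_diff: "smooth_vec x S V \<Longrightarrow> smooth_vec x S W \<Longrightarrow> pd_vec x i (\<lambda>q. V q - W q) p = pd_vec x i V p - pd_vec x i W p"
  by (simp add: smooth_vec_def pd_vec_def vec_eq_iff pd_diff[OF x _ _ p])

lemma pd_inner:
  "smooth_vec x S V \<Longrightarrow> smooth_vec x S W \<Longrightarrow> pd x i (\<lambda>q. V q \<bullet> W q) p = pd_vec x i V p \<bullet> W p + V p \<bullet> pd_vec x i W p"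
  by (simp add: smooth_vec_def inner_vec_def pd_vec_def pd_sum[OF x p] smooth_fun_mult[OF x] pd_mult[OF x p] sum.distrib)

lemma pd_vec_mult:
  "smooth_mat x S A \<Longrightarrow> smooth_vec x S V \<Longrightarrow> pd_vec x i (\<lambda>q. A q *v V q) p = pd_mat x i A p *v V p + A p *v pd_vec x i V p"
  by (simp add: smooth_vec_def smooth_mat_def matrix_vector_mult_def vec_eq_iff pd_vec_def pd_mat_def pd_sum[OF x p]
      smooth_fun_mult[OF x] pd_mult[OF x p] sum.distrib)

lemma pd_vec_scaleR_sum:
  "(\<And>k. k \<in> I \<Longrightarrow> smooth_fun x S (u k)) \<Longrightarrow> (\<And>k. k \<in> I \<Longrightarrow> smooth_vec x S (V k)) \<Longrightarrow>
   pd_vec x i (\<lambda>q. \<Sum>k\<in>I. u k q *\<^sub>R V k q) p = (\<Sum>k\<in>I. pd x i (u k) p *\<^sub>R V k p + u k p *\<^sub>R pd_vec x i (V k) p)"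
  by (simp add: smooth_vec_def vec_eq_iff pd_vec_def pd_sum[OF x p] smooth_fun_mult[OF x] pd_mult[OF x p])

lemma pd_vec_commute: "smooth_vec x S V \<Longrightarrow> pd_vec x i (pd_vec x j V) p = pd_vec x j (pd_vec x i V) p"
  by (simp add: smooth_vec_def vec_eq_iff pd_vec_def pd_commute[OF x _ p])

end
end

lemma inner_transpose_right:
  fixes A :: "real ^ 'n::finite ^ 'm::finite"
  shows "v \<bullet> (transpose A *v w) = (A *v v) \<bullet> w"
  by (metis dot_lmul_matrix inner_commute transpose_matrix_vector)

text \<open>\<open>push x y f i\<close> is \<open>f\<^sub>* \<partial>\<^sub>i\<close> in the chart \<open>y\<close>. Vectors are columns, so the row index of a connection
  matrix is the contravariant one, and an endomorphism field with components \<open>J\<^sub>i\<^sup>j\<close> acts by its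
  transpose.\<close>

definition push :: "('m, 'n::finite) chart \<Rightarrow> ('p, 'k::finite) chart \<Rightarrow> ('m \<Rightarrow> 'p) \<Rightarrow> 'n \<Rightarrow> 'm \<Rightarrow> real ^ 'k" where
  "push x y f i q = (\<chi> a. dmap x y f q i a)"

text \<open>The connection form of the pulled-back connection, evaluated on the i-th coordinate
  field.\<close>

definition conn_matrix :: "('m, 'n::finite) chart \<Rightarrow> ('p, 'k::finite) chart \<Rightarrow> ('m \<Rightarrow> 'p)
    \<Rightarrow> ('p \<Rightarrow> 'k \<Rightarrow> 'k \<Rightarrow> 'k \<Rightarrow> real) \<Rightarrow> 'n \<Rightarrow> 'm \<Rightarrow> real ^ 'k ^ 'k" where
  "conn_matrix x y f G i q = (\<chi> a b. \<Sum>c\<in>UNIV. dmap x y f q i c * G (f q) c b a)"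

text \<open>The connection on the pulled-back tangent bundle. V is a vector field along f, given on
  the source only, so no extension to the ambient manifold has to be chosen.\<close>

definition cov_along :: "('m, 'n::finite) chart \<Rightarrow> ('p, 'k::finite) chart \<Rightarrow> ('m \<Rightarrow> 'p)
    \<Rightarrow> ('p \<Rightarrow> 'k \<Rightarrow> 'k \<Rightarrow> 'k \<Rightarrow> real) \<Rightarrow> 'n \<Rightarrow> ('m \<Rightarrow> real ^ 'k) \<Rightarrow> 'm \<Rightarrow> real ^ 'k" where
  "cov_along x y f G i V q = pd_vec x i V q + conn_matrix x y f G i q *v V q"

text \<open>Also used with \<open>f = id\<close>, so that changes of coordinates and immersions
  share one chain rule.\<close>

locale local_map =
  fixes x :: "('m::topological_space, 'n::finite) chart" and S :: "'m set"
    and y :: "('p::topological_space, 'k::finite) chart" and T :: "'p set" and f :: "'m \<Rightarrow> 'p"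
  assumes x: "chart_domain x S" and y: "chart_domain y T" and image: "f ` S \<subseteq> T"
    and smooth: "smooth_vec x S (\<lambda>q. snd y (f q))"
begin

lemma f_in: "p \<in> S \<Longrightarrow> f p \<in> T"
  using image by auto

lemma compose: "smooth_fun y T u \<Longrightarrow> smooth_fun x S (\<lambda>q. u (f q))"
  by (rule smooth_fun_compose[OF x y image]) (use smooth in \<open>auto simp: smooth_vec_def\<close>)

lemma chain: "smooth_fun y T u \<Longrightarrow> p \<in> S \<Longrightarrow> pd x i (\<lambda>q. u (f q)) p = (\<Sum>a\<in>UNIV. dmap x y f p i a * pd y a u (f p))"
  by (rule pd_chain[OF x y image]) (use smooth in \<open>auto simp: smooth_vec_def\<close>)

abbreviation "E \<equiv> push x y f"

lemma smooth_E: "smooth_vec x S (E i)"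
  using smooth by (simp add: smooth_vec_def push_def dmap_def smooth_fun_pd[OF x])

lemma smooth_dmap: "smooth_fun x S (\<lambda>q. dmap x y f q i a)"
  using smooth_E[of i] by (simp add: smooth_vec_def push_def)

lemma pd_dmap_commute: "p \<in> S \<Longrightarrow> pd x i (\<lambda>q. dmap x y f q j a) p = pd x j (\<lambda>q. dmap x y f q i a) p"
  unfolding dmap_def by (rule pd_commute[OF x]) (use smooth in \<open>auto simp: smooth_vec_def\<close>)

lemma pd_vec_E_commute: "p \<in> S \<Longrightarrow> pd_vec x i (E j) p = pd_vec x j (E i) p"
  unfolding pd_vec_def push_def by (simp add: vec_eq_iff pd_dmap_commute)

end

text \<open>G is only a symmetric array of functions in one target chart. Metric compatibility,
  parallel J and the transformation law enter as hypotheses of the lemmas that use them, so the same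
  locale serves the ambient connection along f and the Christoffel symbols along a change of
  coordinates.\<close>

locale pulled_back_connection = local_map x S y T f
  for x :: "('m::topological_space, 'n::finite) chart" and S :: "'m set"
    and y :: "('p::topological_space, 'k::finite) chart" and T :: "'p set" and f :: "'m \<Rightarrow> 'p" +
  fixes G :: "'p \<Rightarrow> 'k \<Rightarrow> 'k \<Rightarrow> 'k \<Rightarrow> real"
  assumes smooth_G: "smooth_fun y T (\<lambda>r. G r a b c)"
    and sym_G: "r \<in> T \<Longrightarrow> G r a b c = G r b a c"
begin

abbreviation "\<omega> \<equiv> conn_matrix x y f G"

abbreviation "nab \<equiv> cov_along x y f G"

lemma nab_nth:
  "nab i V q $ a = pd x i (\<lambda>q. V q $ a) q + (\<Sum>b\<in>UNIV. \<Sum>c\<in>UNIV. G (f q) b c a * dmap x y f q i b * V q $ c)"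
proof -
  have "(\<omega> i q *v V q) $ a = (\<Sum>c\<in>UNIV. \<Sum>b\<in>UNIV. G (f q) b c a * dmap x y f q i b * V q $ c)"
    by (simp add: matrix_vector_mult_def conn_matrix_def sum_distrib_left sum_distrib_right mult_ac)
  then show ?thesis
    by (simp add: cov_along_def pd_vec_def) (rule sum.swap)
qed

lemma smooth_\<omega>: "smooth_mat x S (\<omega> i)"
  unfolding smooth_mat_def conn_matrix_def
  by (simp add: smooth_fun_sum[OF x] smooth_fun_mult[OF x] smooth_dmap compose[OF smooth_G])

lemma smooth_nab: "smooth_vec x S V \<Longrightarrow> smooth_vec x S (nab i V)"
  unfolding cov_along_def[abs_def]
  by (intro smooth_vec_add[OF x] smooth_vec_pd[OF x] smooth_vec_mult[OF x] smooth_\<omega>)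

lemma nab_cong: "p \<in> S \<Longrightarrow> (\<And>q. q \<in> S \<Longrightarrow> V q = W q) \<Longrightarrow> nab i V p = nab i W p"
  unfolding cov_along_def using pd_vec_cong[OF x, of p V W i] by simp

lemma nab_diff:
  "p \<in> S \<Longrightarrow> smooth_vec x S V \<Longrightarrow> smooth_vec x S W \<Longrightarrow> nab i (\<lambda>q. V q - W q) p = nab i V p - nab i W p"
  by (simp add: cov_along_def pd_vec_diff[OF x] matrix_vector_mult_diff_distrib)

lemma nab_scaleR_sum:
  assumes "p \<in> S" "\<And>k. smooth_fun x S (u k)" "\<And>k. smooth_vec x S (V k)"
  shows "nab i (\<lambda>q. \<Sum>k\<in>I. u k q *\<^sub>R V k q) p = (\<Sum>k\<in>I. pd x i (u k) p *\<^sub>R V k p + u k p *\<^sub>R nab i (V k) p)"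
  by (simp add: cov_along_def pd_vec_scaleR_sum[OF x] assms matrix_vector_mult_scaleR scaleR_add_right sum.distrib
      linear_sum[OF matrix_vector_mul_linear])

text \<open>Torsion-freeness along f: second partial derivatives of f commute and G is symmetric in
  its lower indices.\<close>

lemma nab_E_commute:
  assumes "p \<in> S"
  shows "nab i (E j) p = nab j (E i) p"
proof -
  have "(\<omega> i p *v E j p) $ a = (\<omega> j p *v E i p) $ a" for a
  proof -
    have "(\<omega> i p *v E j p) $ a = (\<Sum>b\<in>UNIV. \<Sum>c\<in>UNIV. G (f p) c b a * dmap x y f p i c * dmap x y f p j b)"
      by (simp add: matrix_vector_mult_def conn_matrix_def push_def sum_distrib_left sum_distrib_right mult_ac)
    also have "\<dots> = (\<Sum>c\<in>UNIV. \<Sum>b\<in>UNIV. G (f p) b c a * dmap x y f p j b * dmap x y f p i c)"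
      using sym_G[OF f_in[OF assms]] by (subst sum.swap) (simp add: mult_ac)
    also have "\<dots> = (\<omega> j p *v E i p) $ a"
      by (simp add: matrix_vector_mult_def conn_matrix_def push_def sum_distrib_left sum_distrib_right mult_ac)
    finally show ?thesis .
  qed
  then show ?thesis
    by (simp add: cov_along_def pd_vec_E_commute[OF assms] vec_eq_iff)
qed

text \<open>The hypothesis \<open>par\<close> is \<nabla>g = 0 in coordinates. By the chain rule it
  becomes dg = \<omega>^T g + g \<omega> along f, where \<omega>^T is the transpose, and the Leibniz
  rule follows.\<close>

lemma pd_metric:
  assumes g: "smooth_mat y T g"
    and par: "\<And>r a b c. r \<in> T \<Longrightarrow> pd y a (\<lambda>r. g r $ b $ c) r = (\<Sum>d\<in>UNIV. G r a b d * g r $ d $ c) + (\<Sum>d\<in>UNIV. G r a c d * g r $ b $ d)"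
    and V: "smooth_vec x S V" and W: "smooth_vec x S W" and p: "p \<in> S"
  shows "pd x i (\<lambda>q. V q \<bullet> (g (f q) *v W q)) p = nab i V p \<bullet> (g (f p) *v W p) + V p \<bullet> (g (f p) *v nab i W p)"
proof -
  have gf: "smooth_mat x S (\<lambda>q. g (f q))"
    using g compose by (auto simp: smooth_mat_def)
  have "pd_mat x i (\<lambda>q. g (f q)) p $ b $ c = (transpose (\<omega> i p) ** g (f p) + g (f p) ** \<omega> i p) $ b $ c" for b c
  proof -
    have "pd_mat x i (\<lambda>q. g (f q)) p $ b $ c = (\<Sum>a\<in>UNIV. dmap x y f p i a * pd y a (\<lambda>r. g r $ b $ c) (f p))"
      using chain[of "\<lambda>r. g r $ b $ c" p i] g p by (simp add: pd_mat_def smooth_mat_def)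
    also have "\<dots> = (\<Sum>a\<in>UNIV. \<Sum>d\<in>UNIV. dmap x y f p i a * G (f p) a b d * g (f p) $ d $ c)
        + (\<Sum>a\<in>UNIV. \<Sum>d\<in>UNIV. dmap x y f p i a * G (f p) a c d * g (f p) $ b $ d)"
      by (simp add: par[OF f_in[OF p]] sum.distrib[symmetric] distrib_left sum_distrib_left mult.assoc)
    also have "\<dots> = (transpose (\<omega> i p) ** g (f p) + g (f p) ** \<omega> i p) $ b $ c"
      by (simp add: matrix_matrix_mult_def transpose_def conn_matrix_def sum_distrib_left sum_distrib_right)
        (rule arg_cong2[where f = "(+)"]; subst sum.swap; simp add: mult_ac)
    finally show ?thesis .
  qed
  then have pdg: "pd_mat x i (\<lambda>q. g (f q)) p = transpose (\<omega> i p) ** g (f p) + g (f p) ** \<omega> i p"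
    by (simp add: vec_eq_iff)
  have "pd x i (\<lambda>q. V q \<bullet> (g (f q) *v W q)) p
     = pd_vec x i V p \<bullet> (g (f p) *v W p) + V p \<bullet> (pd_mat x i (\<lambda>q. g (f q)) p *v W p + g (f p) *v pd_vec x i W p)"
    using pd_inner[OF x p V smooth_vec_mult[OF x gf W]] pd_vec_mult[OF x p gf W] by simp
  also have "V p \<bullet> (pd_mat x i (\<lambda>q. g (f q)) p *v W p)
     = (\<omega> i p *v V p) \<bullet> (g (f p) *v W p) + V p \<bullet> (g (f p) *v (\<omega> i p *v W p))" for V W
    unfolding pdg matrix_vector_mult_add_rdistrib inner_add_right
    by (simp only: matrix_vector_mul_assoc[symmetric] inner_transpose_right)
  ultimately show ?thesis
    by (simp add: cov_along_def inner_add_left inner_add_right matrix_vector_right_distrib)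
qed

text \<open>For the transposed matrices, \<nabla>J = 0 reads dJ = J \<omega> - \<omega> J along f,
  which is what lets J pass through the derivative.\<close>

lemma nab_parallel_endo:
  assumes J: "smooth_mat y T J"
    and par: "\<And>r a b c. r \<in> T \<Longrightarrow> pd y a (\<lambda>r. J r $ b $ c) r = (\<Sum>d\<in>UNIV. G r a b d * J r $ d $ c) - (\<Sum>d\<in>UNIV. G r a d c * J r $ b $ d)"
    and V: "smooth_vec x S V" and p: "p \<in> S"
  shows "nab i (\<lambda>q. transpose (J (f q)) *v V q) p = transpose (J (f p)) *v nab i V p"
proof -
  have Jf: "smooth_mat x S (\<lambda>q. transpose (J (f q)))"
    using J compose by (auto simp: smooth_mat_def transpose_def)
  have "pd_mat x i (\<lambda>q. transpose (J (f q))) p $ c $ b = (transpose (J (f p)) ** \<omega> i p - \<omega> i p ** transpose (J (f p))) $ c $ b" for b c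
  proof -
    have "pd_mat x i (\<lambda>q. transpose (J (f q))) p $ c $ b = (\<Sum>a\<in>UNIV. dmap x y f p i a * pd y a (\<lambda>r. J r $ b $ c) (f p))"
      using chain[of "\<lambda>r. J r $ b $ c" p i] J p by (simp add: pd_mat_def smooth_mat_def transpose_def)
    also have "\<dots> = (\<Sum>a\<in>UNIV. \<Sum>d\<in>UNIV. dmap x y f p i a * G (f p) a b d * J (f p) $ d $ c)
        - (\<Sum>a\<in>UNIV. \<Sum>d\<in>UNIV. dmap x y f p i a * G (f p) a d c * J (f p) $ b $ d)"
      by (simp add: par[OF f_in[OF p]] sum_subtractf[symmetric] right_diff_distrib sum_distrib_left mult.assoc)
    also have "\<dots> = (transpose (J (f p)) ** \<omega> i p - \<omega> i p ** transpose (J (f p))) $ c $ b"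
      by (simp add: matrix_matrix_mult_def transpose_def conn_matrix_def sum_distrib_left sum_distrib_right)
        (rule arg_cong2[where f = "(-)"]; subst sum.swap; simp add: mult_ac)
    finally show ?thesis .
  qed
  then have pdJ: "pd_mat x i (\<lambda>q. transpose (J (f q))) p = transpose (J (f p)) ** \<omega> i p - \<omega> i p ** transpose (J (f p))"
    by (simp add: vec_eq_iff)
  show ?thesis
    unfolding cov_along_def pd_vec_mult[OF x p Jf V] pdJ
    by (simp add: matrix_vector_mult_diff_rdistrib matrix_vector_right_distrib matrix_vector_mul_assoc
        del: transpose_matrix_vector)
qed

text \<open>The structure equation: d\<omega> + \<omega> \<and> \<omega> is the pullback of the
  ambient curvature. \<open>curvature\<close> expects coefficients for every chart, hence the
  constant family.\<close>

lemma nab_curvature: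
  assumes V: "smooth_vec x S V" and p: "p \<in> S"
  shows "(nab i (nab j V) p - nab j (nab i V) p) $ l
    = (\<Sum>b\<in>UNIV. \<Sum>c\<in>UNIV. \<Sum>k\<in>UNIV. curvature (\<lambda>_. G) y (f p) b c k l * dmap x y f p i b * dmap x y f p j c * V p $ k)"
proof -
  have nab2: "nab i (nab j V) p = pd_vec x i (pd_vec x j V) p + pd_mat x i (\<omega> j) p *v V p + \<omega> j p *v pd_vec x i V p
      + \<omega> i p *v pd_vec x j V p + (\<omega> i p ** \<omega> j p) *v V p" for i j
    unfolding cov_along_def[abs_def]
    by (simp add: pd_vec_add[OF x p smooth_vec_pd[OF x V] smooth_vec_mult[OF x smooth_\<omega> V]]
        pd_vec_mult[OF x p smooth_\<omega> V] matrix_vector_right_distrib matrix_vector_mul_assoc)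
  have pd\<omega>: "pd_mat x i (\<omega> j) p $ l $ k = (\<Sum>c\<in>UNIV. pd x i (\<lambda>q. dmap x y f q j c) p * G (f p) c k l)
      + (\<Sum>c\<in>UNIV. \<Sum>b\<in>UNIV. dmap x y f p i b * dmap x y f p j c * pd y b (\<lambda>r. G r c k l) (f p))" for i j l k
    unfolding pd_mat_def conn_matrix_def
    by (simp add: pd_sum[OF x p] smooth_fun_mult[OF x] smooth_dmap compose[OF smooth_G] pd_mult[OF x p]
        sum.distrib chain[OF smooth_G p] sum_distrib_left sum_distrib_right mult_ac)
  have "pd_mat x i (\<omega> j) p $ l $ k - pd_mat x j (\<omega> i) p $ l $ k
      + (\<omega> i p ** \<omega> j p) $ l $ k - (\<omega> j p ** \<omega> i p) $ l $ k
    = (\<Sum>b\<in>UNIV. \<Sum>c\<in>UNIV. curvature (\<lambda>_. G) y (f p) b c k l * dmap x y f p i b * dmap x y f p j c)" for k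
  proof -
    let ?e = "\<lambda>b c. dmap x y f p i b * dmap x y f p j c"
    \<comment> \<open>The second derivatives of f contribute equally to both terms and
      cancel.\<close>
    have 1: "pd_mat x i (\<omega> j) p $ l $ k - pd_mat x j (\<omega> i) p $ l $ k
      = (\<Sum>b\<in>UNIV. \<Sum>c\<in>UNIV. ?e b c * pd y b (\<lambda>r. G r c k l) (f p))
        - (\<Sum>b\<in>UNIV. \<Sum>c\<in>UNIV. ?e b c * pd y c (\<lambda>r. G r b k l) (f p))"
      unfolding pd\<omega> pd_dmap_commute[OF p, of i j]
      by (subst sum.swap[of _ _ "UNIV :: 'k set"]) (simp add: mult_ac)
    have 2: "(\<omega> i p ** \<omega> j p) $ l $ k = (\<Sum>b\<in>UNIV. \<Sum>c\<in>UNIV. ?e b c * (\<Sum>r\<in>UNIV. G (f p) b r l * G (f p) c k r))"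
    proof -
      have "(\<omega> i p ** \<omega> j p) $ l $ k = (\<Sum>r\<in>UNIV. \<Sum>b\<in>UNIV. \<Sum>c\<in>UNIV. ?e b c * (G (f p) b r l * G (f p) c k r))"
        by (simp add: matrix_matrix_mult_def conn_matrix_def sum_product) (simp add: mult_ac)
      also have "\<dots> = (\<Sum>b\<in>UNIV. \<Sum>r\<in>UNIV. \<Sum>c\<in>UNIV. ?e b c * (G (f p) b r l * G (f p) c k r))"
        by (rule sum.swap)
      also have "\<dots> = (\<Sum>b\<in>UNIV. \<Sum>c\<in>UNIV. \<Sum>r\<in>UNIV. ?e b c * (G (f p) b r l * G (f p) c k r))"
        by (rule sum.cong[OF refl]) (rule sum.swap)
      finally show ?thesis by (simp add: sum_distrib_left)
    qed
    have 3: "(\<omega> j p ** \<omega> i p) $ l $ k = (\<Sum>b\<in>UNIV. \<Sum>c\<in>UNIV. ?e b c * (\<Sum>r\<in>UNIV. G (f p) c r l * G (f p) b k r))"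
    proof -
      have "(\<omega> j p ** \<omega> i p) $ l $ k = (\<Sum>r\<in>UNIV. \<Sum>c\<in>UNIV. \<Sum>b\<in>UNIV. ?e b c * (G (f p) c r l * G (f p) b k r))"
        by (simp add: matrix_matrix_mult_def conn_matrix_def sum_product) (simp add: mult_ac)
      also have "\<dots> = (\<Sum>r\<in>UNIV. \<Sum>b\<in>UNIV. \<Sum>c\<in>UNIV. ?e b c * (G (f p) c r l * G (f p) b k r))"
        by (rule sum.cong[OF refl]) (rule sum.swap)
      also have "\<dots> = (\<Sum>b\<in>UNIV. \<Sum>r\<in>UNIV. \<Sum>c\<in>UNIV. ?e b c * (G (f p) c r l * G (f p) b k r))"
        by (rule sum.swap)
      also have "\<dots> = (\<Sum>b\<in>UNIV. \<Sum>c\<in>UNIV. \<Sum>r\<in>UNIV. ?e b c * (G (f p) c r l * G (f p) b k r))"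
        by (rule sum.cong[OF refl]) (rule sum.swap)
      finally show ?thesis by (simp add: sum_distrib_left)
    qed
    show ?thesis
      unfolding 1 2 3 curvature_def
      by (simp add: sum_subtractf sum.distrib algebra_simps)
  qed
  note curv = this
  \<comment> \<open>The second derivatives of V, and the terms pairing \<omega> with a first
    derivative of V, are symmetric in i and j and drop out.\<close>
  have "(nab i (nab j V) p - nab j (nab i V) p) $ l
    = (\<Sum>k\<in>UNIV. (pd_mat x i (\<omega> j) p $ l $ k - pd_mat x j (\<omega> i) p $ l $ k
      + (\<omega> i p ** \<omega> j p) $ l $ k - (\<omega> j p ** \<omega> i p) $ l $ k) * V p $ k)"
    unfolding nab2 pd_vec_commute[OF x p V, of i j]
    by (simp add: matrix_vector_mult_def[of "pd_mat _ _ _ _"] matrix_vector_mult_def[of "_ ** _"] sum_subtractf sum.distrib algebra_simps)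
  also have "\<dots> = (\<Sum>k\<in>UNIV. \<Sum>b\<in>UNIV. \<Sum>c\<in>UNIV. curvature (\<lambda>_. G) y (f p) b c k l * dmap x y f p i b * dmap x y f p j c * V p $ k)"
    unfolding curv by (simp add: sum_distrib_right)
  also have "\<dots> = (\<Sum>b\<in>UNIV. \<Sum>k\<in>UNIV. \<Sum>c\<in>UNIV. curvature (\<lambda>_. G) y (f p) b c k l * dmap x y f p i b * dmap x y f p j c * V p $ k)"
    by (rule sum.swap)
  also have "\<dots> = (\<Sum>b\<in>UNIV. \<Sum>c\<in>UNIV. \<Sum>k\<in>UNIV. curvature (\<lambda>_. G) y (f p) b c k l * dmap x y f p i b * dmap x y f p j c * V p $ k)"
    by (rule sum.cong[OF refl]) (rule sum.swap)
  finally show ?thesis .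
qed

end

section \<open>Changes of coordinates\<close>

lemma matrix_inv_mult:
  fixes A :: "real ^ 'n::finite ^ 'n"
  assumes "invertible A"
  shows "A ** matrix_inv A = mat 1" "matrix_inv A ** A = mat 1"
  using someI_ex[OF assms[unfolded invertible_def]] by (simp_all add: matrix_inv_def)

lemma mult_eq_mat_1_nth:
  fixes A :: "real ^ 'n::finite ^ 'n"
  assumes "A ** B = mat 1"
  shows "(\<Sum>k\<in>UNIV. A $ i $ k * B $ k $ j) = (if i = j then 1 else 0)"
  using arg_cong[OF assms, of "\<lambda>M. M $ i $ j"] by (simp add: matrix_matrix_mult_def mat_def)

text \<open>Cramer's rule exhibits the entries of the inverse as quotients of determinants, which
  makes the inverse metric smooth.\<close>

lemma matrix_inv_nth:
  fixes A :: "real ^ 'n::finite ^ 'n"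
  assumes "invertible A"
  shows "matrix_inv A $ k $ l = det (\<chi> i j. if j = k then axis l 1 $ i else A $ i $ j) / det A"
proof -
  have "A *v column l (matrix_inv A) = axis l 1"
    using mult_eq_mat_1_nth[OF matrix_inv_mult(1)[OF assms]]
    by (auto simp: vec_eq_iff matrix_vector_mult_def column_def axis_def)
  then have "column l (matrix_inv A) = (\<chi> k. det (\<chi> i j. if j = k then axis l 1 $ i else A $ i $ j) / det A)"
    using assms by (simp add: cramer invertible_det_nz)
  then show ?thesis by (simp add: vec_eq_iff column_def)
qed

lemma smooth_fun_det:
  assumes x: "chart_domain x S" and A: "\<And>i j. smooth_fun x S (\<lambda>q. A q $ i $ j)"
  shows "smooth_fun x S (\<lambda>q. det (A q :: real ^ 'k::finite ^ 'k))"
  unfolding det_def by (intro smooth_fun_sum[OF x] smooth_fun_cmult[OF x] smooth_fun_prod[OF x] A)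

lemma smooth_mat_inv:
  fixes A :: "'m::topological_space \<Rightarrow> real ^ 'k::finite ^ 'k" and x :: "('m, 'n::finite) chart"
  assumes x: "chart_domain x S" and A: "smooth_mat x S A" and inv: "\<And>q. q \<in> S \<Longrightarrow> invertible (A q)"
  shows "smooth_mat x S (\<lambda>q. matrix_inv (A q))"
  unfolding smooth_mat_def
proof (intro allI)
  fix k l
  have "smooth_fun x S (\<lambda>q. if j = k then axis l 1 $ i else A q $ i $ j)" for i j
    using A by (cases "j = k") (auto simp: smooth_mat_def smooth_fun_const)
  then have "smooth_fun x S (\<lambda>q. det (\<chi> i j. if j = k then axis l 1 $ i else A q $ i $ j) / det (A q))"
    using A inv by (intro smooth_fun_divide[OF x] smooth_fun_det[OF x]) (auto simp: smooth_mat_def invertible_det_nz)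
  then show "smooth_fun x S (\<lambda>q. matrix_inv (A q) $ k $ l)"
    by (subst smooth_fun_cong[OF x]) (simp add: matrix_inv_nth[OF inv])
qed

section \<open>Gluing smoothness from local pieces, and changes of charts\<close>

lemma Ck_on_local:
  "(\<And>z. z \<in> S \<Longrightarrow> \<exists>T. open T \<and> z \<in> T \<and> Ck_on k T f) \<Longrightarrow> Ck_on k S f"
proof (induction k arbitrary: f)
  case 0
  \<comment> \<open>For k = 0 the openness of T turns continuity on T into continuity at z; the
    clauses for larger k are pointwise conditions \<open>at z\<close>, so they can be taken from T
    directly.\<close>
  have "isCont f z" if "z \<in> S" for z
    using 0[OF that] by (auto simp: continuous_on_eq_continuous_at)
  then show ?case by (simp add: continuous_at_imp_continuous_on)
next
  case (Suc k)
  have "f differentiable at z" if "z \<in> S" for z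
    using Suc.prems[OF that] by auto
  moreover have "Ck_on k S (\<lambda>z. frechet_derivative f (at z) v)" for v
    by (rule Suc.IH) (use Suc.prems in fastforce)
  ultimately show ?case by simp
qed

text \<open>Used with the neighbourhoods on which the image of a map stays in one target
  chart.\<close>

lemma smooth_fun_local:
  assumes "chart_domain x S" "\<And>p. p \<in> S \<Longrightarrow> \<exists>T. p \<in> T \<and> chart_domain x T \<and> smooth_fun x T u"
  shows "smooth_fun x S u"
  unfolding smooth_fun_def smooth_on_def
proof
  fix k
  show "Ck_on k (snd x ` S) (u \<circ> chart_inv x)"
  proof (rule Ck_on_local)
    fix z assume "z \<in> snd x ` S"
    then obtain p where "p \<in> S" "z = snd x p" by auto
    moreover from assms(2)[OF \<open>p \<in> S\<close>] obtain T where "p \<in> T" "chart_domain x T" "smooth_fun x T u" by auto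
    ultimately show "\<exists>T. open T \<and> z \<in> T \<and> Ck_on k T (u \<circ> chart_inv x)"
      using open_chart_image[of x T] by (intro exI[of _ "snd x ` T"]) (auto simp: smooth_fun_def smooth_on_def)
  qed
qed

lemma chart_domain_full: "smooth_manifold A \<Longrightarrow> x \<in> A \<Longrightarrow> chart_domain x (fst x)"
  by (simp add: smooth_manifold_def chart_domain_def)

lemma smooth_in_real: "smooth_in x u \<longleftrightarrow> smooth_fun x (fst x) u"
  by (simp add: smooth_in_def smooth_fun_def)

lemma smooth_vec_iff:
  assumes "chart_domain x S"
  shows "smooth_vec x S V \<longleftrightarrow> smooth_on (snd x ` S) (V \<circ> chart_inv x)"
  unfolding smooth_on_vec_iff[OF open_chart_image[OF assms]] by (simp add: smooth_vec_def smooth_fun_def comp_def)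

lemma smooth_mat_iff:
  assumes "chart_domain x S"
  shows "smooth_mat x S V \<longleftrightarrow> smooth_on (snd x ` S) (V \<circ> chart_inv x)"
  unfolding smooth_on_vec_iff[OF open_chart_image[OF assms]] by (simp add: smooth_mat_def smooth_fun_def comp_def)

lemma smooth_in_mat: "smooth_manifold A \<Longrightarrow> x \<in> A \<Longrightarrow> smooth_in x V \<longleftrightarrow> smooth_mat x (fst x) V"
  using smooth_mat_iff[OF chart_domain_full[of A x], of V] by (simp add: smooth_in_def)

lemma smooth_mat_subset: "smooth_mat x S V \<Longrightarrow> T \<subseteq> S \<Longrightarrow> smooth_mat x T V"
  unfolding smooth_mat_def using smooth_fun_subset by blast

lemma smooth_map_id: "smooth_manifold A \<Longrightarrow> smooth_map A A id"
  by (simp add: smooth_map_def smooth_manifold_def)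

lemma local_mapI:
  assumes A: "smooth_manifold A" and B: "smooth_manifold B" and f: "smooth_map A B f" and x: "x \<in> A" and y: "y \<in> B"
    and S: "open S" "S \<subseteq> fst x" and T: "open T" "T \<subseteq> fst y" and im: "f ` S \<subseteq> T"
  shows "local_map x S y T f"
proof
  show xS: "chart_domain x S" using chart_domain_subset[OF chart_domain_full[OF A x]] S by simp
  show "chart_domain y T" using chart_domain_subset[OF chart_domain_full[OF B y]] T by simp
  have "smooth_on (snd x ` (fst x \<inter> f -` fst y)) (snd y \<circ> f \<circ> chart_inv x)"
    using f x y by (auto simp: smooth_map_def)
  then have "smooth_on (snd x ` S) (snd y \<circ> f \<circ> chart_inv x)"
    by (rule smooth_on_subset) (use S T im in \<open>intro image_mono, fastforce\<close>)
  then show "smooth_vec x S (\<lambda>q. snd y (f q))"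
    unfolding smooth_vec_iff[OF xS] by (simp add: comp_def)
qed fact

text \<open>The matrix acts on column vectors, so the target index is the row, opposite to the
  argument order of \<open>dmap\<close>.\<close>

definition jac :: "('m, 'n::finite) chart \<Rightarrow> ('m, 'k::finite) chart \<Rightarrow> 'm \<Rightarrow> real ^ 'n ^ 'k" where
  "jac x y q = (\<chi> a i. dmap x y id q i a)"

lemma dmap_compose:
  assumes f: "local_map x S y T f" and g: "local_map y T z U g" and p: "p \<in> S"
  shows "dmap x z (\<lambda>q. g (f q)) p i c = (\<Sum>a\<in>UNIV. dmap x y f p i a * dmap y z g (f p) a c)"
  using local_map.chain[OF f _ p, of "\<lambda>r. snd z (g r) $ c"] local_map.smooth[OF g]
  by (simp add: dmap_def[of x z] dmap_def[of y z] smooth_vec_def)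

lemma push_target:
  assumes f: "local_map x S y T f" and g: "local_map y T z U id" and p: "p \<in> S"
  shows "push x z f i p = jac y z (f p) *v push x y f i p"
  using dmap_compose[OF f g p]
  by (simp add: vec_eq_iff push_def jac_def matrix_vector_mult_def mult.commute)

lemma push_source:
  assumes f: "local_map x' S y T f" and g: "local_map x S x' S id" and p: "p \<in> S"
  shows "push x y f i p = (\<Sum>b\<in>UNIV. dmap x x' id p i b *\<^sub>R push x' y f b p)"
  using dmap_compose[OF g f p] by (simp add: vec_eq_iff push_def)

lemma jac_inverse:
  assumes f: "local_map x S y S id" and g: "local_map y S x S id" and p: "p \<in> S"
  shows "jac y x p ** jac x y p = mat 1"
proof -
  have "(\<Sum>a\<in>UNIV. dmap x y id p i a * dmap y x id p a j) = (if i = j then 1 else 0)" for i j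
    using dmap_compose[OF f g p, of i j] dmap_same[OF local_map.x[OF f] p, of i j] by (simp add: id_def)
  then show ?thesis
    by (auto simp: vec_eq_iff matrix_matrix_mult_def jac_def mat_def mult.commute)
qed

text \<open>The hypothesis \<open>law\<close> is the transformation law of connections. Pulled back
  along f it becomes the gauge formula dA = A \<omega> - \<omega>' A for the Jacobian A, and hence
  differentiation along f is independent of the target chart.\<close>

lemma cov_along_target:
  assumes P: "pulled_back_connection x S y T f G" and P': "pulled_back_connection x S z U f G'"
    and g: "local_map y T z U id" and p: "p \<in> S" and V: "smooth_vec x S V"
    and law: "\<And>r b c a. r \<in> T \<Longrightarrow> pd y b (\<lambda>r. dmap y z id r c a) r
        + (\<Sum>d\<in>UNIV. \<Sum>e\<in>UNIV. G' r d e a * dmap y z id r b d * dmap y z id r c e)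
      = (\<Sum>k\<in>UNIV. G r b c k * dmap y z id r k a)"
  shows "cov_along x z f G' i (\<lambda>q. jac y z (f q) *v V q) p = jac y z (f p) *v cov_along x y f G i V p"
proof -
  interpret P: pulled_back_connection x S y T f G by fact
  interpret P': pulled_back_connection x S z U f G' by fact
  interpret g: local_map y T z U id by fact
  have sj: "smooth_mat x S (\<lambda>q. jac y z (f q))"
    using P.compose[OF g.smooth_dmap] by (simp add: smooth_mat_def jac_def)
  have "pd_mat x i (\<lambda>q. jac y z (f q)) p $ a $ c = (jac y z (f p) ** P.\<omega> i p - P'.\<omega> i p ** jac y z (f p)) $ a $ c" for a c
  proof -
    let ?e = "\<lambda>b. dmap x y f p i b" and ?d = "\<lambda>b a. dmap y z id (f p) b a"
    have "pd_mat x i (\<lambda>q. jac y z (f q)) p $ a $ c = (\<Sum>b\<in>UNIV. ?e b * pd y b (\<lambda>r. dmap y z id r c a) (f p))"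
      using P.chain[OF g.smooth_dmap p] by (simp add: pd_mat_def jac_def)
    also have "\<dots> = (\<Sum>b\<in>UNIV. ?e b * ((\<Sum>k\<in>UNIV. G (f p) b c k * ?d k a)
        - (\<Sum>d\<in>UNIV. \<Sum>e\<in>UNIV. G' (f p) d e a * ?d b d * ?d c e)))"
      by (simp add: law[OF P.f_in[OF p], symmetric])
    also have "\<dots> = (\<Sum>b\<in>UNIV. \<Sum>k\<in>UNIV. ?e b * G (f p) b c k * ?d k a)
        - (\<Sum>b\<in>UNIV. \<Sum>d\<in>UNIV. \<Sum>e\<in>UNIV. ?e b * (G' (f p) d e a * ?d b d * ?d c e))"
      by (simp add: right_diff_distrib sum_subtractf sum_distrib_left mult.assoc)
    also have "(\<Sum>b\<in>UNIV. \<Sum>k\<in>UNIV. ?e b * G (f p) b c k * ?d k a) = (jac y z (f p) ** P.\<omega> i p) $ a $ c"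
      by (subst sum.swap) (simp add: matrix_matrix_mult_def jac_def conn_matrix_def sum_distrib_left mult_ac)
    also have "(\<Sum>b\<in>UNIV. \<Sum>d\<in>UNIV. \<Sum>e\<in>UNIV. ?e b * (G' (f p) d e a * ?d b d * ?d c e))
        = (P'.\<omega> i p ** jac y z (f p)) $ a $ c"
    proof -
      have "dmap x z f p i d = (\<Sum>b\<in>UNIV. ?e b * ?d b d)" for d
        using dmap_compose[OF P.local_map_axioms g p] by simp
      then have "(P'.\<omega> i p ** jac y z (f p)) $ a $ c
          = (\<Sum>e\<in>UNIV. \<Sum>d\<in>UNIV. \<Sum>b\<in>UNIV. ?e b * (G' (f p) d e a * ?d b d * ?d c e))"
        by (simp add: matrix_matrix_mult_def jac_def conn_matrix_def sum_distrib_left sum_distrib_right mult_ac)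
      also have "\<dots> = (\<Sum>d\<in>UNIV. \<Sum>e\<in>UNIV. \<Sum>b\<in>UNIV. ?e b * (G' (f p) d e a * ?d b d * ?d c e))"
        by (rule sum.swap)
      also have "\<dots> = (\<Sum>d\<in>UNIV. \<Sum>b\<in>UNIV. \<Sum>e\<in>UNIV. ?e b * (G' (f p) d e a * ?d b d * ?d c e))"
        by (rule sum.cong[OF refl]) (rule sum.swap)
      also have "\<dots> = (\<Sum>b\<in>UNIV. \<Sum>d\<in>UNIV. \<Sum>e\<in>UNIV. ?e b * (G' (f p) d e a * ?d b d * ?d c e))"
        by (rule sum.swap)
      finally show ?thesis by simp
    qed
    finally show ?thesis by simp
  qed
  then have "pd_mat x i (\<lambda>q. jac y z (f q)) p = jac y z (f p) ** P.\<omega> i p - P'.\<omega> i p ** jac y z (f p)"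
    by (simp add: vec_eq_iff)
  then show ?thesis
    unfolding cov_along_def pd_vec_mult[OF P.x p sj V]
    by (simp add: matrix_vector_mult_diff_rdistrib matrix_vector_right_distrib matrix_vector_mul_assoc)
qed

lemma sum_scaleR_matrix_vector:
  fixes M :: "'i \<Rightarrow> real ^ 'k::finite ^ 'l::finite"
  shows "(\<Sum>b\<in>I. c b *\<^sub>R M b) *v v = (\<Sum>b\<in>I. c b *\<^sub>R (M b *v v))"
  by (induction I rule: infinite_finite_induct)
    (simp_all add: matrix_vector_mult_add_rdistrib scaleR_matrix_vector_assoc)

text \<open>Partial derivatives and the connection form are both linear in the coordinate field, so
  the derivative is tensorial in its direction.\<close>

lemma cov_along_source:
  assumes f: "local_map x' S y T f" and g: "local_map x S x' S id" and p: "p \<in> S" and V: "smooth_vec x' S V"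
  shows "cov_along x y f G i V p = (\<Sum>b\<in>UNIV. dmap x x' id p i b *\<^sub>R cov_along x' y f G b V p)"
proof -
  have "pd x i (\<lambda>q. V q $ a) p = (\<Sum>b\<in>UNIV. dmap x x' id p i b * pd x' b (\<lambda>q. V q $ a) p)" for a
    using local_map.chain[OF g _ p, of "\<lambda>q. V q $ a"] V by (simp add: smooth_vec_def)
  then have "pd_vec x i V p = (\<Sum>b\<in>UNIV. dmap x x' id p i b *\<^sub>R pd_vec x' b V p)"
    by (simp add: pd_vec_def vec_eq_iff)
  moreover have "conn_matrix x y f G i p = (\<Sum>b\<in>UNIV. dmap x x' id p i b *\<^sub>R conn_matrix x' y f G b p)"
  proof -
    have "dmap x y f p i c = (\<Sum>b\<in>UNIV. dmap x x' id p i b * dmap x' y f p b c)" for c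
      using dmap_compose[OF g f p] by simp
    then have "conn_matrix x y f G i p $ a $ b = (\<Sum>d\<in>UNIV. dmap x x' id p i d * conn_matrix x' y f G d p $ a $ b)" for a b
      by (simp add: conn_matrix_def sum_distrib_left sum_distrib_right mult.assoc) (rule sum.swap)
    then show ?thesis by (simp add: vec_eq_iff)
  qed
  ultimately show ?thesis
    by (simp add: cov_along_def scaleR_add_right sum.distrib sum_scaleR_matrix_vector)
qed

lemma covariant2_jac:
  assumes "covariant2 A g" "x \<in> A" "y \<in> A" "p \<in> fst x" "p \<in> fst y"
  shows "g x p = transpose (jac x y p) ** g y p ** jac x y p"
proof -
  have "(transpose (jac x y p) ** g y p ** jac x y p) $ i $ j = g x p $ i $ j" for i j
  proof -
    have "(transpose (jac x y p) ** g y p ** jac x y p) $ i $ j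
        = (\<Sum>b\<in>UNIV. \<Sum>a\<in>UNIV. dmap x y id p i a * dmap x y id p j b * g y p $ a $ b)"
      by (simp add: matrix_matrix_mult_def transpose_def jac_def sum_distrib_left sum_distrib_right mult_ac)
    also have "\<dots> = (\<Sum>a\<in>UNIV. \<Sum>b\<in>UNIV. dmap x y id p i a * dmap x y id p j b * g y p $ a $ b)"
      by (rule sum.swap)
    also have "\<dots> = g x p $ i $ j"
      using assms unfolding covariant2_def by (metis (no_types, lifting) IntI)
    finally show ?thesis .
  qed
  then show ?thesis by (simp add: vec_eq_iff)
qed

lemma transition_map:
  assumes A: "smooth_manifold A" "x \<in> A" "y \<in> A" and S: "open S" "S \<subseteq> fst x" "S \<subseteq> fst y"
  shows "local_map x S y S id"
  by (rule local_mapI[OF A(1) A(1) smooth_map_id[OF A(1)] A(2,3)]) (use S in auto)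

lemma overlap_open: "smooth_manifold A \<Longrightarrow> x \<in> A \<Longrightarrow> y \<in> A \<Longrightarrow> open (fst x \<inter> fst y)"
  by (auto simp: smooth_manifold_def)

lemma inner_transform:
  fixes A :: "real ^ 'n::finite ^ 'm::finite"
  shows "v \<bullet> ((transpose A ** g ** A) *v w) = (A *v v) \<bullet> (g *v (A *v w))"
  by (simp only: matrix_vector_mul_assoc[symmetric] inner_transpose_right)

lemma double_sum_inner:
  fixes g :: "real ^ 'n::finite ^ 'm::finite"
  shows "(\<Sum>a\<in>UNIV. \<Sum>b\<in>UNIV. v $ a * w $ b * g $ a $ b) = v \<bullet> (g *v w)"
  by (simp add: inner_vec_def matrix_vector_mult_def sum_distrib_left mult_ac)

section \<open>The Levi-Civita connection\<close>

lemma sum_delta_left: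
  fixes D :: "'i::finite \<Rightarrow> real"
  shows "(\<Sum>l\<in>UNIV. (if m = l then 1 else 0) * D l) = D m"
  by (simp add: if_distrib[of "\<lambda>c. c * _"] cong: if_cong)

lemma symmetric_inner:
  fixes g :: "real ^ 'n::finite ^ 'n"
  assumes "transpose g = g"
  shows "v \<bullet> (g *v w) = w \<bullet> (g *v v)"
  using inner_transpose_right[of v g w] assms by (simp add: inner_commute)

text \<open>Koszul's computation along f. With L_ijm the pairing of \<nabla>_i E_j and E_m, metric
  compatibility says that the i-th derivative of h_jm is L_ijm + L_imj, torsion-freeness says L_ijm
  = L_jim, and together they determine L. For \<open>f = id\<close> this serves the transformation
  law of Christoffel symbols, for an immersion the tangential part of the ambient
  derivative.\<close>

lemma (in pulled_back_connection) koszul: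
  assumes g: "smooth_mat y T g" and sym: "\<And>r. r \<in> T \<Longrightarrow> transpose (g r) = g r"
    and par: "\<And>r a b c. r \<in> T \<Longrightarrow> pd y a (\<lambda>r. g r $ b $ c) r = (\<Sum>d\<in>UNIV. G r a b d * g r $ d $ c) + (\<Sum>d\<in>UNIV. G r a c d * g r $ b $ d)"
    and h: "\<And>q i j. q \<in> S \<Longrightarrow> h q $ i $ j = E i q \<bullet> (g (f q) *v E j q)" and p: "p \<in> S"
  shows "nab i (E j) p \<bullet> (g (f p) *v E m p)
    = (pd x i (\<lambda>q. h q $ j $ m) p + pd x j (\<lambda>q. h q $ i $ m) p - pd x m (\<lambda>q. h q $ i $ j) p) / 2"
proof -
  define L where "L i j m = nab i (E j) p \<bullet> (g (f p) *v E m p)" for i j m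
  have "pd x i (\<lambda>q. h q $ j $ m) p = L i j m + L i m j" for i j m
  proof -
    have "pd x i (\<lambda>q. h q $ j $ m) p = pd x i (\<lambda>q. E j q \<bullet> (g (f q) *v E m q)) p"
      by (rule pd_cong[OF x p]) (rule h)
    also have "\<dots> = L i j m + E j p \<bullet> (g (f p) *v nab i (E m) p)"
      unfolding L_def by (rule pd_metric[OF g par smooth_E smooth_E p])
    also have "E j p \<bullet> (g (f p) *v nab i (E m) p) = L i m j"
      unfolding L_def by (rule symmetric_inner[OF sym[OF f_in[OF p]]])
    finally show ?thesis .
  qed
  moreover have "L i j m = L j i m" for i j m
    unfolding L_def using nab_E_commute[OF p, of i j] by simp
  ultimately show ?thesis
    unfolding L_def[symmetric] by (simp add: \<open>L m i j = L i m j\<close> \<open>L m j i = L j m i\<close>) 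
qed

text \<open>\<open>levi_civita\<close> is a choice, so nothing about it is known before some
  connection is shown to satisfy \<open>is_levi_civita\<close>; these coefficients are the
  witness.\<close>

definition christoffel :: "('m, 'n::finite) field2 \<Rightarrow> ('m, 'n) field3" where
  "christoffel g x p i j k = (\<Sum>l\<in>UNIV. matrix_inv (g x p) $ k $ l *
     ((pd x i (\<lambda>q. g x q $ j $ l) p + pd x j (\<lambda>q. g x q $ i $ l) p - pd x l (\<lambda>q. g x q $ i $ j) p) / 2))"

context
  fixes A :: "('m::{t2_space, second_countable_topology}, 'n::finite) chart set" and g :: "('m, 'n) field2"
  assumes A: "smooth_manifold A" and metric: "pseudo_metric A g"
begin

lemma metric_smooth: "x \<in> A \<Longrightarrow> smooth_mat x (fst x) (g x)"
  using metric smooth_in_mat[OF A, of x "g x"] by (simp add: pseudo_metric_def covariant2_def)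

lemma metric_sym: "x \<in> A \<Longrightarrow> p \<in> fst x \<Longrightarrow> transpose (g x p) = g x p"
  using metric by (auto simp: pseudo_metric_def)

lemma metric_sym_nth: "x \<in> A \<Longrightarrow> p \<in> fst x \<Longrightarrow> g x p $ i $ j = g x p $ j $ i"
  using arg_cong[OF metric_sym, of x p "\<lambda>M. M $ j $ i"] by (simp add: transpose_def)

lemma metric_invertible: "x \<in> A \<Longrightarrow> p \<in> fst x \<Longrightarrow> invertible (g x p)"
  using metric by (auto simp: pseudo_metric_def)

lemma metric_nondegenerate:
  assumes "x \<in> A" "p \<in> fst x" "\<And>w. z \<bullet> (g x p *v w) = 0"
  shows "z = 0"
proof -
  have "z \<bullet> (g x p *v (matrix_inv (g x p) *v z)) = 0" by (rule assms)
  then show ?thesis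
    by (simp add: matrix_vector_mul_assoc matrix_inv_mult[OF metric_invertible[OF assms(1,2)]])
qed

lemma pd_metric_sym: "x \<in> A \<Longrightarrow> p \<in> fst x \<Longrightarrow> pd x i (\<lambda>q. g x q $ j $ k) p = pd x i (\<lambda>q. g x q $ k $ j) p"
  by (rule pd_cong[OF chart_domain_full[OF A]]) (simp_all add: metric_sym_nth)

lemma christoffel_sym: "x \<in> A \<Longrightarrow> p \<in> fst x \<Longrightarrow> christoffel g x p i j k = christoffel g x p j i k"
  unfolding christoffel_def using pd_metric_sym[of x p _ i j] by (simp add: add.commute)

lemma christoffel_lowered:
  assumes "x \<in> A" "p \<in> fst x"
  shows "(\<Sum>k\<in>UNIV. christoffel g x p i j k * g x p $ k $ m)
    = (pd x i (\<lambda>q. g x q $ j $ m) p + pd x j (\<lambda>q. g x q $ i $ m) p - pd x m (\<lambda>q. g x q $ i $ j) p) / 2"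
proof -
  let ?D = "\<lambda>l. (pd x i (\<lambda>q. g x q $ j $ l) p + pd x j (\<lambda>q. g x q $ i $ l) p - pd x l (\<lambda>q. g x q $ i $ j) p) / 2"
  have "(\<Sum>k\<in>UNIV. christoffel g x p i j k * g x p $ k $ m)
      = (\<Sum>k\<in>UNIV. \<Sum>l\<in>UNIV. (g x p $ m $ k * matrix_inv (g x p) $ k $ l) * ?D l)"
    unfolding christoffel_def sum_distrib_right
    by (intro sum.cong refl) (simp only: metric_sym_nth[OF assms, of _ m] mult_ac)
  also have "\<dots> = (\<Sum>l\<in>UNIV. \<Sum>k\<in>UNIV. (g x p $ m $ k * matrix_inv (g x p) $ k $ l) * ?D l)"
    by (rule sum.swap)
  also have "\<dots> = (\<Sum>l\<in>UNIV. (if m = l then 1 else 0) * ?D l)"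
    unfolding sum_distrib_right[symmetric]
    by (simp only: mult_eq_mat_1_nth[OF matrix_inv_mult(1)[OF metric_invertible[OF assms]]])
  also have "\<dots> = ?D m" by (rule sum_delta_left)
  finally show ?thesis .
qed

lemma christoffel_metric:
  assumes "x \<in> A" "p \<in> fst x"
  shows "pd x i (\<lambda>q. g x q $ j $ k) p
    = (\<Sum>r\<in>UNIV. christoffel g x p i j r * g x p $ r $ k) + (\<Sum>r\<in>UNIV. christoffel g x p i k r * g x p $ j $ r)"
proof -
  have "(\<Sum>r\<in>UNIV. christoffel g x p i k r * g x p $ j $ r) = (\<Sum>r\<in>UNIV. christoffel g x p i k r * g x p $ r $ j)"
    by (simp add: metric_sym_nth[OF assms, of j])
  then show ?thesis
    unfolding christoffel_lowered[OF assms] pd_metric_sym[OF assms, of i k j]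
    by (simp only: christoffel_lowered[OF assms] pd_metric_sym[OF assms, of i k j]) (simp add: field_simps)
qed

lemma christoffel_smooth:
  assumes "x \<in> A"
  shows "smooth_fun x (fst x) (\<lambda>p. christoffel g x p i j k)"
proof -
  note x = chart_domain_full[OF A assms]
  have g: "smooth_fun x (fst x) (pd x i (\<lambda>q. g x q $ j $ k))" for i j k
    using metric_smooth[OF assms] by (auto simp: smooth_mat_def intro: smooth_fun_pd[OF x])
  have "smooth_fun x (fst x) (\<lambda>p. matrix_inv (g x p) $ k $ l)" for k l
    using smooth_mat_inv[OF x metric_smooth[OF assms] metric_invertible[OF assms]] by (simp add: smooth_mat_def)
  then show ?thesis
    unfolding christoffel_def
    by (intro smooth_fun_sum[OF x] smooth_fun_mult[OF x] smooth_fun_divide[OF x] smooth_fun_diff[OF x] smooth_fun_add[OF x] g smooth_fun_const) auto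
qed

text \<open>Transforming the derivatives of the metric by hand is avoided: both sides are vectors in
  the chart y, and they have the same products with the frame E_m, by Koszul's formula in y on one
  side and the lowered symbols in x on the other.\<close>

lemma christoffel_connection:
  assumes "x \<in> A" "y \<in> A" "p \<in> fst x" "p \<in> fst y"
  shows "pd x i (\<lambda>q. dmap x y id q j a) p
      + (\<Sum>b\<in>UNIV. \<Sum>c\<in>UNIV. christoffel g y p b c a * dmap x y id p i b * dmap x y id p j c)
    = (\<Sum>k\<in>UNIV. christoffel g x p i j k * dmap x y id p k a)"
proof -
  define S where "S = fst x \<inter> fst y"
  have S: "open S" "S \<subseteq> fst x" "S \<subseteq> fst y" "p \<in> S"
    using overlap_open[OF A assms(1,2)] assms by (auto simp: S_def)
  interpret pulled_back_connection x S y S id "christoffel g y"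
  proof (intro pulled_back_connection.intro pulled_back_connection_axioms.intro)
    show "local_map x S y S id" by (rule transition_map[OF A assms(1,2) S(1-3)])
    show "smooth_fun y S (\<lambda>r. christoffel g y r a b c)" for a b c
      by (rule smooth_fun_subset[OF christoffel_smooth[OF assms(2)] S(3)])
    show "christoffel g y r a b c = christoffel g y r b a c" if "r \<in> S" for r a b c
      using christoffel_sym[OF assms(2)] that S by blast
  qed
  \<comment> \<open>The failure of the transformation law; it turns out to be orthogonal to every
    vector.\<close>
  define z where "z = nab i (E j) p - (\<Sum>k\<in>UNIV. christoffel g x p i j k *\<^sub>R E k p)"
  have h: "g x q $ i $ j = E i q \<bullet> (g y (id q) *v E j q)" if "q \<in> S" for q i j
  proof -
    have "g x q $ i $ j = (axis i 1 :: real ^ 'n) \<bullet> (g x q *v axis j 1)"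
      by (simp add: inner_axis' matrix_vector_mult_basis column_def)
    also have "\<dots> = (jac x y q *v axis i 1) \<bullet> (g y q *v (jac x y q *v axis j 1))"
      using that S by (subst covariant2_jac[of A g x y]) (use metric assms in \<open>auto simp: pseudo_metric_def inner_transform\<close>)
    also have "\<dots> = E i q \<bullet> (g y (id q) *v E j q)"
      by (simp add: matrix_vector_mult_basis column_def jac_def push_def)
    finally show ?thesis .
  qed
  have "z \<bullet> (g y p *v E m p) = 0" for m
  proof -
    have "nab i (E j) p \<bullet> (g y (id p) *v E m p) = (\<Sum>k\<in>UNIV. christoffel g x p i j k * g x p $ k $ m)"
      unfolding christoffel_lowered[OF assms(1,3)]
      by (rule koszul[OF smooth_mat_subset[OF metric_smooth[OF assms(2)] S(3)] _ _ h S(4)])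
        (use S metric_sym[OF assms(2)] christoffel_metric[OF assms(2)] in auto)
    also have "\<dots> = (\<Sum>k\<in>UNIV. christoffel g x p i j k *\<^sub>R E k p) \<bullet> (g y (id p) *v E m p)"
      by (simp add: inner_sum_left h[OF S(4)])
    finally show ?thesis by (simp add: z_def inner_diff_left)
  qed
  \<comment> \<open>The frame spans: the coefficients of w are its components in the chart
    x.\<close>
  moreover have "w = (\<Sum>m\<in>UNIV. (jac y x p *v w) $ m *\<^sub>R E m p)" for w
  proof -
    have "(\<Sum>m\<in>UNIV. (jac y x p *v w) $ m *\<^sub>R E m p) = jac x y p *v (jac y x p *v w)"
      by (simp add: vec_eq_iff push_def jac_def matrix_vector_mult_def mult.commute)
    also have "\<dots> = w"
      using jac_inverse[OF transition_map[OF A assms(2,1) S(1,3,2)] transition_map[OF A assms(1,2) S(1-3)] S(4)]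
      by (simp add: matrix_vector_mul_assoc)
    finally show ?thesis by simp
  qed
  ultimately have "z \<bullet> (g y p *v w) = 0" for w
  proof -
    assume z: "\<And>m. z \<bullet> (g y p *v E m p) = 0" and w: "\<And>w. w = (\<Sum>m\<in>UNIV. (jac y x p *v w) $ m *\<^sub>R E m p)"
    have "z \<bullet> (g y p *v (\<Sum>m\<in>UNIV. (jac y x p *v w) $ m *\<^sub>R E m p)) = 0"
      by (simp add: linear_sum[OF matrix_vector_mul_linear] matrix_vector_mult_scaleR inner_sum_right z)
    then show ?thesis using w[of w] by simp
  qed
  from metric_nondegenerate[OF assms(2,4) this]
  have "nab i (E j) p $ a = (\<Sum>k\<in>UNIV. christoffel g x p i j k *\<^sub>R E k p) $ a"
    by (simp add: z_def)
  then show ?thesis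
    unfolding nab_nth by (simp add: push_def)
qed

lemma is_levi_civita_christoffel: "is_levi_civita A g (christoffel g)"
  unfolding is_levi_civita_def torsion_free_connection_def connection_def smooth_in_real cov2_def
  using christoffel_smooth christoffel_connection christoffel_sym christoffel_metric
  by (simp add: Int_iff)

lemma is_levi_civita: "is_levi_civita A g (levi_civita A g)"
  unfolding levi_civita_def by (rule someI[of "is_levi_civita A g", OF is_levi_civita_christoffel])

lemma levi_civita_sym: "x \<in> A \<Longrightarrow> p \<in> fst x \<Longrightarrow> levi_civita A g x p i j k = levi_civita A g x p j i k"
  using is_levi_civita by (auto simp: is_levi_civita_def torsion_free_connection_def)

lemma levi_civita_smooth: "x \<in> A \<Longrightarrow> smooth_fun x (fst x) (\<lambda>p. levi_civita A g x p i j k)"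
  using is_levi_civita by (auto simp: is_levi_civita_def torsion_free_connection_def connection_def smooth_in_real)

lemma levi_civita_metric:
  assumes "x \<in> A" "p \<in> fst x"
  shows "pd x i (\<lambda>q. g x q $ j $ k) p
    = (\<Sum>r\<in>UNIV. levi_civita A g x p i j r * g x p $ r $ k) + (\<Sum>r\<in>UNIV. levi_civita A g x p i k r * g x p $ j $ r)"
proof -
  have "cov2 (levi_civita A g) 0 g x p i j k = 0"
    using is_levi_civita assms unfolding is_levi_civita_def by blast
  then show ?thesis by (simp add: cov2_def)
qed

lemma levi_civita_connection:
  assumes "x \<in> A" "y \<in> A" "p \<in> fst x" "p \<in> fst y"
  shows "pd x i (\<lambda>q. dmap x y id q j a) p
      + (\<Sum>b\<in>UNIV. \<Sum>c\<in>UNIV. levi_civita A g y p b c a * dmap x y id p i b * dmap x y id p j c)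
    = (\<Sum>k\<in>UNIV. levi_civita A g x p i j k * dmap x y id p k a)"
  using is_levi_civita assms unfolding is_levi_civita_def torsion_free_connection_def connection_def by blast

text \<open>Koszul's argument for the chosen connection itself: whichever one was chosen, its
  lowered coefficients are forced.\<close>

lemma levi_civita_lowered:
  assumes "x \<in> A" "p \<in> fst x"
  shows "(\<Sum>k\<in>UNIV. levi_civita A g x p i j k * g x p $ k $ m)
    = (pd x i (\<lambda>q. g x q $ j $ m) p + pd x j (\<lambda>q. g x q $ i $ m) p - pd x m (\<lambda>q. g x q $ i $ j) p) / 2"
proof -
  define L where "L i j m = (\<Sum>k\<in>UNIV. levi_civita A g x p i j k * g x p $ k $ m)" for i j m
  have "pd x i (\<lambda>q. g x q $ j $ m) p = L i j m + L i m j" for i j m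
    unfolding levi_civita_metric[OF assms] L_def using metric_sym_nth[OF assms, of j] by simp
  moreover have "L i j m = L j i m" for i j m
    unfolding L_def using levi_civita_sym[OF assms, of i j] by simp
  ultimately show ?thesis
    unfolding L_def[symmetric] by (simp add: \<open>L m i j = L i m j\<close> \<open>L m j i = L j m i\<close>)
qed

end

section \<open>Lagrangian immersions\<close>

lemma chart_at:
  assumes "smooth_manifold N"
  shows "chart_at N r \<in> N" "r \<in> fst (chart_at N r)"
proof -
  have "\<exists>x. x \<in> N \<and> r \<in> fst x" using assms unfolding smooth_manifold_def by (metis UNIV_I UN_E)
  from someI_ex[OF this] show "chart_at N r \<in> N" "r \<in> fst (chart_at N r)" by (auto simp: chart_at_def)
qed

section \<open>Smooth maps and pullbacks of tensors\<close>

locale manifold_map =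
  fixes M :: "('m::{t2_space, second_countable_topology}, 'n::finite) chart set"
    and N :: "('p::{t2_space, second_countable_topology}, 'k::finite) chart set"
    and f :: "'m \<Rightarrow> 'p"
  assumes M: "smooth_manifold M" and N: "smooth_manifold N" and smooth_f: "smooth_map M N f"
begin

definition overlap :: "('m, 'n) chart \<Rightarrow> ('p, 'k) chart \<Rightarrow> 'm set" where
  "overlap x y = fst x \<inter> f -` fst y"

lemma overlap_openI: "x \<in> M \<Longrightarrow> y \<in> N \<Longrightarrow> open (overlap x y)"
  using M N smooth_f open_vimage[of _ f] by (auto simp: overlap_def smooth_manifold_def smooth_map_def)

lemma mem_overlap: "p \<in> overlap x y \<longleftrightarrow> p \<in> fst x \<and> f p \<in> fst y"
  by (simp add: overlap_def)

lemma overlap_chart_at: "p \<in> fst x \<Longrightarrow> p \<in> overlap x (chart_at N (f p))"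
  using chart_at[OF N] by (simp add: mem_overlap)

lemma local_map_sub:
  assumes "x \<in> M" "y \<in> N" "open S" "S \<subseteq> fst x" "open T" "T \<subseteq> fst y" "f ` S \<subseteq> T"
  shows "local_map x S y T f"
  by (rule local_mapI[OF M N smooth_f assms])

lemma local_map_overlap: "x \<in> M \<Longrightarrow> y \<in> N \<Longrightarrow> local_map x (overlap x y) y (fst y) f"
  using N by (intro local_map_sub overlap_openI) (auto simp: overlap_def smooth_manifold_def)

lemma push_target_overlap:
  assumes "x \<in> M" "y \<in> N" "z \<in> N" "p \<in> overlap x y" "p \<in> overlap x z"
  shows "push x z f i p = jac y z (f p) *v push x y f i p"
proof -
  have o: "open (overlap x y \<inter> overlap x z)" "open (fst y \<inter> fst z)"
    using assms by (simp_all add: open_Int overlap_openI overlap_open[OF N])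
  show ?thesis
    by (rule push_target[OF local_map_sub[OF assms(1,2) o(1) _ o(2)] transition_map[OF N assms(2,3) o(2)]])
      (use assms in \<open>auto simp: overlap_def\<close>)
qed

lemma push_source_overlap:
  assumes "x \<in> M" "x' \<in> M" "y \<in> N" "p \<in> overlap x y" "p \<in> overlap x' y"
  shows "push x y f i p = (\<Sum>b\<in>UNIV. dmap x x' id p i b *\<^sub>R push x' y f b p)"
proof -
  have o: "open (overlap x y \<inter> overlap x' y)" "open (fst y)"
    using assms N by (simp_all add: open_Int overlap_openI smooth_manifold_def)
  show ?thesis
    by (rule push_source[OF local_map_sub[OF assms(2,3) o(1) _ o(2)] transition_map[OF M assms(1,2) o(1)]])
      (use assms in \<open>auto simp: overlap_def\<close>)
qed

text \<open>The chart \<open>chart_at N (f p)\<close> inside \<open>pullback\<close> may jump with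
  p; only with a fixed target chart y can the components be differentiated.\<close>

lemma pullback_eq:
  assumes T: "covariant2 N T" and "x \<in> M" "y \<in> N" "p \<in> overlap x y"
  shows "pullback N f T x p $ i $ j = push x y f i p \<bullet> (T y (f p) *v push x y f j p)"
proof -
  define z where "z = chart_at N (f p)"
  have z: "z \<in> N" "p \<in> overlap x z" "f p \<in> fst z" "f p \<in> fst y"
    using chart_at[OF N] assms by (auto simp: z_def mem_overlap)
  have "pullback N f T x p $ i $ j = push x z f i p \<bullet> (T z (f p) *v push x z f j p)"
    unfolding pullback_def Let_def z_def[symmetric] by (simp add: double_sum_inner[symmetric] push_def)
  also have "\<dots> = push x y f i p \<bullet> (T y (f p) *v push x y f j p)"
    unfolding push_target_overlap[OF assms(2,3) z(1) assms(4) z(2)] covariant2_jac[OF T assms(3) z(1,4,3)] inner_transform ..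
  finally show ?thesis .
qed

lemma covariant2_smooth: "covariant2 N T \<Longrightarrow> y \<in> N \<Longrightarrow> smooth_mat y (fst y) (T y)"
  using smooth_in_mat[OF N, of y "T y"] by (simp add: covariant2_def)

lemma compose_mat:
  assumes "x \<in> M" "y \<in> N" "smooth_mat y (fst y) A"
  shows "smooth_mat x (overlap x y) (\<lambda>q. A (f q))"
  using assms local_map.compose[OF local_map_overlap[OF assms(1,2)]] by (auto simp: smooth_mat_def)

lemma smooth_fun_overlapI:
  assumes "x \<in> M" "\<And>y. y \<in> N \<Longrightarrow> smooth_fun x (overlap x y) u"
  shows "smooth_fun x (fst x) u"
proof (rule smooth_fun_local[OF chart_domain_full[OF M assms(1)]])
  fix p assume "p \<in> fst x"
  then show "\<exists>T. p \<in> T \<and> chart_domain x T \<and> smooth_fun x T u"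
    using overlap_chart_at local_map.x[OF local_map_overlap[OF assms(1)]] assms(2) chart_at[OF N] by blast
qed

lemma covariant2_pullback:
  assumes T: "covariant2 N T"
  shows "covariant2 M (pullback N f T)"
  unfolding covariant2_def
proof (intro conjI ballI allI)
  fix x assume x: "x \<in> M"
  have "smooth_fun x (overlap x y) (\<lambda>q. pullback N f T x q $ i $ j)" if y: "y \<in> N" for y i j
  proof -
    interpret lm: local_map x "overlap x y" y "fst y" f by (rule local_map_overlap[OF x y])
    have "smooth_fun x (overlap x y) (\<lambda>q. push x y f i q \<bullet> (T y (f q) *v push x y f j q))"
      by (intro smooth_fun_inner[OF lm.x] smooth_vec_mult[OF lm.x] lm.smooth_E compose_mat[OF x y covariant2_smooth[OF T y]])
    then show ?thesis
      by (subst smooth_fun_cong[OF lm.x]) (simp add: pullback_eq[OF T x y])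
  qed
  then have "smooth_mat x (fst x) (pullback N f T x)"
    unfolding smooth_mat_def using smooth_fun_overlapI[OF x] by simp
  then show "smooth_in x (pullback N f T x)" by (simp add: smooth_in_mat[OF M x])
next
  fix x x' p i j assume x: "x \<in> M" "x' \<in> M" "p \<in> fst x \<inter> fst x'"
  define y where "y = chart_at N (f p)"
  have y: "y \<in> N" "p \<in> overlap x y" "p \<in> overlap x' y" using chart_at[OF N] overlap_chart_at x by (auto simp: y_def)
  show "pullback N f T x p $ i $ j = (\<Sum>a\<in>UNIV. \<Sum>b\<in>UNIV. dmap x x' id p i a * dmap x x' id p j b * pullback N f T x' p $ a $ b)"
    unfolding pullback_eq[OF T x(1) y(1,2)] pullback_eq[OF T x(2) y(1,3)] push_source_overlap[OF x(1,2) y]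
    by (simp add: inner_sum_left inner_sum_right linear_sum[OF matrix_vector_mul_linear] matrix_vector_mult_scaleR
        sum_distrib_left mult_ac) (rule sum.swap)
qed

end

section \<open>Lagrangian immersions and the frame E, JE\<close>

locale lagrangian_immersion = manifold_map M N f
  for M :: "('m::{t2_space, second_countable_topology}, 'n::finite) chart set"
    and N :: "('p::{t2_space, second_countable_topology}, 'k::finite) chart set"
    and f :: "'m \<Rightarrow> 'p" +
  fixes g J :: "('p, 'k) field2"
  assumes para: "para_kaehler N g J" and spacelike: "spacelike M N g f" and lagr: "lagrangian M N (kaehler_form g J) f"
begin

abbreviation h where "h \<equiv> pullback N f g"

abbreviation "Jt y q \<equiv> transpose (J y (f q))"

definition P :: "('m, 'n) chart \<Rightarrow> ('p, 'k) chart \<Rightarrow> 'n \<Rightarrow> 'm \<Rightarrow> real ^ 'k" where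
  "P x y i q = push x y f i q - Jt y q *v push x y f i q"

lemma g: "pseudo_metric N g" and cov_g: "covariant2 N g" and cov_W: "covariant2 N (kaehler_form g J)"
  using para by (auto simp: para_kaehler_def pseudo_metric_def symplectic_def)

lemma J_smooth: "y \<in> N \<Longrightarrow> smooth_mat y (fst y) (J y)"
  using para smooth_in_mat[OF N, of y "J y"] by (simp add: para_kaehler_def endomorphism_def)

lemma J_J: "y \<in> N \<Longrightarrow> r \<in> fst y \<Longrightarrow> transpose (J y r) *v (transpose (J y r) *v v) = v"
  using para by (auto simp: para_kaehler_def matrix_vector_mul_assoc matrix_transpose_mul[symmetric] simp del: transpose_matrix_vector)

lemma W_inner: "v \<bullet> (kaehler_form g J y r *v w) = (transpose (J y r) *v v) \<bullet> (g y r *v w)"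
proof -
  have "(transpose (J y r) *v v) \<bullet> (g y r *v w) = v \<bullet> (transpose (transpose (J y r)) *v (g y r *v w))"
    by (rule inner_transpose_right[symmetric])
  then show ?thesis
    by (simp add: kaehler_form_def matrix_vector_mul_assoc del: transpose_matrix_vector)
qed

lemma W_antisym:
  assumes "y \<in> N" "r \<in> fst y"
  shows "v \<bullet> (kaehler_form g J y r *v w) = - (w \<bullet> (kaehler_form g J y r *v v))"
proof -
  have t: "transpose (kaehler_form g J y r) = - kaehler_form g J y r"
    using para assms by (auto simp: para_kaehler_def symplectic_def)
  have "(- A) *v w = - (A *v w)" for A :: "real ^ 'k ^ 'k" and w
    by (simp add: vec_eq_iff matrix_vector_mult_def sum_negf)
  then show ?thesis
    using inner_transpose_right[of v "kaehler_form g J y r" w] unfolding t by (simp add: inner_commute)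
qed

lemma g_sym: "y \<in> N \<Longrightarrow> r \<in> fst y \<Longrightarrow> v \<bullet> (g y r *v w) = w \<bullet> (g y r *v v)"
  by (rule symmetric_inner) (rule metric_sym[OF N g])

lemma g_J_left: "y \<in> N \<Longrightarrow> r \<in> fst y \<Longrightarrow> (transpose (J y r) *v v) \<bullet> (g y r *v w) = - ((transpose (J y r) *v w) \<bullet> (g y r *v v))"
  using W_antisym[of y r v w] unfolding W_inner .

text \<open>J is an anti-isometry, by antisymmetry of \<Omega> and J^2 = 1. Hence the block of the
  Gram matrix belonging to the normal vectors J E_i is -h.\<close>

lemma g_J_J: "y \<in> N \<Longrightarrow> r \<in> fst y \<Longrightarrow> (transpose (J y r) *v v) \<bullet> (g y r *v (transpose (J y r) *v w)) = - (v \<bullet> (g y r *v w))"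
  using g_J_left[of y r v "transpose (J y r) *v w"] J_J[of y r w] g_sym[of y r v w] by simp

context
  fixes x y p
  assumes x: "x \<in> M" and y: "y \<in> N" and p: "p \<in> overlap x y"
begin

lemma fp: "f p \<in> fst y" and px: "p \<in> fst x"
  using p by (auto simp: mem_overlap)

lemma h_eq: "push x y f i p \<bullet> (g y (f p) *v push x y f j p) = h x p $ i $ j"
  using pullback_eq[OF cov_g x y p] by simp

text \<open>The Lagrangian condition \<Omega>(E_i, E_j) = 0, read as: J maps tangent vectors to
  normal ones.\<close>

lemma JE_E: "(Jt y p *v push x y f i p) \<bullet> (g y (f p) *v push x y f j p) = 0"
  using pullback_eq[OF cov_W x y p, of i j] lagr x px unfolding W_inner by (simp add: lagrangian_def del: transpose_matrix_vector)

lemma E_JE: "push x y f i p \<bullet> (g y (f p) *v (Jt y p *v push x y f j p)) = 0"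
  using JE_E[of j i] g_sym[OF y fp] by metis

lemma JE_JE: "(Jt y p *v push x y f i p) \<bullet> (g y (f p) *v (Jt y p *v push x y f j p)) = - h x p $ i $ j"
  using g_J_J[OF y fp] h_eq by (simp del: transpose_matrix_vector)

lemma P_E: "P x y i p \<bullet> (g y (f p) *v push x y f j p) = h x p $ i $ j"
  by (simp add: P_def inner_diff_left h_eq JE_E del: transpose_matrix_vector)

lemma h_sym_nth: "h x p $ i $ j = h x p $ j $ i"
  using h_eq g_sym[OF y fp] by metis

lemma h_pos: "v \<noteq> 0 \<Longrightarrow> v \<bullet> (h x p *v v) > 0"
  using spacelike x px by (simp add: spacelike_def positive_definite_def)

text \<open>The Gram matrix of the E_i and J E_i is block diagonal with blocks h and -h, and there
  are 2n = k of these vectors, so they form a basis.\<close>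

lemma frame_nondegenerate:
  assumes z: "\<And>m. z \<bullet> (g y (f p) *v push x y f m p) = 0" "\<And>m. z \<bullet> (g y (f p) *v (Jt y p *v push x y f m p)) = 0"
  shows "z = 0"
proof -
  define L :: "(real ^ 'n) \<times> (real ^ 'n) \<Rightarrow> real ^ 'k" where
    "L = (\<lambda>(u, v). (\<Sum>i\<in>UNIV. u $ i *\<^sub>R push x y f i p) + (\<Sum>i\<in>UNIV. v $ i *\<^sub>R (Jt y p *v push x y f i p)))"
  have lin: "linear L"
    by (rule linearI)
      (auto simp: L_def sum.distrib scaleR_add_left scaleR_add_right scaleR_sum_right simp del: transpose_matrix_vector)
  have "w = 0" if "L w = 0" for w
  proof -
    obtain u v where w: "w = (u, v)" by force
    have L: "(\<Sum>i\<in>UNIV. u $ i *\<^sub>R push x y f i p) + (\<Sum>i\<in>UNIV. v $ i *\<^sub>R (Jt y p *v push x y f i p)) = 0"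
      using that by (simp add: L_def w del: transpose_matrix_vector)
    have "(\<Sum>i\<in>UNIV. u $ i * h x p $ i $ m) = 0" "(\<Sum>i\<in>UNIV. v $ i * h x p $ i $ m) = 0" for m
      using arg_cong[OF L, of "\<lambda>z. z \<bullet> (g y (f p) *v push x y f m p)"]
        arg_cong[OF L, of "\<lambda>z. z \<bullet> (g y (f p) *v (Jt y p *v push x y f m p))"]
      by (simp_all add: inner_add_left inner_sum_left h_eq JE_E E_JE JE_JE sum_negf del: transpose_matrix_vector)
    \<comment> \<open>Contracting with u and v themselves produces h(u, u) and h(v, v), which vanish
      only for u = v = 0.\<close>
    then have "u \<bullet> (h x p *v u) = 0" "v \<bullet> (h x p *v v) = 0"
      by (simp_all add: inner_vec_def matrix_vector_mult_def h_sym_nth[of _ _] mult.commute)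
    then show "w = 0" using h_pos[of u] h_pos[of v] by (auto simp: w zero_prod_def)
  qed
  then have "inj L" using lin by (simp add: linear_injective_0)
  \<comment> \<open>The equality of dimensions is part of \<open>lagrangian\<close>.\<close>
  moreover have "dim (UNIV :: (real ^ 'k) set) = dim (UNIV :: ((real ^ 'n) \<times> (real ^ 'n)) set)"
    using lagr by (simp add: lagrangian_def)
  ultimately have "surj L" using lin by (intro linear_injective_imp_surjective)
  have "z \<bullet> (g y (f p) *v w) = 0" for w
  proof -
    obtain u v where "w = L (u, v)" using \<open>surj L\<close> by (metis surjE prod.exhaust)
    then show ?thesis
      by (simp add: L_def matrix_vector_right_distrib linear_sum[OF matrix_vector_mul_linear] matrix_vector_mult_scaleR
          inner_add_right inner_sum_right z del: transpose_matrix_vector)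
  qed
  then show "z = 0" by (rule metric_nondegenerate[OF N g y fp])
qed

end

end

lemma endomorphism_jac:
  assumes "endomorphism A T" "x \<in> A" "y \<in> A" "p \<in> fst x" "p \<in> fst y"
  shows "T x p = transpose (jac x y p) ** T y p ** transpose (jac y x p)"
proof -
  have "(transpose (jac x y p) ** T y p ** transpose (jac y x p)) $ i $ j = T x p $ i $ j" for i j
  proof -
    have "(transpose (jac x y p) ** T y p ** transpose (jac y x p)) $ i $ j
        = (\<Sum>b\<in>UNIV. \<Sum>a\<in>UNIV. dmap x y id p i a * T y p $ a $ b * dmap y x id p b j)"
      by (simp add: matrix_matrix_mult_def transpose_def jac_def sum_distrib_left sum_distrib_right mult_ac)
    also have "\<dots> = (\<Sum>a\<in>UNIV. \<Sum>b\<in>UNIV. dmap x y id p i a * T y p $ a $ b * dmap y x id p b j)"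
      by (rule sum.swap)
    also have "\<dots> = T x p $ i $ j"
      using assms unfolding endomorphism_def by (metis (no_types, lifting) IntI)
    finally show ?thesis .
  qed
  then show ?thesis by (simp add: vec_eq_iff)
qed

lemma pos_def_invertible:
  fixes A :: "real ^ 'n::finite ^ 'n"
  assumes "\<And>v. v \<noteq> 0 \<Longrightarrow> v \<bullet> (A *v v) > 0"
  shows "invertible A"
proof -
  have "v = 0" if "A *v v = 0" for v
    using assms[of v] that by (cases "v = 0") auto
  then show ?thesis
    unfolding invertible_left_inverse matrix_left_invertible_ker by blast
qed

section \<open>The ambient connection along the immersion and the second fundamental form\<close>

context lagrangian_immersion
begin

abbreviation nab where "nab x y \<equiv> cov_along x y f (levi_civita N g y)"

abbreviation D where "D \<equiv> levi_civita M h"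

lemma h_metric: "pseudo_metric M h"
  unfolding pseudo_metric_def
proof (intro conjI ballI covariant2_pullback cov_g)
  fix x p assume x: "x \<in> M" "p \<in> fst x"
  show "transpose (h x p) = h x p"
    using h_sym_nth[OF x(1) chart_at(1)[OF N] overlap_chart_at[OF x(2)]] by (simp add: vec_eq_iff transpose_def)
  show "invertible (h x p)"
    by (rule pos_def_invertible) (rule h_pos[OF x(1) chart_at(1)[OF N] overlap_chart_at[OF x(2)]])
qed

lemma pulled_back_sub:
  assumes "x \<in> M" "y \<in> N" "open S" "S \<subseteq> overlap x y"
  shows "pulled_back_connection x S y (fst y) f (levi_civita N g y)"
proof (intro pulled_back_connection.intro pulled_back_connection_axioms.intro)
  show "local_map x S y (fst y) f"
    using assms N by (intro local_map_sub) (auto simp: overlap_def smooth_manifold_def)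
  show "smooth_fun y (fst y) (\<lambda>r. levi_civita N g y r a b c)" for a b c
    by (rule levi_civita_smooth[OF N g assms(2)])
  show "levi_civita N g y r a b c = levi_civita N g y r b a c" if "r \<in> fst y" for r a b c
    by (rule levi_civita_sym[OF N g assms(2) that])
qed

lemma pulled_back: "x \<in> M \<Longrightarrow> y \<in> N \<Longrightarrow> pulled_back_connection x (overlap x y) y (fst y) f (levi_civita N g y)"
  by (rule pulled_back_sub) (auto intro: overlap_openI)

lemma J_parallel:
  assumes "y \<in> N" "r \<in> fst y"
  shows "pd y a (\<lambda>r. J y r $ b $ c) r = (\<Sum>d\<in>UNIV. levi_civita N g y r a b d * J y r $ d $ c)
    - (\<Sum>d\<in>UNIV. levi_civita N g y r a d c * J y r $ b $ d)"
proof -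
  have "cov_endo (levi_civita N g) J y r a b c = 0"
    using para assms unfolding para_kaehler_def by blast
  then show ?thesis by (simp add: cov_endo_def)
qed

lemma overlap_chart_domain: "x \<in> M \<Longrightarrow> y \<in> N \<Longrightarrow> chart_domain x (overlap x y)"
  using local_map.x[OF local_map_overlap] .

lemma smooth_push: "x \<in> M \<Longrightarrow> y \<in> N \<Longrightarrow> smooth_vec x (overlap x y) (push x y f i)"
  using local_map.smooth_E[OF local_map_overlap] .

lemma smooth_J_push:
  assumes "x \<in> M" "y \<in> N"
  shows "smooth_vec x (overlap x y) (\<lambda>q. Jt y q *v push x y f i q)"
proof (rule smooth_vec_mult[OF overlap_chart_domain[OF assms] _ smooth_push[OF assms]])
  show "smooth_mat x (overlap x y) (\<lambda>q. Jt y q)"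
    using compose_mat[OF assms J_smooth[OF assms(2)]] by (simp add: smooth_mat_def transpose_def)
qed

lemma smooth_P: "x \<in> M \<Longrightarrow> y \<in> N \<Longrightarrow> smooth_vec x (overlap x y) (P x y i)"
  unfolding P_def[abs_def] by (intro smooth_vec_diff overlap_chart_domain smooth_push smooth_J_push)

lemma P_source:
  assumes "x \<in> M" "x' \<in> M" "y \<in> N" "p \<in> overlap x y" "p \<in> overlap x' y"
  shows "P x y i p = (\<Sum>b\<in>UNIV. dmap x x' id p i b *\<^sub>R P x' y b p)"
  unfolding P_def push_source_overlap[OF assms]
  by (simp add: linear_sum[OF matrix_vector_mul_linear] matrix_vector_mult_scaleR scaleR_diff_right sum_subtractf
      del: transpose_matrix_vector)

text \<open>J is a tensor field, so the Jacobian intertwines its matrices in the two charts, and the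
  P_i transform like vectors.\<close>

lemma P_target:
  assumes "x \<in> M" "y \<in> N" "z \<in> N" "p \<in> overlap x y" "p \<in> overlap x z"
  shows "P x z i p = jac y z (f p) *v P x y i p"
proof -
  have r: "f p \<in> fst y" "f p \<in> fst z" "open (fst y \<inter> fst z)"
    using assms overlap_open[OF N] by (auto simp: mem_overlap)
  let ?A = "jac y z (f p)" and ?B = "jac z y (f p)"
  have "?A ** ?B = mat 1"
    by (rule jac_inverse[OF transition_map[OF N assms(3,2) r(3)] transition_map[OF N assms(2,3) r(3)]]) (use r in auto)
  moreover have "Jt y p = ?B ** Jt z p ** ?A"
    using para by (subst endomorphism_jac[OF _ assms(2,3) r(1,2)])
      (auto simp: para_kaehler_def matrix_transpose_mul matrix_mul_assoc)
  ultimately have "?A ** Jt y p = Jt z p ** ?A"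
    by (simp add: matrix_mul_assoc)
  then have "?A *v (Jt y p *v v) = Jt z p *v (?A *v v)" for v
    by (simp only: matrix_vector_mul_assoc)
  then show ?thesis
    unfolding P_def push_target_overlap[OF assms] by (simp add: matrix_vector_mult_diff_distrib del: transpose_matrix_vector)
qed

text \<open>Pairing the relation with E_m shows that the difference of the coefficients is
  annihilated by h, which is definite.\<close>

lemma P_independent:
  assumes "x \<in> M" "y \<in> N" "p \<in> overlap x y" "(\<Sum>a\<in>UNIV. u a *\<^sub>R P x y a p) = (\<Sum>a\<in>UNIV. v a *\<^sub>R P x y a p)"
  shows "u a = v a"
proof -
  define w where "w = (\<chi> a. u a - v a)"
  have z: "(\<Sum>a\<in>UNIV. w $ a *\<^sub>R P x y a p) = 0"
    using assms(4) by (simp add: w_def scaleR_diff_left sum_subtractf)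
  have "(\<Sum>a\<in>UNIV. w $ a * h x p $ a $ m) = 0" for m
  proof -
    have "(\<Sum>a\<in>UNIV. w $ a * h x p $ a $ m) = (\<Sum>a\<in>UNIV. w $ a *\<^sub>R P x y a p) \<bullet> (g y (f p) *v push x y f m p)"
      by (simp only: inner_sum_left inner_scaleR_left P_E[OF assms(1-3)])
    then show ?thesis by (simp only: z inner_zero_left)
  qed
  then have "w \<bullet> (h x p *v w) = 0"
    by (simp add: inner_vec_def matrix_vector_mult_def h_sym_nth[OF assms(1-3), of _ _] mult.commute)
  then have "w = 0" using h_pos[OF assms(1-3), of w] by auto
  then have "w $ a = 0" by simp
  then show ?thesis by (simp add: w_def)
qed

text \<open>The tangential part of the ambient derivative is D, because both sides are given by the
  same Koszul formula in h.\<close>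

lemma nab_push_E:
  assumes x: "x \<in> M" and y: "y \<in> N" and p: "p \<in> overlap x y"
  shows "nab x y i (push x y f j) p \<bullet> (g y (f p) *v push x y f m p) = (\<Sum>k\<in>UNIV. D x p i j k * h x p $ k $ m)"
  unfolding levi_civita_lowered[OF M h_metric x px[OF x y p]]
  by (rule pulled_back_connection.koszul[OF pulled_back[OF x y]])
    (use p metric_smooth[OF N g y] metric_sym[OF N g y] levi_civita_metric[OF N g y] pullback_eq[OF cov_g x y] in auto)

lemma nab_J_push:
  assumes x: "x \<in> M" and y: "y \<in> N" and p: "p \<in> overlap x y"
  shows "nab x y i (\<lambda>q. Jt y q *v push x y f j q) p = Jt y p *v nab x y i (push x y f j) p"
  by (rule pulled_back_connection.nab_parallel_endo[OF pulled_back[OF x y] J_smooth[OF y] J_parallel[OF y] smooth_push[OF x y] p])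

text \<open>Obtained by differentiating \<Omega>(E_j, E_m) = 0 with \<nabla>J = 0. With
  torsion-freeness it makes the second fundamental form completely symmetric.\<close>

lemma J_nab_push_sym:
  assumes x: "x \<in> M" and y: "y \<in> N" and p: "p \<in> overlap x y"
  shows "(Jt y p *v nab x y i (push x y f j) p) \<bullet> (g y (f p) *v push x y f m p)
    = (Jt y p *v nab x y i (push x y f m) p) \<bullet> (g y (f p) *v push x y f j p)"
proof -
  have "pd x i (\<lambda>q. (Jt y q *v push x y f j q) \<bullet> (g y (f q) *v push x y f m q)) p = pd x i (\<lambda>q. 0) p"
    by (rule pd_cong[OF overlap_chart_domain[OF x y] p]) (rule JE_E[OF x y])
  then have "0 = pd x i (\<lambda>q. (Jt y q *v push x y f j q) \<bullet> (g y (f q) *v push x y f m q)) p"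
    by (simp add: pd_const)
  also have "\<dots> = nab x y i (\<lambda>q. Jt y q *v push x y f j q) p \<bullet> (g y (f p) *v push x y f m p)
      + (Jt y p *v push x y f j p) \<bullet> (g y (f p) *v nab x y i (push x y f m) p)"
    by (rule pulled_back_connection.pd_metric[OF pulled_back[OF x y] metric_smooth[OF N g y] levi_civita_metric[OF N g y]
          smooth_J_push[OF x y] smooth_push[OF x y] p])
  also have "(Jt y p *v push x y f j p) \<bullet> (g y (f p) *v nab x y i (push x y f m) p)
      = - ((Jt y p *v nab x y i (push x y f m) p) \<bullet> (g y (f p) *v push x y f j p))"
    by (rule g_J_left[OF y fp[OF x y p]])
  finally show ?thesis by (simp add: nab_J_push[OF x y p] del: transpose_matrix_vector)
qed

lemma second_ff_eq:
  assumes x: "x \<in> M" and p: "p \<in> fst x"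
  defines "y \<equiv> chart_at N (f p)"
  shows "second_ff N g f x p i j a = (nab x y i (push x y f j) p - (\<Sum>k\<in>UNIV. D x p i j k *\<^sub>R push x y f k p)) $ a"
proof -
  have y: "y \<in> N" and py: "p \<in> overlap x y" using chart_at[OF N] overlap_chart_at[OF p] by (auto simp: y_def)
  let ?Q = "nab x y i (push x y f j) p"
  have Q: "ambient_derivative N g f x p i j = (\<lambda>a. ?Q $ a)"
    unfolding ambient_derivative_def Let_def y_def[symmetric]
    by (simp add: pulled_back_connection.nab_nth[OF pulled_back[OF x y]] push_def)
  have "(\<Sum>b\<in>UNIV. \<Sum>c\<in>UNIV. g y (f p) $ b $ c * ?Q $ b * dmap x y f p l c) = (\<Sum>k\<in>UNIV. D x p i j k * h x p $ k $ l)" for l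
    unfolding nab_push_E[OF x y py, symmetric] by (simp add: double_sum_inner[symmetric] push_def mult_ac)
  then have "second_ff N g f x p i j a = ?Q $ a - (\<Sum>k\<in>UNIV. \<Sum>l\<in>UNIV. matrix_inv (h x p) $ k $ l
      * (\<Sum>r\<in>UNIV. D x p i j r * h x p $ r $ l) * push x y f k p $ a)"
    unfolding second_ff_def normal_part_def Let_def y_def[symmetric] Q by (simp add: push_def)
  \<comment> \<open>The inverse of h undoes the lowering, so the tangential part that is subtracted
    has the coefficients of D.\<close>
  also have "(\<Sum>k\<in>UNIV. \<Sum>l\<in>UNIV. matrix_inv (h x p) $ k $ l * (\<Sum>r\<in>UNIV. D x p i j r * h x p $ r $ l) * push x y f k p $ a)
      = (\<Sum>k\<in>UNIV. D x p i j k * push x y f k p $ a)"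
  proof (rule sum.cong[OF refl])
    fix k
    have "(\<Sum>l\<in>UNIV. matrix_inv (h x p) $ k $ l * (\<Sum>r\<in>UNIV. D x p i j r * h x p $ r $ l))
        = (\<Sum>r\<in>UNIV. (\<Sum>l\<in>UNIV. matrix_inv (h x p) $ k $ l * h x p $ l $ r) * D x p i j r)"
      by (simp add: sum_distrib_left sum_distrib_right mult_ac h_sym_nth[OF x y py, of _ _])
        (subst sum.swap, simp add: h_sym_nth[OF x y py, of _ _])
    also have "\<dots> = D x p i j k"
      by (simp only: mult_eq_mat_1_nth[OF matrix_inv_mult(2)[OF metric_invertible[OF M h_metric x p]]] sum_delta_left)
    finally show "(\<Sum>l\<in>UNIV. matrix_inv (h x p) $ k $ l * (\<Sum>r\<in>UNIV. D x p i j r * h x p $ r $ l) * push x y f k p $ a)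
        = D x p i j k * push x y f k p $ a"
      by (simp add: sum_distrib_right[symmetric])
  qed
  finally show ?thesis by simp
qed

lemma second_ff3_eq:
  assumes x: "x \<in> M" and p: "p \<in> fst x"
  defines "y \<equiv> chart_at N (f p)"
  shows "second_ff3 N g J f x p i j m = (Jt y p *v nab x y i (push x y f j) p) \<bullet> (g y (f p) *v push x y f m p)"
proof -
  have y: "y \<in> N" and py: "p \<in> overlap x y" using chart_at[OF N] overlap_chart_at[OF p] by (auto simp: y_def)
  let ?Pi = "nab x y i (push x y f j) p - (\<Sum>k\<in>UNIV. D x p i j k *\<^sub>R push x y f k p)"
  have "second_ff3 N g J f x p i j m = ?Pi \<bullet> (kaehler_form g J y (f p) *v push x y f m p)"
    unfolding second_ff3_def Let_def y_def[symmetric] second_ff_eq[OF x p, folded y_def]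
    by (simp only: double_sum_inner[symmetric]) (simp add: push_def mult_ac)
  also have "\<dots> = (Jt y p *v nab x y i (push x y f j) p) \<bullet> (g y (f p) *v push x y f m p)"
    unfolding W_inner
    by (simp add: matrix_vector_mult_diff_distrib inner_diff_left linear_sum[OF matrix_vector_mul_linear]
        matrix_vector_mult_scaleR inner_sum_left JE_E[OF x y py] del: transpose_matrix_vector)
  finally show ?thesis .
qed

lemma second_ff3_sym12:
  assumes "x \<in> M" "p \<in> fst x"
  shows "second_ff3 N g J f x p i j m = second_ff3 N g J f x p j i m"
  unfolding second_ff3_eq[OF assms]
  using pulled_back_connection.nab_E_commute[OF pulled_back[OF assms(1) chart_at(1)[OF N]] overlap_chart_at[OF assms(2)]]
  by metis

lemma second_ff3_sym23:
  assumes "x \<in> M" "p \<in> fst x"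
  shows "second_ff3 N g J f x p i j m = second_ff3 N g J f x p i m j"
  unfolding second_ff3_eq[OF assms] by (rule J_nab_push_sym[OF assms(1) chart_at(1)[OF N] overlap_chart_at[OF assms(2)]])

end

section \<open>The induced connection\<close>

text \<open>Shape of the terms of the space form tensor: the free index sits on one vector and the
  other two are contracted by a bilinear form.\<close>

lemma triple_sum_inner:
  fixes A G :: "real ^ 'n::finite ^ 'n" and u v w :: "real ^ 'n"
  shows "(\<Sum>b\<in>UNIV. \<Sum>c\<in>UNIV. \<Sum>d\<in>UNIV. A $ b $ l * G $ c $ d * (u $ b * v $ c * w $ d)) = (transpose A *v u) $ l * (v \<bullet> (G *v w))"
proof -
  have "(transpose A *v u) $ l * (v \<bullet> (G *v w)) = (\<Sum>b\<in>UNIV. A $ b $ l * u $ b) * (\<Sum>c\<in>UNIV. \<Sum>d\<in>UNIV. v $ c * w $ d * G $ c $ d)"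
    unfolding double_sum_inner by (simp add: matrix_vector_mult_def transpose_def del: transpose_matrix_vector)
  also have "\<dots> = (\<Sum>b\<in>UNIV. \<Sum>c\<in>UNIV. \<Sum>d\<in>UNIV. A $ b $ l * u $ b * (v $ c * w $ d * G $ c $ d))"
    unfolding sum_product by (simp only: sum_distrib_left)
  finally show ?thesis by (simp only: mult_ac)
qed

locale minimal_lagrangian_immersion = lagrangian_immersion M N f g J
  for M :: "('m::{t2_space, second_countable_topology}, 'n::finite) chart set"
    and N :: "('p::{t2_space, second_countable_topology}, 'k::finite) chart set"
    and f :: "'m \<Rightarrow> 'p" and g J :: "('p, 'k) field2" +
  assumes mean: "mean_curvature_zero M N g J f"
begin

abbreviation B where "B \<equiv> trace_free_part h (second_ff3 N g J f)"

text \<open>The coefficients of \<open>induced_connection\<close>, here for a source of any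
  dimension; only the last locale specializes to surfaces.\<close>

definition \<Gamma> :: "('m, 'n) field3" where
  "\<Gamma> x p i j k = D x p i j k - (\<Sum>r\<in>UNIV. B x p i j r * matrix_inv (h x p) $ r $ k)"

context
  fixes x p
  assumes x: "x \<in> M" and p: "p \<in> fst x"
begin

lemma B_eq: "B x p i j k = second_ff3 N g J f x p i j k"
  using mean x p by (simp add: trace_free_part_def mean_curvature_zero_def)

lemma B_sym12: "B x p i j k = B x p j i k"
  unfolding B_eq by (rule second_ff3_sym12[OF x p])

lemma B_sym23: "B x p i j k = B x p i k j"
  unfolding B_eq by (rule second_ff3_sym23[OF x p])

lemma \<Gamma>_sym: "\<Gamma> x p i j k = \<Gamma> x p j i k"
  unfolding \<Gamma>_def using B_sym12[of i j] levi_civita_sym[OF M h_metric x p, of i j] by simp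

lemma \<Gamma>_lowered:
  "(\<Sum>k\<in>UNIV. \<Gamma> x p i j k * h x p $ k $ m) = (\<Sum>k\<in>UNIV. D x p i j k * h x p $ k $ m) - B x p i j m"
proof -
  have "(\<Sum>k\<in>UNIV. (\<Sum>r\<in>UNIV. B x p i j r * matrix_inv (h x p) $ r $ k) * h x p $ k $ m)
      = (\<Sum>r\<in>UNIV. (\<Sum>k\<in>UNIV. matrix_inv (h x p) $ r $ k * h x p $ k $ m) * B x p i j r)"
    unfolding sum_distrib_right by (subst sum.swap) (simp only: mult_ac)
  also have "\<dots> = (\<Sum>r\<in>UNIV. (if m = r then 1 else 0) * B x p i j r)"
    by (simp only: mult_eq_mat_1_nth[OF matrix_inv_mult(2)[OF metric_invertible[OF M h_metric x p]]] eq_commute[of m])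
  also have "\<dots> = B x p i j m" by (rule sum_delta_left)
  finally show ?thesis
    by (simp add: \<Gamma>_def left_diff_distrib sum_subtractf)
qed

text \<open>The trace of the correction B is the mean curvature, which vanishes. Hence \<Gamma> and
  D differentiate densities in the same way.\<close>

lemma \<Gamma>_trace: "(\<Sum>r\<in>UNIV. \<Gamma> x p i r r) = (\<Sum>r\<in>UNIV. D x p i r r)"
proof -
  have "(\<Sum>k\<in>UNIV. \<Sum>r\<in>UNIV. B x p i k r * matrix_inv (h x p) $ r $ k) = trace3 h (second_ff3 N g J f) x p i"
    unfolding trace3_def by (subst sum.swap) (simp add: B_eq second_ff3_sym23[OF x p] mult.commute)
  also have "\<dots> = 0" using mean x p by (simp add: mean_curvature_zero_def)
  finally show ?thesis by (simp add: \<Gamma>_def sum_subtractf)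
qed

text \<open>The derivative of E_j has the D-coefficients along E and the coefficients B with raised
  index along JE. Parallel J exchanges the two families for the derivative of J E_j, so the
  difference has coefficients D - B along P. The chart is the one through which
  \<open>second_ff3\<close> is defined.\<close>

lemma nab_P_chart_at:
  defines "y \<equiv> chart_at N (f p)"
  shows "nab x y i (P x y j) p = (\<Sum>k\<in>UNIV. \<Gamma> x p i j k *\<^sub>R P x y k p)"
proof -
  have y: "y \<in> N" and py: "p \<in> overlap x y" using chart_at[OF N] overlap_chart_at[OF p] by (auto simp: y_def)
  note fy = fp[OF x y py]
  let ?E = "\<lambda>k. push x y f k p" and ?g = "g y (f p)" and ?J = "Jt y p"
  define Q where "Q = nab x y i (push x y f j) p"
  define Pi where "Pi = Q - (\<Sum>k\<in>UNIV. D x p i j k *\<^sub>R ?E k)"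
  define A where "A k = (\<Sum>r\<in>UNIV. B x p i j r * matrix_inv (h x p) $ r $ k)" for k
  \<comment> \<open>J maps the normal vector Pi back to a tangent one, whose components should be A.
    The defect z is tested against the frame: against E_m both parts give B, against J E_m the
    anti-isometry reduces the claim to normality of Pi.\<close>
  define z where "z = ?J *v Pi - (\<Sum>k\<in>UNIV. A k *\<^sub>R ?E k)"
  have QE: "Q \<bullet> (?g *v ?E m) = (\<Sum>k\<in>UNIV. D x p i j k * h x p $ k $ m)" for m
    unfolding Q_def by (rule nab_push_E[OF x y py])
  have B: "(?J *v Q) \<bullet> (?g *v ?E m) = B x p i j m" for m
    unfolding Q_def B_eq second_ff3_eq[OF x p] y_def ..
  have A: "(\<Sum>k\<in>UNIV. A k * h x p $ k $ m) = B x p i j m" for m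
    using \<Gamma>_lowered[of i j m] by (simp add: \<Gamma>_def A_def left_diff_distrib sum_subtractf)
  have JPi: "?J *v Pi = ?J *v Q - (\<Sum>k\<in>UNIV. D x p i j k *\<^sub>R (?J *v ?E k))"
    by (simp add: Pi_def matrix_vector_mult_diff_distrib linear_sum[OF matrix_vector_mul_linear]
        matrix_vector_mult_scaleR del: transpose_matrix_vector)
  have "z = 0"
  proof (rule frame_nondegenerate[OF x y py])
    fix m
    show "z \<bullet> (?g *v ?E m) = 0"
      by (simp add: z_def JPi inner_diff_left inner_sum_left JE_E[OF x y py] B h_eq[OF x y py] A del: transpose_matrix_vector)
    have "(?J *v Pi) \<bullet> (?g *v (?J *v ?E m)) = - (Pi \<bullet> (?g *v ?E m))"
      by (rule g_J_J[OF y fy])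
    also have "\<dots> = 0"
      by (simp add: Pi_def inner_diff_left inner_sum_left QE h_eq[OF x y py])
    finally show "z \<bullet> (?g *v (?J *v ?E m)) = 0"
      by (simp add: z_def inner_diff_left inner_sum_left E_JE[OF x y py] del: transpose_matrix_vector)
  qed
  then have JPi_A: "?J *v Pi = (\<Sum>k\<in>UNIV. A k *\<^sub>R ?E k)" by (simp add: z_def)
  have "Pi = ?J *v (?J *v Pi)" by (rule J_J[OF y fy, symmetric])
  also have "\<dots> = (\<Sum>k\<in>UNIV. A k *\<^sub>R (?J *v ?E k))"
    unfolding JPi_A by (simp add: linear_sum[OF matrix_vector_mul_linear] matrix_vector_mult_scaleR del: transpose_matrix_vector)
  finally have Q: "Q = (\<Sum>k\<in>UNIV. A k *\<^sub>R (?J *v ?E k)) + (\<Sum>k\<in>UNIV. D x p i j k *\<^sub>R ?E k)"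
    by (simp add: Pi_def eq_diff_eq diff_eq_eq)
  have JQ: "?J *v Q = (\<Sum>k\<in>UNIV. A k *\<^sub>R ?E k) + (\<Sum>k\<in>UNIV. D x p i j k *\<^sub>R (?J *v ?E k))"
    using JPi JPi_A by (simp add: diff_eq_eq)
  have "nab x y i (P x y j) p = Q - ?J *v Q"
    unfolding P_def[abs_def] Q_def nab_J_push[OF x y py, symmetric]
    by (rule pulled_back_connection.nab_diff[OF pulled_back[OF x y] py smooth_push[OF x y] smooth_J_push[OF x y]])
  also have "\<dots> = (\<Sum>k\<in>UNIV. \<Gamma> x p i j k *\<^sub>R P x y k p)"
    unfolding JQ by (subst Q)
      (simp add: \<Gamma>_def A_def[symmetric] P_def scaleR_diff_left scaleR_diff_right sum_subtractf del: transpose_matrix_vector)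
  finally show ?thesis .
qed

end

text \<open>The previous chart depends on p, so that identity cannot be differentiated. Both sides
  transform by the Jacobian, which carries it to every target chart around f p.\<close>

lemma nab_P:
  assumes x: "x \<in> M" and z: "z \<in> N" and p: "p \<in> overlap x z"
  shows "nab x z i (P x z j) p = (\<Sum>k\<in>UNIV. \<Gamma> x p i j k *\<^sub>R P x z k p)"
proof -
  define y where "y = chart_at N (f p)"
  have px: "p \<in> fst x" using p by (simp add: mem_overlap)
  have y: "y \<in> N" and py: "p \<in> overlap x y" using chart_at[OF N] overlap_chart_at[OF px] by (auto simp: y_def)
  define S where "S = overlap x y \<inter> overlap x z"
  define T where "T = fst y \<inter> fst z"
  have S: "open S" "S \<subseteq> overlap x y" "S \<subseteq> overlap x z" "p \<in> S" "f ` S \<subseteq> T"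
    using overlap_openI[OF x y] overlap_openI[OF x z] p py by (auto simp: S_def T_def overlap_def)
  have T: "open T" using overlap_open[OF N y z] by (simp add: T_def)
  have T': "T \<subseteq> fst y" "T \<subseteq> fst z" by (auto simp: T_def)
  have Py: "pulled_back_connection x S y T f (levi_civita N g y)" if "y \<in> N" "T \<subseteq> fst y" "S \<subseteq> overlap x y" for y
  proof (intro pulled_back_connection.intro pulled_back_connection_axioms.intro)
    show "local_map x S y T f"
      using that S T x by (intro local_map_sub) (auto simp: overlap_def)
    show "smooth_fun y T (\<lambda>r. levi_civita N g y r a b c)" for a b c
      by (rule smooth_fun_subset[OF levi_civita_smooth[OF N g that(1)] that(2)])
    show "levi_civita N g y r a b c = levi_civita N g y r b a c" if "r \<in> T" for r a b c
      using levi_civita_sym[OF N g \<open>y \<in> N\<close>] \<open>T \<subseteq> fst y\<close> that by blast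
  qed
  have "nab x z i (P x z j) p = nab x z i (\<lambda>q. jac y z (f q) *v P x y j q) p"
    by (rule pulled_back_connection.nab_cong[OF pulled_back_sub[OF x z S(1,3)] S(4)])
      (rule P_target[OF x y z]; use S in blast)
  also have "\<dots> = jac y z (f p) *v nab x y i (P x y j) p"
  proof (rule cov_along_target[OF Py[OF y T'(1) S(2)] Py[OF z T'(2) S(3)] transition_map[OF N y z T T'] S(4)])
    show "smooth_vec x S (P x y j)" by (rule smooth_vec_subset[OF smooth_P[OF x y] S(2)])
  qed (use S levi_civita_connection[OF N g y z] in \<open>auto simp: T_def\<close>)
  also have "\<dots> = (\<Sum>k\<in>UNIV. \<Gamma> x p i j k *\<^sub>R P x z k p)"
    unfolding y_def nab_P_chart_at[OF x px]
    by (simp add: linear_sum[OF matrix_vector_mul_linear] matrix_vector_mult_scaleR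
        P_target[OF x chart_at(1)[OF N] z overlap_chart_at[OF px] p])
  finally show ?thesis .
qed

text \<open>In a fixed target chart \<Gamma> is recovered from the smooth field \<nabla>_i P_j by
  pairing with E_m and raising the index, bypassing the pointwise choice of charts inside the second
  fundamental form.\<close>

lemma \<Gamma>_smooth:
  assumes x: "x \<in> M"
  shows "smooth_fun x (fst x) (\<lambda>p. \<Gamma> x p i j k)"
proof (rule smooth_fun_overlapI[OF x])
  fix y assume y: "y \<in> N"
  note cd = overlap_chart_domain[OF x y]
  have "smooth_fun x (overlap x y) (\<lambda>q. \<Sum>m\<in>UNIV. matrix_inv (h x q) $ m $ k * (nab x y i (P x y j) q \<bullet> (g y (f q) *v push x y f m q)))"
  proof (intro smooth_fun_sum[OF cd] smooth_fun_mult[OF cd] smooth_fun_inner[OF cd] smooth_vec_mult[OF cd])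
    have "smooth_mat x (fst x) (\<lambda>q. matrix_inv (h x q))"
      by (rule smooth_mat_inv[OF chart_domain_full[OF M x] metric_smooth[OF M h_metric x] metric_invertible[OF M h_metric x]])
    from smooth_mat_subset[OF this, of "overlap x y"]
    show "smooth_fun x (overlap x y) (\<lambda>q. matrix_inv (h x q) $ m $ k)" for m
      by (auto simp: smooth_mat_def overlap_def)
    show "smooth_vec x (overlap x y) (nab x y i (P x y j))"
      by (rule pulled_back_connection.smooth_nab[OF pulled_back[OF x y] smooth_P[OF x y]])
    show "smooth_mat x (overlap x y) (\<lambda>q. g y (f q))"
      by (rule compose_mat[OF x y metric_smooth[OF N g y]])
  qed (rule smooth_push[OF x y])
  moreover have "(\<Sum>m\<in>UNIV. matrix_inv (h x q) $ m $ k * (nab x y i (P x y j) q \<bullet> (g y (f q) *v push x y f m q))) = \<Gamma> x q i j k"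
    if q: "q \<in> overlap x y" for q
  proof -
    have qx: "q \<in> fst x" using q by (simp add: mem_overlap)
    have "(\<Sum>m\<in>UNIV. matrix_inv (h x q) $ m $ k * (nab x y i (P x y j) q \<bullet> (g y (f q) *v push x y f m q)))
        = (\<Sum>m\<in>UNIV. \<Sum>l\<in>UNIV. (h x q $ l $ m * matrix_inv (h x q) $ m $ k) * \<Gamma> x q i j l)"
      unfolding nab_P[OF x y q] inner_sum_left inner_scaleR_left P_E[OF x y q] sum_distrib_left by (simp only: mult_ac)
    also have "\<dots> = (\<Sum>l\<in>UNIV. (\<Sum>m\<in>UNIV. h x q $ l $ m * matrix_inv (h x q) $ m $ k) * \<Gamma> x q i j l)"
      unfolding sum_distrib_right by (rule sum.swap)
    also have "\<dots> = (\<Sum>l\<in>UNIV. (if k = l then 1 else 0) * \<Gamma> x q i j l)"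
      by (simp only: mult_eq_mat_1_nth[OF matrix_inv_mult(1)[OF metric_invertible[OF M h_metric x qx]]] eq_commute[of k])
    also have "\<dots> = \<Gamma> x q i j k" by (rule sum_delta_left)
    finally show ?thesis .
  qed
  ultimately show "smooth_fun x (overlap x y) (\<lambda>p. \<Gamma> x p i j k)"
    by (subst (asm) smooth_fun_cong[OF cd]) auto
qed

text \<open>The vector \<nabla>_i P_j is expanded in the frame belonging to x' in two ways: through
  its coefficients in x, and by the product rule after rewriting P_j in that frame. Independence of
  the P compares coefficients.\<close>

lemma \<Gamma>_connection:
  assumes x: "x \<in> M" "x' \<in> M" and p: "p \<in> fst x" "p \<in> fst x'"
  shows "pd x i (\<lambda>q. dmap x x' id q j a) p
      + (\<Sum>b\<in>UNIV. \<Sum>c\<in>UNIV. \<Gamma> x' p b c a * dmap x x' id p i b * dmap x x' id p j c)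
    = (\<Sum>k\<in>UNIV. \<Gamma> x p i j k * dmap x x' id p k a)"
proof -
  define y where "y = chart_at N (f p)"
  have y: "y \<in> N" using chart_at[OF N] by (auto simp: y_def)
  define S where "S = overlap x y \<inter> overlap x' y"
  have S: "open S" "S \<subseteq> overlap x y" "S \<subseteq> overlap x' y" "p \<in> S"
    using overlap_openI[OF x(1) y] overlap_openI[OF x(2) y] overlap_chart_at p by (auto simp: S_def y_def)
  then have S': "S \<subseteq> fst x" "S \<subseteq> fst x'" by (auto simp: overlap_def)
  have pS: "p \<in> overlap x y" "p \<in> overlap x' y" using S by auto
  interpret pc: pulled_back_connection x S y "fst y" f "levi_civita N g y" by (rule pulled_back_sub[OF x(1) y S(1,2)])
  interpret pc': pulled_back_connection x' S y "fst y" f "levi_civita N g y" by (rule pulled_back_sub[OF x(2) y S(1,3)])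
  have tr: "local_map x S x' S id" and tr': "local_map x' S x S id"
    using transition_map[OF M x S(1) S'] transition_map[OF M x(2,1) S(1) S'(2,1)] by auto
  let ?d = "\<lambda>i a. dmap x x' id p i a"
  have sm: "smooth_vec x S (P x' y b)" for b
    unfolding smooth_vec_def
  proof
    fix a
    have "smooth_fun x' S (\<lambda>q. P x' y b q $ a)"
      using smooth_vec_subset[OF smooth_P[OF x(2) y] S(3), of b] by (simp add: smooth_vec_def)
    from local_map.compose[OF tr this] show "smooth_fun x S (\<lambda>q. P x' y b q $ a)" by simp
  qed
  have "(\<Sum>a\<in>UNIV. (\<Sum>k\<in>UNIV. \<Gamma> x p i j k * ?d k a) *\<^sub>R P x' y a p)
      = (\<Sum>k\<in>UNIV. \<Gamma> x p i j k *\<^sub>R P x y k p)"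
    unfolding P_source[OF x y pS] scaleR_sum_right scaleR_sum_left scaleR_scaleR by (rule sum.swap)
  also have "\<dots> = nab x y i (P x y j) p" by (rule nab_P[OF x(1) y pS(1), symmetric])
  also have "\<dots> = nab x y i (\<lambda>q. \<Sum>b\<in>UNIV. dmap x x' id q j b *\<^sub>R P x' y b q) p"
    by (rule pc.nab_cong[OF S(4)]) (use S P_source[OF x y] in blast)
  also have "\<dots> = (\<Sum>b\<in>UNIV. pd x i (\<lambda>q. dmap x x' id q j b) p *\<^sub>R P x' y b p + ?d j b *\<^sub>R nab x y i (P x' y b) p)"
    by (rule pc.nab_scaleR_sum[OF S(4) local_map.smooth_dmap[OF tr] sm])
  also have "\<dots> = (\<Sum>b\<in>UNIV. pd x i (\<lambda>q. dmap x x' id q j b) p *\<^sub>R P x' y b p)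
      + (\<Sum>c\<in>UNIV. \<Sum>b\<in>UNIV. \<Sum>a\<in>UNIV. (\<Gamma> x' p b c a * ?d i b * ?d j c) *\<^sub>R P x' y a p)"
  proof -
    have "nab x y i (P x' y c) p = (\<Sum>b\<in>UNIV. \<Sum>a\<in>UNIV. (?d i b * \<Gamma> x' p b c a) *\<^sub>R P x' y a p)" for c
      using cov_along_source[OF pc'.local_map_axioms tr S(4) smooth_vec_subset[OF smooth_P[OF x(2) y] S(3)], where i = i]
      by (simp add: nab_P[OF x(2) y pS(2)] scaleR_sum_right)
    then show ?thesis
      by (simp add: sum.distrib scaleR_sum_right mult_ac)
  qed
  also have "(\<Sum>c\<in>UNIV. \<Sum>b\<in>UNIV. \<Sum>a\<in>UNIV. (\<Gamma> x' p b c a * ?d i b * ?d j c) *\<^sub>R P x' y a p)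
      = (\<Sum>b\<in>UNIV. \<Sum>c\<in>UNIV. \<Sum>a\<in>UNIV. (\<Gamma> x' p b c a * ?d i b * ?d j c) *\<^sub>R P x' y a p)"
    by (rule sum.swap)
  also have "\<dots> = (\<Sum>b\<in>UNIV. \<Sum>a\<in>UNIV. \<Sum>c\<in>UNIV. (\<Gamma> x' p b c a * ?d i b * ?d j c) *\<^sub>R P x' y a p)"
    by (rule sum.cong[OF refl]) (rule sum.swap)
  also have "\<dots> = (\<Sum>a\<in>UNIV. \<Sum>b\<in>UNIV. \<Sum>c\<in>UNIV. (\<Gamma> x' p b c a * ?d i b * ?d j c) *\<^sub>R P x' y a p)"
    by (rule sum.swap)
  finally have "(\<Sum>a\<in>UNIV. (\<Sum>k\<in>UNIV. \<Gamma> x p i j k * ?d k a) *\<^sub>R P x' y a p)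
     = (\<Sum>a\<in>UNIV. (pd x i (\<lambda>q. dmap x x' id q j a) p
      + (\<Sum>b\<in>UNIV. \<Sum>c\<in>UNIV. \<Gamma> x' p b c a * ?d i b * ?d j c)) *\<^sub>R P x' y a p)"
    by (simp add: scaleR_add_left sum.distrib scaleR_sum_left id_def)
  from P_independent[OF x(2) y pS(2) this] show ?thesis by simp
qed

lemma \<Gamma>_torsion_free: "torsion_free_connection M \<Gamma>"
  unfolding torsion_free_connection_def connection_def smooth_in_real
  using \<Gamma>_smooth \<Gamma>_connection \<Gamma>_sym by (simp add: Int_iff)

end

section \<open>Curvature of the induced connection\<close>

locale space_form_immersion = minimal_lagrangian_immersion M N f g J
  for M :: "('m::{t2_space, second_countable_topology}, 'n::finite) chart set"
    and N :: "('p::{t2_space, second_countable_topology}, 'k::finite) chart set"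
    and f :: "'m \<Rightarrow> 'p" and g J :: "('p, 'k) field2" +
  fixes c :: real
  assumes space_form: "constant_para_holomorphic_curvature N g J (4 * c)"
begin

text \<open>The tensor is contracted with vectors so that the products among E, JE and P can be
  inserted; the factor is 4c / 2 = 2c.\<close>

lemma ambient_curvature:
  assumes "y \<in> N" "r \<in> fst y"
  defines "W \<equiv> kaehler_form g J y r" and "J' \<equiv> transpose (J y r)"
  shows "(\<Sum>b\<in>UNIV. \<Sum>d\<in>UNIV. \<Sum>e\<in>UNIV. curvature (levi_civita N g) y r b d e l * (u $ b * v $ d * w $ e))
    = 2 * c * ((u $ l * (v \<bullet> (g y r *v w)) - v $ l * (u \<bullet> (g y r *v w))) / 2
      - ((J' *v u) $ l * (v \<bullet> (W *v w)) - (J' *v v) $ l * (u \<bullet> (W *v w))) / 2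
      + (u \<bullet> (W *v v)) * (J' *v w) $ l)"
proof -
  let ?I = "mat 1 :: real ^ 'k ^ 'k" and ?g = "g y r" and ?J = "J y r"
  have swap: "(\<Sum>b\<in>UNIV. \<Sum>d\<in>UNIV. \<Sum>e\<in>UNIV. A $ d $ l * G $ b $ e * (u $ b * v $ d * w $ e))
      = (transpose A *v v) $ l * (u \<bullet> (G *v w))" for A G :: "real ^ 'k ^ 'k"
    by (subst triple_sum_inner[symmetric], subst sum.swap) (simp only: mult_ac)
  have last: "(\<Sum>b\<in>UNIV. \<Sum>d\<in>UNIV. \<Sum>e\<in>UNIV. W $ b $ d * ?J $ e $ l * (u $ b * v $ d * w $ e)) = (u \<bullet> (W *v v)) * (J' *v w) $ l"
  proof -
    have "(u \<bullet> (W *v v)) * (J' *v w) $ l = (\<Sum>b\<in>UNIV. \<Sum>d\<in>UNIV. u $ b * v $ d * W $ b $ d) * (\<Sum>e\<in>UNIV. ?J $ e $ l * w $ e)"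
      unfolding double_sum_inner by (simp add: matrix_vector_mult_def transpose_def J'_def del: transpose_matrix_vector)
    also have "\<dots> = (\<Sum>b\<in>UNIV. \<Sum>d\<in>UNIV. \<Sum>e\<in>UNIV. u $ b * v $ d * W $ b $ d * (?J $ e $ l * w $ e))"
      by (simp only: sum_distrib_right) (simp only: sum_distrib_left)
    finally show ?thesis by (simp only: mult_ac)
  qed
  have "curvature (levi_civita N g) y r b d e l * z = 2 * c *
      ((?I $ b $ l * ?g $ d $ e * z - ?I $ d $ l * ?g $ b $ e * z) / 2
        - (?J $ b $ l * W $ d $ e * z - ?J $ d $ l * W $ b $ e * z) / 2 + W $ b $ d * ?J $ e $ l * z)" for b d e z
  proof -
    have "curvature (levi_civita N g) y r b d e l = 2 * c *
      ((?I $ b $ l * ?g $ d $ e - ?I $ d $ l * ?g $ b $ e) / 2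
        - (?J $ b $ l * W $ d $ e - ?J $ d $ l * W $ b $ e) / 2 + W $ b $ d * ?J $ e $ l)"
      using space_form assms(1,2) unfolding constant_para_holomorphic_curvature_def Let_def W_def by simp
    then show ?thesis by (simp only:) (simp add: field_simps)
  qed
  then have "(\<Sum>b\<in>UNIV. \<Sum>d\<in>UNIV. \<Sum>e\<in>UNIV. curvature (levi_civita N g) y r b d e l * (u $ b * v $ d * w $ e))
    = 2 * c * (((\<Sum>b\<in>UNIV. \<Sum>d\<in>UNIV. \<Sum>e\<in>UNIV. ?I $ b $ l * ?g $ d $ e * (u $ b * v $ d * w $ e))
        - (\<Sum>b\<in>UNIV. \<Sum>d\<in>UNIV. \<Sum>e\<in>UNIV. ?I $ d $ l * ?g $ b $ e * (u $ b * v $ d * w $ e))) / 2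
      - ((\<Sum>b\<in>UNIV. \<Sum>d\<in>UNIV. \<Sum>e\<in>UNIV. ?J $ b $ l * W $ d $ e * (u $ b * v $ d * w $ e))
        - (\<Sum>b\<in>UNIV. \<Sum>d\<in>UNIV. \<Sum>e\<in>UNIV. ?J $ d $ l * W $ b $ e * (u $ b * v $ d * w $ e))) / 2
      + (\<Sum>b\<in>UNIV. \<Sum>d\<in>UNIV. \<Sum>e\<in>UNIV. W $ b $ d * ?J $ e $ l * (u $ b * v $ d * w $ e)))"
    by (simp only: sum_subtractf sum.distrib sum_distrib_left[symmetric] sum_divide_distrib[symmetric])
  then show ?thesis
    unfolding triple_sum_inner swap last by (simp only: transpose_mat matrix_vector_mul_lid J'_def)
qed

text \<open>The commutator of covariant derivatives on P_k is computed twice, from the coefficients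
  \<Gamma> and from the ambient curvature, and compared in the frame P.\<close>

lemma curvature_\<Gamma>:
  assumes x: "x \<in> M" and p: "p \<in> fst x"
  shows "curvature \<Gamma> x p i j k l = c * (h x p $ j $ k * (if i = l then 1 else 0) - h x p $ i $ k * (if j = l then 1 else 0))"
proof -
  define y where "y = chart_at N (f p)"
  have y: "y \<in> N" and py: "p \<in> overlap x y" using chart_at[OF N] overlap_chart_at[OF p] by (auto simp: y_def)
  note fy = fp[OF x y py]
  interpret pc: pulled_back_connection x "overlap x y" y "fst y" f "levi_civita N g y" by (rule pulled_back[OF x y])
  let ?P = "\<lambda>k. P x y k p" and ?g = "g y (f p)" and ?J = "Jt y p" and ?E = "\<lambda>k. push x y f k p"
  have \<Gamma>_smooth': "smooth_fun x (overlap x y) (\<lambda>q. \<Gamma> x q i j k)" for i j k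
    by (rule smooth_fun_subset[OF \<Gamma>_smooth[OF x]]) (auto simp: overlap_def)
  have nab2: "nab x y i (nab x y j (P x y k)) p
      = (\<Sum>l\<in>UNIV. (pd x i (\<lambda>q. \<Gamma> x q j k l) p + (\<Sum>r\<in>UNIV. \<Gamma> x p i r l * \<Gamma> x p j k r)) *\<^sub>R ?P l)" for i j
  proof -
    have "nab x y i (nab x y j (P x y k)) p = nab x y i (\<lambda>q. \<Sum>l\<in>UNIV. \<Gamma> x q j k l *\<^sub>R P x y l q) p"
      by (rule pc.nab_cong[OF py]) (rule nab_P[OF x y])
    also have "\<dots> = (\<Sum>l\<in>UNIV. pd x i (\<lambda>q. \<Gamma> x q j k l) p *\<^sub>R ?P l + \<Gamma> x p j k l *\<^sub>R nab x y i (P x y l) p)"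
      by (rule pc.nab_scaleR_sum[OF py \<Gamma>_smooth' smooth_P[OF x y]])
    also have "\<dots> = (\<Sum>l\<in>UNIV. pd x i (\<lambda>q. \<Gamma> x q j k l) p *\<^sub>R ?P l)
        + (\<Sum>r\<in>UNIV. \<Sum>l\<in>UNIV. (\<Gamma> x p i r l * \<Gamma> x p j k r) *\<^sub>R ?P l)"
      by (simp add: nab_P[OF x y py] sum.distrib scaleR_sum_right mult.commute)
    also have "(\<Sum>r\<in>UNIV. \<Sum>l\<in>UNIV. (\<Gamma> x p i r l * \<Gamma> x p j k r) *\<^sub>R ?P l)
        = (\<Sum>l\<in>UNIV. \<Sum>r\<in>UNIV. (\<Gamma> x p i r l * \<Gamma> x p j k r) *\<^sub>R ?P l)"
      by (rule sum.swap)
    finally show ?thesis by (simp add: scaleR_add_left sum.distrib scaleR_sum_left)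
  qed
  have "(\<Sum>l\<in>UNIV. curvature \<Gamma> x p i j k l *\<^sub>R ?P l) = nab x y i (nab x y j (P x y k)) p - nab x y j (nab x y i (P x y k)) p"
    unfolding nab2 curvature_def by (simp add: scaleR_add_left scaleR_diff_left sum.distrib sum_subtractf)
  also have "\<dots> = c *\<^sub>R (h x p $ j $ k *\<^sub>R ?P i - h x p $ i $ k *\<^sub>R ?P j)"
  proof -
    \<comment> \<open>Both g and \<Omega> pair E_i with P_k to h_ik, while \<Omega>(E_i, E_j) = 0.
      So the last term of the ambient formula vanishes and the first two combine to E_i - J E_i =
      P_i, with constant 2c / 2 = c.\<close>
    have gP: "?E i \<bullet> (?g *v ?P k) = h x p $ i $ k" for i
      using P_E[OF x y py, of k i] g_sym[OF y fy, of "?E i" "?P k"] h_sym_nth[OF x y py, of i k] by simp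
    have WP: "?E i \<bullet> (kaehler_form g J y (f p) *v ?P k) = h x p $ i $ k" for i
      unfolding W_inner P_def
      by (simp add: matrix_vector_mult_diff_distrib inner_diff_right JE_E[OF x y py] JE_JE[OF x y py] del: transpose_matrix_vector)
    have WE: "?E i \<bullet> (kaehler_form g J y (f p) *v ?E j) = 0"
      unfolding W_inner by (rule JE_E[OF x y py])
    have "(nab x y i (nab x y j (P x y k)) p - nab x y j (nab x y i (P x y k)) p) $ l
        = (c *\<^sub>R (h x p $ j $ k *\<^sub>R ?P i - h x p $ i $ k *\<^sub>R ?P j)) $ l" for l
    proof -
      have "(nab x y i (nab x y j (P x y k)) p - nab x y j (nab x y i (P x y k)) p) $ l
          = (\<Sum>b\<in>UNIV. \<Sum>d\<in>UNIV. \<Sum>e\<in>UNIV. curvature (levi_civita N g) y (f p) b d e l * (?E i $ b * ?E j $ d * ?P k $ e))"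
        unfolding pc.nab_curvature[OF smooth_P[OF x y] py] by (simp add: curvature_def push_def mult.assoc)
      also have "\<dots> = 2 * c * ((?E i $ l * h x p $ j $ k - ?E j $ l * h x p $ i $ k) / 2
          - ((?J *v ?E i) $ l * h x p $ j $ k - (?J *v ?E j) $ l * h x p $ i $ k) / 2)"
        unfolding ambient_curvature[OF y fy] gP WP WE by simp
      also have "\<dots> = (c *\<^sub>R (h x p $ j $ k *\<^sub>R ?P i - h x p $ i $ k *\<^sub>R ?P j)) $ l"
        by (simp add: P_def field_simps del: transpose_matrix_vector)
      finally show ?thesis .
    qed
    then show ?thesis by (simp add: vec_eq_iff)
  qed
  also have "\<dots> = (\<Sum>l\<in>UNIV. (c * (h x p $ j $ k * (if i = l then 1 else 0) - h x p $ i $ k * (if j = l then 1 else 0))) *\<^sub>R ?P l)"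
  proof -
    have "(\<Sum>l\<in>UNIV. (a * (if i = l then 1 else 0)) *\<^sub>R ?P l) = a *\<^sub>R ?P i" for a i
      by (simp add: if_distrib[of "\<lambda>b. (a * b) *\<^sub>R _"] cong: if_cong)
    then show ?thesis
      by (simp add: right_diff_distrib scaleR_diff_left scaleR_diff_right sum_subtractf mult.assoc[symmetric])
  qed
  finally show ?thesis by (rule P_independent[OF x y py])
qed

text \<open>The two delta terms contract to n and 1; on a surface the factor n - 1 equals 1.\<close>

lemma ricci_\<Gamma>:
  assumes "x \<in> M" "p \<in> fst x"
  shows "ricci \<Gamma> x p $ i $ j = c * (real CARD('n) - 1) * h x p $ i $ j"
proof -
  have "(\<Sum>r\<in>UNIV. h x p $ r $ j * (if i = r then 1 else 0)) = h x p $ i $ j"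
    using sum_delta_left[of i "\<lambda>r. h x p $ r $ j"] by (simp only: mult.commute)
  then show ?thesis
    by (simp add: ricci_def curvature_\<Gamma>[OF assms] sum_distrib_left[symmetric] sum_subtractf algebra_simps)
qed

end

section \<open>Surfaces: determinants, densities and the Einstein equations\<close>

lemma det_derivative_2:
  fixes h :: "('m::topological_space, 2) field2"
  assumes x: "chart_domain x S" and p: "p \<in> S" and h: "smooth_mat x S (h x)"
    and par: "\<And>j k. pd x i (\<lambda>q. h x q $ j $ k) p = (\<Sum>r\<in>UNIV. G j r * h x p $ r $ k) + (\<Sum>r\<in>UNIV. G k r * h x p $ j $ r)"
  shows "pd x i (\<lambda>q. det (h x q)) p = 2 * (\<Sum>r\<in>UNIV. G r r) * det (h x p)"
proof -
  have s: "smooth_fun x S (\<lambda>q. h x q $ j $ k)" for j k using h by (simp add: smooth_mat_def)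
  have "pd x i (\<lambda>q. det (h x q)) p = pd x i (\<lambda>q. h x q $ 1 $ 1) p * h x p $ 2 $ 2 + h x p $ 1 $ 1 * pd x i (\<lambda>q. h x q $ 2 $ 2) p
     - (pd x i (\<lambda>q. h x q $ 1 $ 2) p * h x p $ 2 $ 1 + h x p $ 1 $ 2 * pd x i (\<lambda>q. h x q $ 2 $ 1) p)"
    unfolding det_2 by (simp add: pd_diff[OF x _ _ p] smooth_fun_mult[OF x] s pd_mult[OF x p])
  \<comment> \<open>Jacobi's formula in dimension 2: each of the two indices of h contributes one
    trace, whence the factor 2.\<close>
  then show ?thesis by (simp add: par sum_2 det_2 algebra_simps)
qed

lemma det_pos_2:
  fixes A :: "real ^ 2 ^ 2"
  assumes pos: "\<And>v. v \<noteq> 0 \<Longrightarrow> v \<bullet> (A *v v) > 0"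
  shows "det A > 0"
proof -
  have *: "a \<noteq> 0 \<or> b \<noteq> 0 \<Longrightarrow> a * (A $ 1 $ 1 * a + A $ 1 $ 2 * b) + b * (A $ 2 $ 1 * a + A $ 2 $ 2 * b) > 0" for a b
    using pos[of "vector [a, b]"] by (auto simp: inner_vec_def sum_2 matrix_vector_mult_def vec_eq_iff forall_2)
  have "A $ 2 $ 2 > 0" using *[of 0 1] by simp
  \<comment> \<open>On the vector (A_22, -A_21) the quadratic form takes the value A_22 det
    A.\<close>
  have "0 < A $ 2 $ 2 * (A $ 2 $ 2 * A $ 1 $ 1 - A $ 1 $ 2 * A $ 2 $ 1)"
    using *[of "A $ 2 $ 2" "- A $ 2 $ 1"] \<open>A $ 2 $ 2 > 0\<close> by (simp add: algebra_simps)
  then show ?thesis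
    using \<open>A $ 2 $ 2 > 0\<close> by (simp add: det_2 zero_less_mult_iff mult.commute)
qed

lemma matrix_inv_contract:
  fixes A :: "real ^ 'n::finite ^ 'n"
  assumes "invertible A" "transpose A = A"
  shows "(\<Sum>i\<in>UNIV. \<Sum>j\<in>UNIV. matrix_inv A $ i $ j * A $ i $ j) = real CARD('n)"
proof -
  have "A $ i $ j = A $ j $ i" for i j
    using arg_cong[OF assms(2), of "\<lambda>M. M $ j $ i"] by (simp add: transpose_def)
  then have "(\<Sum>i\<in>UNIV. \<Sum>j\<in>UNIV. matrix_inv A $ i $ j * A $ i $ j) = (\<Sum>i\<in>UNIV. \<Sum>j\<in>UNIV. matrix_inv A $ i $ j * A $ j $ i)"
    by (intro sum.cong refl arg_cong[of _ _ "(*) _"])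
  also have "\<dots> = (\<Sum>i\<in>(UNIV :: 'n set). 1)"
    by (simp only: mult_eq_mat_1_nth[OF matrix_inv_mult(2)[OF assms(1)]]) simp
  finally show ?thesis by simp
qed

text \<open>In dimension 2 the determinant scales by u^2, and its power -1/2 cancels the factor u.
  Conditions on the normalized metric that range over the conformal class thereby reduce to
  h.\<close>

lemma normalized_metric_conformal:
  assumes "det (h x p) > 0" "u > 0" "h' x p = u *\<^sub>R h x p"
  shows "normalized_metric h' x p = normalized_metric h x p"
proof -
  have "det (h' x p) = u\<^sup>2 * det (h x p)" by (simp add: assms(3) det_2 power2_eq_square algebra_simps)
  moreover have "(u\<^sup>2) powr (- 1 / 2) = 1 / u"
    using assms(2) by (simp add: powr_minus powr_half_sqrt field_simps)
  ultimately show ?thesis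
    using assms by (simp add: normalized_metric_def powr_mult)
qed

locale space_form_surface = space_form_immersion M N f g J c
  for M :: "('m::{t2_space, second_countable_topology}, 2) chart set"
    and N :: "('p::{t2_space, second_countable_topology}, 4) chart set"
    and f :: "'m \<Rightarrow> 'p" and g J :: "('p, 4) field2" and c :: real
begin

lemma induced_connection_eq: "induced_connection M N g J f = \<Gamma>"
  by (intro ext) (simp add: induced_connection_def \<Gamma>_def Let_def)

abbreviation \<H> where "\<H> \<equiv> normalized_metric h"

abbreviation tr where "tr x p i \<equiv> \<Sum>r\<in>UNIV. D x p i r r"

lemma h_det_pos: "x \<in> M \<Longrightarrow> p \<in> fst x \<Longrightarrow> det (h x p) > 0"
  by (rule det_pos_2) (rule h_pos[OF _ chart_at(1)[OF N] overlap_chart_at])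

lemma conformal_positive:
  assumes "h' \<in> conformal_class M h" "x \<in> M" "p \<in> fst x"
  obtains u where "u > 0" "h' x p = u *\<^sub>R h x p"
  using assms unfolding conformal_class_def by blast

lemma h_conformal: "h \<in> conformal_class M h"
  unfolding conformal_class_def using h_metric
  by (auto simp: smooth_in_real smooth_fun_const intro!: exI[of _ "\<lambda>_. 1"])

lemma normalized_eq:
  assumes "h' \<in> conformal_class M h" "x \<in> M" "p \<in> fst x"
  shows "normalized_metric h' x p = \<H> x p"
proof -
  obtain u where "u > 0" "h' x p = u *\<^sub>R h x p" using conformal_positive[OF assms] .
  then show ?thesis by (intro normalized_metric_conformal h_det_pos[OF assms(2,3)])
qed

lemma smooth_det: "x \<in> M \<Longrightarrow> smooth_fun x (fst x) (\<lambda>q. det (h x q))"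
  using metric_smooth[OF M h_metric, of x] by (intro smooth_fun_det chart_domain_full[OF M]) (auto simp: smooth_mat_def)

context
  fixes x p
  assumes x: "x \<in> M" and p: "p \<in> fst x"
begin

lemma pd_det: "pd x i (\<lambda>q. det (h x q)) p = 2 * tr x p i * det (h x p)"
  by (rule det_derivative_2[where h = h and G = "D x p i", OF chart_domain_full[OF M x] p metric_smooth[OF M h_metric x] levi_civita_metric[OF M h_metric x p]])

text \<open>Equivalently, this power is a parallel density of weight 2a for every connection with
  trace \<open>tr\<close>, in particular for D and \<Gamma>.\<close>

lemma pd_det_powr: "pd x i (\<lambda>q. det (h x q) powr a) p = 2 * a * tr x p i * det (h x p) powr a"
proof -
  have "pd x i (\<lambda>q. det (h x q) powr a) p = (a * det (h x p) powr (a - 1)) * pd x i (\<lambda>q. det (h x q)) p"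
    by (rule pd_real_compose[OF chart_domain_full[OF M x] smooth_det[OF x] p has_real_derivative_powr[OF h_det_pos[OF x p]]])
  also have "det (h x p) powr (a - 1) = det (h x p) powr a / det (h x p)"
    using h_det_pos[OF x p] by (simp add: powr_diff)
  finally show ?thesis using h_det_pos[OF x p] by (simp add: pd_det)
qed

lemma normalized_nth: "\<H> x p $ j $ k = det (h x p) powr (- 1 / 2) * h x p $ j $ k"
  using h_det_pos[OF x p] by (simp add: normalized_metric_def)

lemma h_normalized: "h x p $ j $ k = det (h x p) powr (1 / 2) * \<H> x p $ j $ k"
proof -
  have "det (h x p) powr (1 / 2) * det (h x p) powr (- 1 / 2) = 1"
    using h_det_pos[OF x p] by (simp add: powr_add[symmetric])
  then show ?thesis by (simp add: normalized_nth mult.assoc[symmetric])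
qed

lemma normalized_sym: "transpose (\<H> x p) = \<H> x p"
  using metric_sym_nth[OF M h_metric x p] by (simp add: vec_eq_iff transpose_def normalized_nth)

lemma normalized_invertible: "invertible (\<H> x p)"
proof -
  have "det (\<H> x p) = (det (h x p) powr (- 1 / 2))\<^sup>2 * det (h x p)"
    by (simp add: det_2 normalized_nth power2_eq_square algebra_simps)
  then show ?thesis using h_det_pos[OF x p] by (simp add: invertible_det_nz)
qed

end

context
  fixes x p
  assumes x: "x \<in> M" and p: "p \<in> fst x"
begin

text \<open>D preserves \<open>\<H>\<close>: the connection terms come from h, and the trace term,
  from the power of the determinant, accounts for the weight -1.\<close>

lemma pd_normalized:
  "pd x i (\<lambda>q. \<H> x q $ j $ k) p = - tr x p i * \<H> x p $ j $ k
    + (\<Sum>r\<in>UNIV. D x p i j r * \<H> x p $ r $ k) + (\<Sum>r\<in>UNIV. D x p i k r * \<H> x p $ j $ r)"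
proof -
  let ?s = "\<lambda>q. det (h x q) powr (- 1 / 2)"
  note cd = chart_domain_full[OF M x]
  have "smooth_fun x (fst x) ?s"
    by (rule smooth_fun_powr[OF cd smooth_det[OF x] h_det_pos[OF x]])
  moreover have "smooth_fun x (fst x) (\<lambda>q. h x q $ j $ k)"
    using metric_smooth[OF M h_metric x] by (simp add: smooth_mat_def)
  moreover have "pd x i (\<lambda>q. \<H> x q $ j $ k) p = pd x i (\<lambda>q. ?s q * h x q $ j $ k) p"
    by (rule pd_cong[OF cd p]) (rule normalized_nth[OF x])
  ultimately have "pd x i (\<lambda>q. \<H> x q $ j $ k) p = pd x i ?s p * h x p $ j $ k + ?s p * pd x i (\<lambda>q. h x q $ j $ k) p"
    using pd_mult[OF cd p] by simp
  then show ?thesis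
    unfolding pd_det_powr[OF x p] levi_civita_metric[OF M h_metric x p]
    by (simp add: normalized_nth[OF x p] distrib_left sum_distrib_left sum_distrib_right sum_negf mult_ac)
qed

text \<open>Replacing D by \<Gamma> in each of the two lower slots adds one copy of B, and the
  copies agree by symmetry; the weight term is unchanged because the traces agree. Alignment then
  follows from the complete symmetry of B.\<close>

lemma cov2_normalized: "cov2 \<Gamma> (- 1) \<H> x p i j k = 2 * det (h x p) powr (- 1 / 2) * B x p i j k"
proof -
  let ?s = "det (h x p) powr (- 1 / 2)"
  have lower: "(\<Sum>r\<in>UNIV. \<Gamma> x p i j r * \<H> x p $ r $ k) = (\<Sum>r\<in>UNIV. D x p i j r * \<H> x p $ r $ k) - ?s * B x p i j k" for j k
  proof -
    have "(\<Sum>r\<in>UNIV. G r * \<H> x p $ r $ k) = ?s * (\<Sum>r\<in>UNIV. G r * h x p $ r $ k)" for G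
      by (simp add: normalized_nth[OF x p] sum_distrib_left mult_ac)
    then show ?thesis by (simp only: \<Gamma>_lowered[OF x p] right_diff_distrib)
  qed
  have flip: "(\<Sum>r\<in>UNIV. G r * \<H> x p $ j $ r) = (\<Sum>r\<in>UNIV. G r * \<H> x p $ r $ j)" for G
    by (simp add: normalized_nth[OF x p] metric_sym_nth[OF M h_metric x p, of j])
  have "B x p i k j = B x p i j k" by (rule B_sym23[OF x p])
  then show ?thesis
    unfolding cov2_def pd_normalized flip lower \<Gamma>_trace[OF x p] by simp
qed

lemma scalar_curvature_\<Gamma>: "scalar_curvature \<Gamma> h x p = 2 * c"
proof -
  have "scalar_curvature \<Gamma> h x p = c * (\<Sum>i\<in>UNIV. \<Sum>j\<in>UNIV. matrix_inv (h x p) $ i $ j * h x p $ i $ j)"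
    by (simp add: scalar_curvature_def ricci_\<Gamma>[OF x p] sum_distrib_left mult_ac)
  then show ?thesis
    by (simp add: matrix_inv_contract[OF metric_invertible[OF M h_metric x p] metric_sym[OF M h_metric x p]])
qed

text \<open>The Ricci tensor is c h = c (det h)^(1/2) H, and contracting H with its inverse gives
  2.\<close>

lemma weighted_scalar_\<Gamma>:
  assumes "h' \<in> conformal_class M h"
  shows "weighted_scalar \<Gamma> h' x p = 2 * c * det (h x p) powr (1 / 2)"
proof -
  have "weighted_scalar \<Gamma> h' x p = c * det (h x p) powr (1 / 2) * (\<Sum>i\<in>UNIV. \<Sum>j\<in>UNIV. matrix_inv (\<H> x p) $ i $ j * \<H> x p $ i $ j)"
    unfolding weighted_scalar_def normalized_eq[OF assms x p] ricci_\<Gamma>[OF x p] h_normalized[OF x p]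
    by (simp add: sum_distrib_left mult_ac)
  then show ?thesis
    by (simp add: matrix_inv_contract[OF normalized_invertible[OF x p] normalized_sym[OF x p]])
qed

lemma faraday_\<Gamma>: "faraday \<Gamma> x p = 0"
  by (simp add: faraday_def ricci_\<Gamma>[OF x p] vec_eq_iff metric_sym_nth[OF M h_metric x p])

end

lemma aligned_\<Gamma>: "aligned M (projective_class M \<Gamma>, conformal_class M h) \<Gamma>"
  unfolding aligned_def fst_conv snd_conv
proof (intro conjI ballI allI)
  show "\<Gamma> \<in> projective_class M \<Gamma>" using \<Gamma>_torsion_free by (simp add: projective_class_def)
  fix h' x p i j k assume h': "h' \<in> conformal_class M h" and x: "x \<in> M" and p: "p \<in> fst x"
  \<comment> \<open>The normalized metrics agree on all of the open set \<open>fst x\<close>, so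
    their derivatives agree as well.\<close>
  have "cov2 \<Gamma> (- 1) (normalized_metric h') x p i j k = cov2 \<Gamma> (- 1) \<H> x p i j k" for i j k
    using pd_cong[OF chart_domain_full[OF M x] p, of "\<lambda>q. normalized_metric h' x q $ j $ k" "\<lambda>q. \<H> x q $ j $ k" i]
    by (simp add: cov2_def normalized_eq[OF h' x] p)
  then show "cov2 \<Gamma> (- 1) (normalized_metric h') x p i j k = cov2 \<Gamma> (- 1) (normalized_metric h') x p j i k"
    using B_sym12[OF x p, of i j k] by (simp add: cov2_normalized[OF x p])
qed

text \<open>The witness in the conformal class is h itself: its determinant is D-parallel with
  weight 2, and \<Gamma> has the same trace as D.\<close>

lemma exact_\<Gamma>: "exact_AH M (projective_class M \<Gamma>, conformal_class M h)"
  unfolding exact_AH_def snd_conv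
proof (intro exI conjI bexI ballI allI)
  fix x p i assume x: "x \<in> M" and p: "p \<in> fst x"
  have "pd x i (\<lambda>q. \<bar>det (h x q)\<bar>) p = pd x i (\<lambda>q. det (h x q)) p"
    by (rule pd_cong[OF chart_domain_full[OF M x] p]) (use h_det_pos[OF x] in force)
  then show "cov_density \<Gamma> 2 (\<lambda>x p. \<bar>det (h x p)\<bar>) x p i = 0"
    using h_det_pos[OF x p] by (simp add: cov_density_def pd_det[OF x p] \<Gamma>_trace[OF x p])
qed (rule aligned_\<Gamma> h_conformal)+

text \<open>Both parts of the second equation vanish separately: R is a constant multiple of the
  parallel density (det h)^(1/2), and F = 0 because the Ricci tensor is symmetric.\<close>

lemma einstein_\<Gamma>: "einstein_AH M (projective_class M \<Gamma>, conformal_class M h)"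
  unfolding einstein_AH_def snd_conv
proof (intro exI conjI ballI allI)
  fix h' x p i assume h': "h' \<in> conformal_class M h" and x: "x \<in> M" and p: "p \<in> fst x"
  note cd = chart_domain_full[OF M x]
  show "(ricci \<Gamma> x p $ i $ j + ricci \<Gamma> x p $ j $ i) / 2
      = 1 / 2 * weighted_scalar \<Gamma> h' x p * normalized_metric h' x p $ i $ j" for j
    using metric_sym_nth[OF M h_metric x p, of j i]
    by (simp add: ricci_\<Gamma>[OF x p] weighted_scalar_\<Gamma>[OF x p h'] normalized_eq[OF h' x p] h_normalized[OF x p, of i j])
  have "pd x i (weighted_scalar \<Gamma> h' x) p = pd x i (\<lambda>q. 2 * c * det (h x q) powr (1 / 2)) p"
    by (rule pd_cong[OF cd p]) (rule weighted_scalar_\<Gamma>[OF x _ h'])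
  also have "\<dots> = 2 * c * pd x i (\<lambda>q. det (h x q) powr (1 / 2)) p"
    by (rule pd_cmult[OF cd smooth_fun_powr[OF cd smooth_det[OF x] h_det_pos[OF x]] p])
  finally have "cov_density \<Gamma> 1 (weighted_scalar \<Gamma> h') x p i = 0"
    by (simp add: cov_density_def \<Gamma>_trace[OF x p] weighted_scalar_\<Gamma>[OF x p h'] pd_det_powr[OF x p])
  moreover have "cov2 \<Gamma> 0 (faraday \<Gamma>) x p s i r = 0" for s r
    using pd_cong[OF cd p, of "\<lambda>q. faraday \<Gamma> x q $ i $ r" "\<lambda>q. 0" s]
    by (simp add: cov2_def faraday_\<Gamma>[OF x] p pd_const)
  ultimately show "cov_density \<Gamma> 1 (weighted_scalar \<Gamma> h') x p i
      + 2 * (\<Sum>r\<in>UNIV. \<Sum>s\<in>UNIV. matrix_inv (normalized_metric h' x p) $ r $ s * cov2 \<Gamma> 0 (faraday \<Gamma>) x p s i r) = 0"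
    by simp
qed (rule aligned_\<Gamma>)

lemma riemannian_\<Gamma>: "riemannian_AH M (projective_class M \<Gamma>, conformal_class M h)"
  unfolding riemannian_AH_def positive_definite_def snd_conv
proof (intro ballI allI impI)
  fix h' x p and v :: "real ^ 2" assume h': "h' \<in> conformal_class M h" and x: "x \<in> M" and p: "p \<in> fst x" and v: "v \<noteq> 0"
  obtain u where u: "u > 0" "h' x p = u *\<^sub>R h x p" using conformal_positive[OF h' x p] .
  have "v \<bullet> (h' x p *v v) = u * (v \<bullet> (h x p *v v))"
    unfolding u(2) by (simp add: scaleR_matrix_vector_assoc[symmetric])
  then show "v \<bullet> (h' x p *v v) > 0"
    using u(1) h_pos[OF x chart_at(1)[OF N] overlap_chart_at[OF p] v] by simp
qed

lemma AH_structure_\<Gamma>: "AH_structure M (projective_class M \<Gamma>, conformal_class M h)"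
  unfolding AH_structure_def projective_structure_def conformal_structure_def fst_conv snd_conv
  using \<Gamma>_torsion_free h_metric by blast

end

text \<open>The scalar curvature of an AH structure is that of its aligned representative, measured
  with a metric of the conformal class; the conclusion therefore also records that
  \<open>induced_connection\<close> is aligned and that the pulled-back metric lies in the
  class.\<close>

theorem theorem12p2:
  fixes M :: "('m::{t2_space, second_countable_topology}, 2) chart set"
    and N :: "('p::{t2_space, second_countable_topology}, 4) chart set"
    and g J :: "('p, 4) field2"
    and f :: "'m \<Rightarrow> 'p"
    and c :: real
  assumes "smooth_manifold M"
    and "para_kaehler N g J"
    and "constant_para_holomorphic_curvature N g J (4 * c)"
    and "immersion M N f"
    and "spacelike M N g f"
    and "lagrangian M N (kaehler_form g J) f"
    and "mean_curvature_zero M N g J f"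
  shows "AH_structure M (induced_AH M N g J f)
    \<and> riemannian_AH M (induced_AH M N g J f)
    \<and> exact_AH M (induced_AH M N g J f)
    \<and> einstein_AH M (induced_AH M N g J f)
    \<and> pullback N f g \<in> snd (induced_AH M N g J f)
    \<and> aligned M (induced_AH M N g J f) (induced_connection M N g J f)
    \<and> (\<forall>x\<in>M. \<forall>p\<in>fst x.
         scalar_curvature (induced_connection M N g J f) (pullback N f g) x p = 2 * c)"
proof -
  interpret space_form_surface M N f g J c
    using assms by unfold_locales (simp_all add: para_kaehler_def immersion_def)
  show ?thesis
    unfolding induced_AH_def induced_connection_eq snd_conv
    using AH_structure_\<Gamma> riemannian_\<Gamma> exact_\<Gamma> einstein_\<Gamma> h_conformal aligned_\<Gamma> scalar_curvature_\<Gamma> by blast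
qed

end
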